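(* Let $\mathcal{F}_2$ be the field of (locally) analytic functions $f(x,y)$ of two variables, and let $\mathcal{F}_2[X,Y]$ be the ring of linear partial differential operators with coefficients in $\mathcal{F}_2$, where $X=\partial/\partial x$, $Y=\partial/\partial y$. Let $u\in\mathcal{F}_2$ and $H=-XY+u\in\mathcal{F}_2[X,Y]$. Suppose $L_1,L_2\in\mathcal{F}_2[X,Y]$ satisfy $$[L_1,L_2]=P_0\cdot H,\qquad [L_1,H]=P_1\cdot H,\qquad [L_2,H]=P_2\cdot H$$ for some $P_0,P_1,P_2\in\mathcal{F}_2[X,Y]$, where $[A,B]=A\cdot B-B\cdot A$. Then there exists a nonzero polynomial $Q(s,t)$ in two commuting variables with constant coefficients such that $Q(L_1,L_2)=S\cdot H$ for some $S\in\mathcal{F}_2[X,Y]$.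
   Context: Products of operators denote composition. Since $L_1$ and $L_2$ need not commute exactly, $Q(L_1,L_2)$ is understood with each monomial written in the fixed order $L_1^rL_2^s$, i.e. $Q(L_1,L_2)=\sum_{r,s} b_{r,s}L_1^rL_2^s$ with constants $b_{r,s}$. *)

theory Defs
  imports "HOL-Analysis.Analysis"
begin

definition analytic2 :: "(complex \<times> complex) set \<Rightarrow> (complex \<times> complex \<Rightarrow> complex) \<Rightarrow> bool" where
  "analytic2 U f \<longleftrightarrow>
     (\<forall>p\<in>U. \<exists>r>0. \<exists>c :: nat \<Rightarrow> nat \<Rightarrow> complex.
        \<forall>z w. cmod (z - fst p) < r \<and> cmod (w - snd p) < r \<longrightarrow>
          (z, w) \<in> U \<and>
          ((\<lambda>(i, j). c i j * (z - fst p) ^ i * (w - snd p) ^ j) has_sum f (z, w)) UNIV)"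

definition dX :: "(complex \<times> complex \<Rightarrow> complex) \<Rightarrow> (complex \<times> complex \<Rightarrow> complex)" where
  "dX f = (\<lambda>(z, w). deriv (\<lambda>t. f (t, w)) z)"

definition dY :: "(complex \<times> complex \<Rightarrow> complex) \<Rightarrow> (complex \<times> complex \<Rightarrow> complex)" where
  "dY f = (\<lambda>(z, w). deriv (\<lambda>t. f (z, t)) w)"

type_synonym op2 = "(complex \<times> complex \<Rightarrow> complex) \<Rightarrow> (complex \<times> complex \<Rightarrow> complex)"

text \<open>An element of F_2[X,Y]: a linear differential operator
  sum_{i,j<=N} a_ij(x,y) X^i Y^j with analytic coefficients, identified with its
  action on analytic functions on U (values on U).\<close>

definition diffop :: "(complex \<times> complex) set \<Rightarrow> op2 \<Rightarrow> bool" where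
  "diffop U T \<longleftrightarrow>
     (\<exists>(a :: nat \<Rightarrow> nat \<Rightarrow> complex \<times> complex \<Rightarrow> complex) (N :: nat).
        (\<forall>i j. analytic2 U (a i j)) \<and>
        (\<forall>g. analytic2 U g \<longrightarrow>
           (\<forall>p\<in>U. T g p = (\<Sum>i\<le>N. \<Sum>j\<le>N. a i j p * (dX ^^ i) ((dY ^^ j) g) p))))"

definition opeq :: "(complex \<times> complex) set \<Rightarrow> op2 \<Rightarrow> op2 \<Rightarrow> bool" where
  "opeq U A B \<longleftrightarrow> (\<forall>g. analytic2 U g \<longrightarrow> (\<forall>p\<in>U. A g p = B g p))"

definition comm :: "op2 \<Rightarrow> op2 \<Rightarrow> op2" where
  "comm A B = (\<lambda>g p. (A \<circ> B) g p - (B \<circ> A) g p)"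

definition Hop :: "(complex \<times> complex \<Rightarrow> complex) \<Rightarrow> op2" where
  "Hop u = (\<lambda>g p. - dX (dY g) p + u p * g p)"

definition polyop :: "nat \<Rightarrow> (nat \<Rightarrow> nat \<Rightarrow> complex) \<Rightarrow> op2 \<Rightarrow> op2 \<Rightarrow> op2" where
  "polyop N b L1 L2 = (\<lambda>g p. \<Sum>r\<le>N. \<Sum>s\<le>N. b r s * (L1 ^^ r) ((L2 ^^ s) g) p)"

end

theory Submission
  imports Defs "HOL-Computational_Algebra.Formal_Power_Series" "HOL-Complex_Analysis.Conformal_Mappings"
begin

text \<open>
  Dividing by \<open>H\<close> (with \<open>XY = u - H\<close>) brings every operator into the form
  \<open>S H + \<Sum>\<^sub>i A\<^sub>i X\<^sup>i + \<Sum>\<^sub>j B\<^sub>j Y\<^sup>j\<close>, and the coefficients \<open>A\<^sub>i\<close>, \<open>B\<^sub>j\<close> are determined by the action on the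
  space of formal power series solutions of \<open>H \<psi> = 0\<close> at one point \<open>p\<close>: a solution has arbitrary
  restrictions to the two axes through \<open>p\<close>. On this space \<open>L1\<close> and \<open>L2\<close> act and commute.

  In the generic case some \<open>L \<in> {L1, L2, L1 + L2}\<close> has orders \<open>n, m \<ge> 1\<close> in \<open>X\<close> and \<open>Y\<close>; choose \<open>p\<close> so that
  both leading coefficients are nonzero there. In terms of the coefficients of \<open>\<psi>\<close> on the axes, \<open>L\<close> is then
  a banded matrix with nonzero extreme entries, so an operator \<open>M\<close> commuting with \<open>L\<close> vanishes as soon as
  \<open>n + m\<close> coefficients of \<open>M \<psi>\<close> vanish for all \<open>\<psi>\<close>. For \<open>M = \<Sum> b\<^sub>r\<^sub>s L1\<^sup>r L2\<^sup>s\<close> with \<open>r, s \<le> N\<close> these are \<open>O(N)\<close> linear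
  conditions on \<open>(N + 1)\<^sup>2\<close> unknowns. If both operators involve only \<open>Y\<close> (or only \<open>X\<close>), the same count makes
  \<open>M \<psi>\<close> vanish on one axis, and \<open>H M \<psi> = 0\<close> then forces \<open>M = 0\<close>.
\<close>

text \<open>Formal series are used because solutions with prescribed axis data then come from a
  plain recursion, with no convergence to control. The price is a transfer: an operator is given
  only by its action on analytic functions, so identities reach formal series through polynomials,
  whose expansions are dense. Invariance and commutation are the hypotheses read on the kernel of
  \<open>H\<close>: if \<open>H \<psi> = 0\<close>, then
  \<open>H L \<psi> = L H \<psi> - P H \<psi> = 0\<close> and
  \<open>[L1, L2] \<psi> = P0 H \<psi> = 0\<close>. Connectedness of \<open>U\<close> enters twice:
  to find one \<open>p\<close> at which all leading coefficients of positive order are nonzero, and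
  to conclude that remainder coefficients with zero Taylor series at \<open>p\<close> vanish on all
  of \<open>U\<close>. The sum \<open>L1 + L2\<close> serves the case in which one operator involves
  only \<open>X\<close> and the other only \<open>Y\<close>. When \<open>X\<close> is absent from
  both, the matrix of \<open>L\<close> is banded along one axis only, so counting gives no direct
  control of the other axis; this is why that case needs a separate argument.\<close>

lemma underdetermined_system:
  fixes A :: "'e \<Rightarrow> 'i \<Rightarrow> 'a::field"
  assumes "finite E" "finite I" "card E < card I"
  shows "\<exists>x. (\<exists>i\<in>I. x i \<noteq> 0) \<and> (\<forall>e\<in>E. (\<Sum>i\<in>I. A e i * x i) = 0)"
  using assms
proof (induction E arbitrary: I A rule: finite_induct)
  case empty
  then have "I \<noteq> {}" by auto
  then show ?case by (intro exI[of _ "\<lambda>_. 1"]) auto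
next
  case (insert e E)
  show ?case
  proof (cases "\<forall>i\<in>I. A e i = 0")
    case True
    have "card E < card I" using insert by simp
    then obtain x where "\<exists>i\<in>I. x i \<noteq> 0" "\<forall>e\<in>E. (\<Sum>i\<in>I. A e i * x i) = 0"
      using insert.IH[OF insert.prems(1), of A] by blast
    then show ?thesis using True by (intro exI[of _ x]) auto
  next
    case False
    then obtain i0 where i0: "i0 \<in> I" "A e i0 \<noteq> 0" by blast
    define I' where "I' = I - {i0}"
    have I': "finite I'" "card E < card I'"
      using insert i0 by (auto simp: I'_def)
    \<comment> \<open>Gaussian elimination: \<open>B\<close> is the system left after equation
      \<open>e\<close> has been used to eliminate the unknown \<open>i0\<close>.\<close>
    define B where "B f i = A f i - A f i0 * A e i / A e i0" for f i
    obtain y where y: "\<exists>i\<in>I'. y i \<noteq> 0" "\<And>f. f \<in> E \<Longrightarrow> (\<Sum>i\<in>I'. B f i * y i) = 0"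
      using insert.IH[OF I', of B] by blast
    define s where "s = (\<Sum>i\<in>I'. A e i * y i)"
    define x where "x = y(i0 := - s / A e i0)"
    have split: "(\<Sum>i\<in>I. A f i * x i) = A f i0 * (- s / A e i0) + (\<Sum>i\<in>I'. A f i * y i)" for f
    proof -
      have "(\<Sum>i\<in>I. A f i * x i) = A f i0 * x i0 + (\<Sum>i\<in>I'. A f i * x i)"
        unfolding I'_def using insert.prems(1) i0(1) by (simp add: sum.remove)
      moreover have "(\<Sum>i\<in>I'. A f i * x i) = (\<Sum>i\<in>I'. A f i * y i)"
        by (rule sum.cong) (auto simp: x_def I'_def)
      ultimately show ?thesis by (simp add: x_def)
    qed
    have "(\<Sum>i\<in>I. A f i * x i) = 0" if "f \<in> insert e E" for f
    proof (cases "f = e")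
      case True
      then show ?thesis unfolding split using i0 by (simp add: s_def)
    next
      case False
      then have "(\<Sum>i\<in>I'. B f i * y i) = 0" using y(2) that by auto
      also have "(\<Sum>i\<in>I'. B f i * y i) = (\<Sum>i\<in>I'. A f i * y i) - A f i0 / A e i0 * s"
        by (simp add: B_def s_def sum_subtractf sum_distrib_left algebra_simps)
      finally show ?thesis unfolding split by (simp add: field_simps)
    qed
    moreover have "\<exists>i\<in>I. x i \<noteq> 0"
      using y(1) by (auto simp: I'_def x_def)
    ultimately show ?thesis by blast
  qed
qed

section \<open>Formal power series in two variables\<close>

type_synonym ps2 = "complex fps fps"

abbreviation cf :: "ps2 \<Rightarrow> nat \<Rightarrow> nat \<Rightarrow> complex" where
  "cf f i j \<equiv> fps_nth (fps_nth f i) j"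

definition ps2_of :: "(nat \<Rightarrow> nat \<Rightarrow> complex) \<Rightarrow> ps2" where
  "ps2_of c = Abs_fps (\<lambda>i. Abs_fps (c i))"

lemma cf_ps2_of [simp]: "cf (ps2_of c) i j = c i j"
  by (simp add: ps2_of_def)

lemma ps2_eqI: "(\<And>i j. cf f i j = cf g i j) \<Longrightarrow> f = g"
  by (simp add: fps_eq_iff)

lemma cf_mult: "cf (f * g) i j = (\<Sum>k\<le>i. \<Sum>l\<le>j. cf f k l * cf g (i - k) (j - l))"
  by (simp add: fps_mult_nth fps_sum_nth atLeast0AtMost)

lemma cf_sum [simp]: "cf (sum f I) i j = (\<Sum>k\<in>I. cf (f k) i j)"
  by (simp add: fps_sum_nth)

definition cst :: "complex \<Rightarrow> ps2" where "cst c = fps_const (fps_const c)"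

lemma cf_cst_mult [simp]: "cf (cst c * f) i j = c * cf f i j"
  by (simp add: cst_def)

lemma cf_cst: "cf (cst c) i j = (if i = 0 \<and> j = 0 then c else 0)"
  by (simp add: cst_def)

lemma cst_0 [simp]: "cst 0 = 0" and cst_1 [simp]: "cst 1 = 1"
  by (simp_all add: cst_def)

text \<open>The symmetry between the two variables: facts about \<open>Dy\<close> and the y-axis are
  obtained from those about \<open>Dx\<close> and the x-axis by conjugation with it.\<close>

definition swap :: "ps2 \<Rightarrow> ps2" where "swap f = ps2_of (\<lambda>i j. cf f j i)"

lemma cf_swap [simp]: "cf (swap f) i j = cf f j i"
  by (simp add: swap_def)

lemma swap_swap [simp]: "swap (swap f) = f"
  by (rule ps2_eqI) simp

lemma swap_add [simp]: "swap (f + g) = swap f + swap g"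
  by (rule ps2_eqI) simp

lemma swap_mult [simp]: "swap (f * g) = swap f * swap g"
  by (rule ps2_eqI, simp only: cf_swap cf_mult, rule sum.swap)

lemma swap_sum [simp]: "swap (sum f I) = (\<Sum>k\<in>I. swap (f k))"
  by (rule ps2_eqI) simp

lemma swap_cst [simp]: "swap (cst c) = cst c"
  by (rule ps2_eqI) (simp add: cf_cst)

lemma swap_0 [simp]: "swap 0 = 0"
  by (rule ps2_eqI) simp

lemma swap_eq_iff [simp]: "swap f = swap g \<longleftrightarrow> f = g"
  by (metis swap_swap)

definition Dx :: "ps2 \<Rightarrow> ps2" where
  "Dx f = ps2_of (\<lambda>i j. of_nat (Suc i) * cf f (Suc i) j)"

definition Dy :: "ps2 \<Rightarrow> ps2" where
  "Dy f = ps2_of (\<lambda>i j. of_nat (Suc j) * cf f i (Suc j))"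

lemma cf_Dx: "cf (Dx f) i j = of_nat (Suc i) * cf f (Suc i) j"
  and cf_Dy: "cf (Dy f) i j = of_nat (Suc j) * cf f i (Suc j)"
  by (simp_all only: Dx_def Dy_def cf_ps2_of)

lemma swap_Dx [simp]: "swap (Dx f) = Dy (swap f)" and swap_Dy [simp]: "swap (Dy f) = Dx (swap f)"
  by (rule ps2_eqI; simp only: cf_swap cf_Dx cf_Dy)+

lemma Dx_mult: "Dx (f * g) = Dx f * g + f * Dx g"
proof -
  have "Dx f = fps_deriv f" for f
    by (rule ps2_eqI) (simp add: cf_Dx fps_of_nat[symmetric] del: of_nat_Suc)
  then show ?thesis by (simp add: algebra_simps)
qed

lemma Dy_mult: "Dy (f * g) = Dy f * g + f * Dy g"
proof -
  have "swap (Dy (f * g)) = swap (Dy f * g + f * Dy g)"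
    by (simp add: Dx_mult)
  then show ?thesis by (simp only: swap_eq_iff)
qed

lemma Dx_add [simp]: "Dx (f + g) = Dx f + Dx g"
  and Dy_add [simp]: "Dy (f + g) = Dy f + Dy g"
  by (rule ps2_eqI; simp add: cf_Dx cf_Dy algebra_simps)+

lemma Dx_cst_mult [simp]: "Dx (cst c * f) = cst c * Dx f"
  and Dy_cst_mult [simp]: "Dy (cst c * f) = cst c * Dy f"
  by (rule ps2_eqI; simp add: cf_Dx cf_Dy)+

lemma Dx_0 [simp]: "Dx 0 = 0" and Dy_0 [simp]: "Dy 0 = 0"
  by (rule ps2_eqI; simp add: cf_Dx cf_Dy)+

lemma Dx_sum [simp]: "Dx (sum f I) = (\<Sum>k\<in>I. Dx (f k))"
  and Dy_sum [simp]: "Dy (sum f I) = (\<Sum>k\<in>I. Dy (f k))"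
  by (induction I rule: infinite_finite_induct; simp)+

lemma Dx_Dy: "Dx (Dy f) = Dy (Dx f)"
  by (rule ps2_eqI) (simp add: cf_Dx cf_Dy)

lemma cf_Dx_pow: "cf ((Dx ^^ n) f) i j = fact (i + n) / fact i * cf f (i + n) j"
proof (induction n arbitrary: i)
  case (Suc n)
  have "cf ((Dx ^^ Suc n) f) i j = of_nat (Suc i) * cf ((Dx ^^ n) f) (Suc i) j"
    by (simp only: funpow.simps o_apply cf_Dx)
  also have "\<dots> = fact (i + Suc n) / fact i * cf f (i + Suc n) j"
    unfolding Suc.IH by (simp add: fact_Suc[of i] del: of_nat_Suc)
  finally show ?case .
qed simp

lemma swap_Dy_pow [simp]: "swap ((Dy ^^ n) f) = (Dx ^^ n) (swap f)"
  and swap_Dx_pow [simp]: "swap ((Dx ^^ n) f) = (Dy ^^ n) (swap f)"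
  by (induction n) simp_all

lemma cf_Dy_pow: "cf ((Dy ^^ n) f) i j = fact (j + n) / fact j * cf f i (j + n)"
proof -
  have "cf ((Dy ^^ n) f) i j = cf ((Dx ^^ n) (swap f)) j i"
    by (metis cf_swap swap_Dy_pow)
  then show ?thesis by (simp add: cf_Dx_pow)
qed

section \<open>Formal solutions of the equation\<close>

text \<open>The formal kernel of \<open>H = -XY + u\<close>; later \<open>u\<close> is the Taylor
  series of the coefficient function at the chosen point.\<close>

definition sol :: "ps2 \<Rightarrow> ps2 set" where
  "sol u = {\<psi>. Dx (Dy \<psi>) = u * \<psi>}"

lemma sol_swap: "\<psi> \<in> sol (swap u) \<longleftrightarrow> swap \<psi> \<in> sol u"
proof -
  have "swap \<psi> \<in> sol u \<longleftrightarrow> swap (Dx (Dy (swap \<psi>))) = swap (u * swap \<psi>)"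
    by (simp only: sol_def swap_eq_iff mem_Collect_eq)
  also have "\<dots> \<longleftrightarrow> \<psi> \<in> sol (swap u)"
    by (simp only: sol_def Dx_Dy[of \<psi>] swap_mult swap_Dx swap_Dy swap_swap mem_Collect_eq)
  finally show ?thesis ..
qed

lemma sol_0 [simp]: "0 \<in> sol u"
  by (simp add: sol_def)

lemma sol_add: "f \<in> sol u \<Longrightarrow> g \<in> sol u \<Longrightarrow> f + g \<in> sol u"
  by (simp add: sol_def algebra_simps)

lemma sol_cst_mult: "f \<in> sol u \<Longrightarrow> cst c * f \<in> sol u"
  by (simp add: sol_def)

lemma sol_sum: "(\<And>i. i \<in> I \<Longrightarrow> f i \<in> sol u) \<Longrightarrow> sum f I \<in> sol u"
  by (induction I rule: infinite_finite_induct) (auto intro: sol_add)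

text \<open>Read as a recursion, this computes every coefficient off the axes from coefficients with
  smaller indices.\<close>

lemma sol_coeff:
  assumes "\<psi> \<in> sol u"
  shows "of_nat (Suc i) * of_nat (Suc j) * cf \<psi> (Suc i) (Suc j) =
         (\<Sum>k\<le>i. \<Sum>l\<le>j. cf u k l * cf \<psi> (i - k) (j - l))"
proof -
  have "cf (Dx (Dy \<psi>)) i j = cf (u * \<psi>) i j" using assms by (simp add: sol_def)
  then show ?thesis by (simp only: cf_Dx cf_Dy cf_mult mult.assoc)
qed

text \<open>A solution is determined by its restrictions to the two coordinate axes; they are indexed
  together by the integers.\<close>

definition ev :: "int \<Rightarrow> ps2 \<Rightarrow> complex" where
  "ev l \<psi> = (if l \<ge> 0 then cf \<psi> (nat l) 0 else cf \<psi> 0 (nat (- l)))"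

lemma ev_of_nat [simp]: "ev (int k) \<psi> = cf \<psi> k 0"
  by (simp add: ev_def)

lemma ev_minus_of_nat [simp]: "ev (- int k) \<psi> = cf \<psi> 0 k"
  by (cases "k = 0") (simp_all add: ev_def)

lemma ev_swap: "ev l (swap \<psi>) = ev (- l) \<psi>"
  by (auto simp: ev_def)

lemma ev_add [simp]: "ev l (f + g) = ev l f + ev l g"
  and ev_cst_mult [simp]: "ev l (cst c * f) = c * ev l f"
  and ev_sum [simp]: "ev l (sum h I) = (\<Sum>i\<in>I. ev l (h i))"
  by (simp_all add: ev_def del: fps_mult_nth_0)

lemma ev_0 [simp]: "ev l 0 = 0"
  by (simp add: ev_def)

text \<open>Row \<open>i\<close> is the coefficient of the \<open>i\<close>-th power of
  \<open>x\<close>, as a series in \<open>y\<close>. The equation prescribes the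
  \<open>y\<close>-derivative of the next row in terms of the earlier ones, and the prescribed value
  on the x-axis is the constant of integration.\<close>

fun sol_row :: "(nat \<Rightarrow> complex) \<Rightarrow> (nat \<Rightarrow> complex) \<Rightarrow> ps2 \<Rightarrow> nat \<Rightarrow> complex fps" where
  "sol_row \<phi> \<eta> u 0 = Abs_fps \<eta>"
| "sol_row \<phi> \<eta> u (Suc i) =
     fps_integral (fps_const (1 / of_nat (Suc i)) * (\<Sum>k\<le>i. fps_nth u (i - k) * sol_row \<phi> \<eta> u k)) (\<phi> (Suc i))"

lemma solution_exists:
  assumes "\<phi> 0 = \<eta> 0"
  obtains \<psi> where "\<psi> \<in> sol u" "\<And>i. cf \<psi> i 0 = \<phi> i" "\<And>j. cf \<psi> 0 j = \<eta> j"
proof -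
  define \<psi> where "\<psi> = Abs_fps (sol_row \<phi> \<eta> u)"
  have n: "fps_nth \<psi> i = sol_row \<phi> \<eta> u i" for i by (simp add: \<psi>_def)
  have a: "cf \<psi> i 0 = \<phi> i" for i
    by (cases i) (use assms in \<open>simp_all add: n fps_integral_def\<close>)
  have b: "cf \<psi> 0 j = \<eta> j" for j by (simp add: n)
  have "Dx (Dy \<psi>) = u * \<psi>"
  proof (rule ps2_eqI)
    fix i j
    have "cf (u * \<psi>) i j = fps_nth (\<Sum>k\<le>i. fps_nth u (i - k) * fps_nth \<psi> k) j"
      by (simp add: mult.commute[of u] fps_mult_nth[of \<psi>] atLeast0AtMost mult.commute)
    moreover have "cf (Dx (Dy \<psi>)) i j = of_nat (Suc i) * of_nat (Suc j) * cf \<psi> (Suc i) (Suc j)"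
      by (simp only: cf_Dx cf_Dy mult.assoc)
    moreover have "of_nat (Suc j) * cf \<psi> (Suc i) (Suc j) =
       (1 / of_nat (Suc i)) * fps_nth (\<Sum>k\<le>i. fps_nth u (i - k) * fps_nth \<psi> k) j"
      by (simp add: n fps_integral_def del: of_nat_Suc)
    ultimately show "cf (Dx (Dy \<psi>)) i j = cf (u * \<psi>) i j"
      by (simp add: mult.assoc del: of_nat_Suc)
  qed
  then have "\<psi> \<in> sol u" by (simp add: sol_def)
  then show ?thesis using a b that by blast
qed

text \<open>Indexing both axes by one integer makes the compatibility at the origin automatic,
  because they share the index \<open>0\<close>.\<close>

lemma solution_exists_ev:
  obtains \<psi> where "\<psi> \<in> sol u" "\<And>l. ev l \<psi> = d l"
proof -
  obtain \<psi> where "\<psi> \<in> sol u" "\<And>i. cf \<psi> i 0 = d (int i)" "\<And>j. cf \<psi> 0 j = d (- int j)"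
    using solution_exists[of "\<lambda>i. d (int i)" "\<lambda>j. d (- int j)" u] by auto
  then show ?thesis using that by (auto simp: ev_def)
qed

text \<open>The interval records how far a functional reaches along the two axes, and thus the
  bandwidth of an operator. Agreement is asked only on solutions, where the axis coefficients
  determine everything.\<close>

definition ev_span :: "ps2 \<Rightarrow> int \<Rightarrow> int \<Rightarrow> (ps2 \<Rightarrow> complex) \<Rightarrow> bool" where
  "ev_span u lo hi \<phi> \<longleftrightarrow> (\<exists>c. \<forall>\<psi>\<in>sol u. \<phi> \<psi> = (\<Sum>l\<in>{lo..hi}. c l * ev l \<psi>))"

lemma ev_span_cong: "ev_span u lo hi \<phi> \<Longrightarrow> (\<And>\<psi>. \<psi> \<in> sol u \<Longrightarrow> \<phi> \<psi> = \<phi>' \<psi>) \<Longrightarrow> ev_span u lo hi \<phi>'"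
  unfolding ev_span_def by simp

lemma ev_span_0 [simp]: "ev_span u lo hi (\<lambda>_. 0)"
  unfolding ev_span_def by (intro exI[of _ "\<lambda>_. 0"]) simp

lemma ev_span_add: "ev_span u lo hi \<phi> \<Longrightarrow> ev_span u lo hi \<phi>' \<Longrightarrow> ev_span u lo hi (\<lambda>\<psi>. \<phi> \<psi> + \<phi>' \<psi>)"
  unfolding ev_span_def
proof (elim exE)
  fix c d
  assume "\<forall>\<psi>\<in>sol u. \<phi> \<psi> = (\<Sum>l = lo..hi. c l * ev l \<psi>)" "\<forall>\<psi>\<in>sol u. \<phi>' \<psi> = (\<Sum>l = lo..hi. d l * ev l \<psi>)"
  then show "\<exists>c. \<forall>\<psi>\<in>sol u. \<phi> \<psi> + \<phi>' \<psi> = (\<Sum>l = lo..hi. c l * ev l \<psi>)"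
    by (intro exI[of _ "\<lambda>l. c l + d l"]) (simp add: algebra_simps sum.distrib)
qed

lemma ev_span_mult: "ev_span u lo hi \<phi> \<Longrightarrow> ev_span u lo hi (\<lambda>\<psi>. a * \<phi> \<psi>)"
  unfolding ev_span_def
proof (elim exE)
  fix c
  assume "\<forall>\<psi>\<in>sol u. \<phi> \<psi> = (\<Sum>l = lo..hi. c l * ev l \<psi>)"
  then show "\<exists>c. \<forall>\<psi>\<in>sol u. a * \<phi> \<psi> = (\<Sum>l = lo..hi. c l * ev l \<psi>)"
    by (intro exI[of _ "\<lambda>l. a * c l"]) (simp add: algebra_simps sum_distrib_left)
qed

lemma ev_span_sum: "(\<And>i. i \<in> I \<Longrightarrow> ev_span u lo hi (\<phi> i)) \<Longrightarrow> ev_span u lo hi (\<lambda>\<psi>. \<Sum>i\<in>I. \<phi> i \<psi>)"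
  by (induction I rule: infinite_finite_induct) (auto intro: ev_span_add)

lemma ev_span_ev: "lo \<le> l \<Longrightarrow> l \<le> hi \<Longrightarrow> ev_span u lo hi (ev l)"
  unfolding ev_span_def
  by (intro exI[of _ "\<lambda>k. if k = l then 1 else 0"]) (simp add: if_distrib[of "\<lambda>x. x * _"] sum.delta cong: if_cong)

lemma ev_span_mono:
  assumes "ev_span u lo hi \<phi>" "lo' \<le> lo" "hi \<le> hi'"
  shows "ev_span u lo' hi' \<phi>"
proof -
  obtain c where c: "\<forall>\<psi>\<in>sol u. \<phi> \<psi> = (\<Sum>l\<in>{lo..hi}. c l * ev l \<psi>)" using assms unfolding ev_span_def by blast
  have "ev_span u lo' hi' (\<lambda>\<psi>. \<Sum>l\<in>{lo..hi}. c l * ev l \<psi>)"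
    by (intro ev_span_sum ev_span_mult ev_span_ev) (use assms in auto)
  then show ?thesis by (rule ev_span_cong) (use c in auto)
qed

lemma ev_span_vanish:
  assumes "ev_span u lo hi \<phi>" "\<psi> \<in> sol u" "\<And>l. lo \<le> l \<Longrightarrow> l \<le> hi \<Longrightarrow> ev l \<psi> = 0"
  shows "\<phi> \<psi> = 0"
  using assms unfolding ev_span_def by auto

text \<open>The recursion \<open>sol_coeff\<close> never leaves the rectangle between the origin and
  \<open>(i, j)\<close>, so it meets the x-axis up to \<open>i\<close> and the y-axis up to
  \<open>j\<close>.\<close>

lemma ev_span_cf: "ev_span u (- int j) (int i) (\<lambda>\<psi>. cf \<psi> i j)"
proof (induction "i + j" arbitrary: i j rule: less_induct)
  case less
  show ?case
  proof (cases "i = 0 \<or> j = 0")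
    case True
    then show ?thesis
    proof
      assume "i = 0"
      then show ?thesis using ev_span_cong[OF ev_span_ev[of "- int j" "- int j" 0 u], of "\<lambda>\<psi>. cf \<psi> 0 j"] by simp
    next
      assume "j = 0"
      then show ?thesis using ev_span_cong[OF ev_span_ev[of 0 "int i" "int i" u], of "\<lambda>\<psi>. cf \<psi> i 0"] by simp
    qed
  next
    case False
    then obtain i' j' where ij: "i = Suc i'" "j = Suc j'" by (metis not0_implies_Suc)
    have "ev_span u (- int j) (int i) (\<lambda>\<psi>. (\<Sum>k\<le>i'. \<Sum>l\<le>j'. cf u k l * cf \<psi> (i' - k) (j' - l)))"
    proof (intro ev_span_sum ev_span_mult)
      fix k l
      show "ev_span u (- int j) (int i) (\<lambda>\<psi>. cf \<psi> (i' - k) (j' - l))"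
        by (rule ev_span_mono[OF less]) (auto simp: ij)
    qed
    then have "ev_span u (- int j) (int i) (\<lambda>\<psi>. 1 / (of_nat i * of_nat j) *
       (\<Sum>k\<le>i'. \<Sum>l\<le>j'. cf u k l * cf \<psi> (i' - k) (j' - l)))" by (rule ev_span_mult)
    then show ?thesis
      by (rule ev_span_cong) (subst sol_coeff[symmetric], assumption, simp add: ij del: of_nat_Suc)
  qed
qed

lemma sol_eq_0I:
  assumes "\<psi> \<in> sol u" "\<And>l. ev l \<psi> = 0"
  shows "\<psi> = 0"
  by (rule ps2_eqI) (use ev_span_vanish[OF ev_span_cf assms(1)] assms(2) in simp)

text \<open>This is uniqueness of the remainder under division by \<open>H\<close>. Coefficients of
  \<open>A\<close> and \<open>B\<close> are shown to vanish by induction on total degree: at the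
  lowest remaining degree only the constant terms of the derivatives of \<open>\<psi>\<close>
  matter, and these are free axis data.\<close>

lemma normal_form_free:
  assumes z: "\<And>\<psi>. \<psi> \<in> sol u \<Longrightarrow> (\<Sum>i\<le>n. A i * (Dx ^^ i) \<psi>) + (\<Sum>j\<in>{1..m}. B j * (Dy ^^ j) \<psi>) = 0"
  shows "(\<forall>i\<le>n. A i = 0) \<and> (\<forall>j\<in>{1..m}. B j = 0)"
proof -
  have "(\<forall>i\<le>n. cf (A i) s t = 0) \<and> (\<forall>j\<in>{1..m}. cf (B j) s t = 0)" for s t
  proof (induction "s + t" arbitrary: s t rule: less_induct)
    case less
    \<comment> \<open>All coefficients of \<open>C\<close> of smaller total degree vanish, so a
      single term of the product survives.\<close>
    have lead: "cf (C * f) s t = cf C s t * cf f 0 0"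
      if "\<And>s' t'. s' + t' < s + t \<Longrightarrow> cf C s' t' = 0" for C f
    proof -
      have "cf C k l * cf f (s - k) (t - l) = (if k = s \<and> l = t then cf C s t * cf f 0 0 else 0)"
        if "k \<le> s" "l \<le> t" for k l
      proof (cases "k = s \<and> l = t")
        case False
        then have "k + l < s + t" using that by linarith
        then show ?thesis using False by (auto simp: \<open>\<And>s' t'. s' + t' < s + t \<Longrightarrow> cf C s' t' = 0\<close>)
      qed simp
      then have "cf (C * f) s t = (\<Sum>k\<le>s. \<Sum>l\<le>t. if k = s \<and> l = t then cf C s t * cf f 0 0 else 0)"
        unfolding cf_mult by (intro sum.cong refl) auto
      also have "\<dots> = (\<Sum>k\<le>s. if k = s then cf C s t * cf f 0 0 else 0)"
        by (intro sum.cong refl) auto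
      finally show ?thesis by simp
    qed
    have eq: "(\<Sum>i\<le>n. cf (A i) s t * (fact i * ev (int i) \<psi>)) +
          (\<Sum>j\<in>{1..m}. cf (B j) s t * (fact j * ev (- int j) \<psi>)) = 0" if "\<psi> \<in> sol u" for \<psi>
    proof -
      have "0 = cf ((\<Sum>i\<le>n. A i * (Dx ^^ i) \<psi>) + (\<Sum>j\<in>{1..m}. B j * (Dy ^^ j) \<psi>)) s t"
        using z[OF that] by simp
      also have "\<dots> = (\<Sum>i\<le>n. cf (A i * (Dx ^^ i) \<psi>) s t) + (\<Sum>j\<in>{1..m}. cf (B j * (Dy ^^ j) \<psi>) s t)"
        by simp
      also have "(\<Sum>i\<le>n. cf (A i * (Dx ^^ i) \<psi>) s t) = (\<Sum>i\<le>n. cf (A i) s t * (fact i * ev (int i) \<psi>))"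
        by (intro sum.cong refl, subst lead) (use less in \<open>auto simp: cf_Dx_pow\<close>)
      also have "(\<Sum>j\<in>{1..m}. cf (B j * (Dy ^^ j) \<psi>) s t) =
          (\<Sum>j\<in>{1..m}. cf (B j) s t * (fact j * ev (- int j) \<psi>))"
        by (intro sum.cong refl, subst lead) (use less in \<open>auto simp: cf_Dy_pow\<close>)
      finally show ?thesis by simp
    qed
    have "cf (A i) s t = 0" if "i \<le> n" for i
    proof -
      \<comment> \<open>A solution with a single nonzero axis coefficient isolates the term of
        \<open>A i\<close>.\<close>
      obtain \<psi> where \<psi>: "\<psi> \<in> sol u" "\<And>l. ev l \<psi> = (if l = int i then 1 else 0)"
        using solution_exists_ev[of u "\<lambda>l. if l = int i then 1 else 0"] by blast
      have "(\<Sum>k\<le>n. cf (A k) s t * (fact k * ev (int k) \<psi>)) = (\<Sum>k\<le>n. if k = i then cf (A i) s t * fact i else 0)"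
        by (intro sum.cong refl) (auto simp only: \<psi>(2) of_nat_eq_iff mult_1_right mult_zero_right split: if_splits)
      moreover have "(\<Sum>k\<in>{1..m}. cf (B k) s t * (fact k * ev (- int k) \<psi>)) = 0"
        by (intro sum.neutral) (auto simp: \<psi>(2) simp del: ev_minus_of_nat)
      ultimately show ?thesis using eq[OF \<psi>(1)] that by simp
    qed
    moreover have "cf (B j) s t = 0" if "j \<in> {1..m}" for j
    proof -
      obtain \<psi> where \<psi>: "\<psi> \<in> sol u" "\<And>l. ev l \<psi> = (if l = - int j then 1 else 0)"
        using solution_exists_ev[of u "\<lambda>l. if l = - int j then 1 else 0"] by blast
      have "(\<Sum>k\<in>{1..m}. cf (B k) s t * (fact k * ev (- int k) \<psi>)) =
          (\<Sum>k\<in>{1..m}. if k = j then cf (B j) s t * fact j else 0)"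
        by (intro sum.cong refl) (auto simp only: \<psi>(2) of_nat_eq_iff mult_1_right mult_zero_right neg_equal_iff_equal split: if_splits)
      moreover have "(\<Sum>k\<le>n. cf (A k) s t * (fact k * ev (int k) \<psi>)) = 0"
        by (intro sum.neutral) (use that in \<open>auto simp: \<psi>(2) simp del: ev_of_nat\<close>)
      ultimately show ?thesis using eq[OF \<psi>(1)] that by simp
    qed
    ultimately show ?case by blast
  qed
  then show ?thesis by (auto intro!: ps2_eqI)
qed

section \<open>Normal forms and their leading terms along the axes\<close>

definition nf :: "(nat \<Rightarrow> ps2) \<Rightarrow> nat \<Rightarrow> (nat \<Rightarrow> ps2) \<Rightarrow> nat \<Rightarrow> ps2 \<Rightarrow> ps2" where
  "nf A n B m \<psi> = (\<Sum>i\<le>n. A i * (Dx ^^ i) \<psi>) + (\<Sum>j\<in>{1..m}. B j * (Dy ^^ j) \<psi>)"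

text \<open>In \<open>nf\<close> the second sum starts at \<open>1\<close>, so that the order-zero
  term occurs once and the form is unique. Under the exchange this term has to stay in the first
  family, hence the case distinction at \<open>0\<close>.\<close>

lemma swap_nf:
  "swap (nf A n B m \<psi>) =
     nf (\<lambda>j. if j = 0 then swap (A 0) else swap (B j)) m (\<lambda>i. swap (A i)) n (swap \<psi>)"
proof -
  have 1: "{..k} = insert 0 {1..k}" for k :: nat by auto
  show ?thesis by (simp add: nf_def 1[of n] 1[of m] algebra_simps)
qed

lemma ev_span_swap:
  assumes "ev_span (swap u) lo hi \<phi>"
  shows "ev_span u (- hi) (- lo) (\<lambda>\<psi>. \<phi> (swap \<psi>))"
proof -
  obtain c where c: "\<forall>\<psi>\<in>sol (swap u). \<phi> \<psi> = (\<Sum>l\<in>{lo..hi}. c l * ev l \<psi>)"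
    using assms unfolding ev_span_def by blast
  have "ev_span u (- hi) (- lo) (\<lambda>\<psi>. \<Sum>l\<in>{lo..hi}. c l * ev (- l) \<psi>)"
    by (intro ev_span_sum ev_span_mult ev_span_ev) auto
  then show ?thesis
    by (rule ev_span_cong) (use c sol_swap[of "swap _" u] in \<open>auto simp: ev_swap\<close>)
qed

lemma ev_span_x_term: "ev_span u (- int l) (int (k + i)) (\<lambda>\<psi>. cf (C * (Dx ^^ i) \<psi>) k l)"
  unfolding cf_mult cf_Dx_pow
  by (intro ev_span_sum ev_span_mult ev_span_mono[OF ev_span_cf]) auto

lemma ev_span_y_term: "ev_span u (- int (l + j)) (int k) (\<lambda>\<psi>. cf (C * (Dy ^^ j) \<psi>) k l)"
  unfolding cf_mult cf_Dy_pow
  by (intro ev_span_sum ev_span_mult ev_span_mono[OF ev_span_cf]) auto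

lemma ev_span_nf: "ev_span u (- int (l + m)) (int (k + n)) (\<lambda>\<psi>. cf (nf A n B m \<psi>) k l)"
  unfolding nf_def fps_add_nth cf_sum
  by (intro ev_span_add ev_span_sum ev_span_mono[OF ev_span_x_term] ev_span_mono[OF ev_span_y_term]) auto

text \<open>A crude symmetric window is enough for counting: each application of the operator widens
  it by a constant.\<close>

lemma ev_span_ev_nf: "ev_span u (- (\<bar>l\<bar> + int (n + m))) (\<bar>l\<bar> + int (n + m)) (\<lambda>\<psi>. ev l (nf A n B m \<psi>))"
  unfolding ev_def by (cases "l \<ge> 0") (auto intro!: ev_span_mono[OF ev_span_nf])

text \<open>The index \<open>k + n\<close> is reached only by the constant term of
  \<open>A n\<close> against the highest derivative. Higher terms of \<open>A n\<close> and lower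
  powers of \<open>Dx\<close> fall short of it, and the \<open>Dy\<close> terms reach at most
  \<open>k\<close>, which is smaller because \<open>n \<ge> 1\<close>.\<close>

lemma nf_lead_x:
  assumes "n \<ge> 1"
  shows "ev_span u (- int m) (int (k + n) - 1)
     (\<lambda>\<psi>. cf (nf A n B m \<psi>) k 0 - cf (A n) 0 0 * fact (k + n) / fact k * cf \<psi> (k + n) 0)"
proof -
  have top: "cf (A n * (Dx ^^ n) \<psi>) k 0 = cf (A n) 0 0 * fact (k + n) / fact k * cf \<psi> (k + n) 0 +
      (\<Sum>s\<in>{1..k}. cf (A n) s 0 * cf ((Dx ^^ n) \<psi>) (k - s) 0)" for \<psi>
  proof -
    have "{..k} = insert 0 {1..k}" by auto
    then show ?thesis by (simp add: cf_mult cf_Dx_pow)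
  qed
  have split: "nf A n B m \<psi> = A n * (Dx ^^ n) \<psi> + (\<Sum>i<n. A i * (Dx ^^ i) \<psi>) +
      (\<Sum>j\<in>{1..m}. B j * (Dy ^^ j) \<psi>)" for \<psi>
    by (simp add: nf_def flip: lessThan_Suc_atMost)
  have "ev_span u (- int m) (int (k + n) - 1) (\<lambda>\<psi>.
      (\<Sum>s\<in>{1..k}. cf (A n) s 0 * cf ((Dx ^^ n) \<psi>) (k - s) 0) +
      (\<Sum>i<n. cf (A i * (Dx ^^ i) \<psi>) k 0) + (\<Sum>j\<in>{1..m}. cf (B j * (Dy ^^ j) \<psi>) k 0))"
    unfolding cf_Dx_pow[of n]
    by (intro ev_span_add ev_span_sum ev_span_mult ev_span_mono[OF ev_span_x_term] ev_span_mono[OF ev_span_y_term] ev_span_mono[OF ev_span_cf])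
       (use assms in auto)
  then show ?thesis
    by (rule ev_span_cong) (simp add: split top)
qed

lemma nf_lead_y:
  assumes "m \<ge> 1"
  shows "ev_span u (1 - int (k + m)) (int n)
     (\<lambda>\<psi>. cf (nf A n B m \<psi>) 0 k - cf (B m) 0 0 * fact (k + m) / fact k * cf \<psi> 0 (k + m))"
proof -
  have "cf (nf A n B m \<psi>) 0 k = cf (swap (nf A n B m \<psi>)) k 0" for \<psi> by simp
  then show ?thesis
    using ev_span_swap[OF nf_lead_x[OF assms, of "swap u" n k
      "\<lambda>j. if j = 0 then swap (A 0) else swap (B j)" "\<lambda>i. swap (A i)"]] assms
    by (simp add: swap_nf)
qed

section \<open>Operators commuting on the solutions\<close>

definition lin :: "(ps2 \<Rightarrow> ps2) \<Rightarrow> bool" where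
  "lin F \<longleftrightarrow> (\<forall>f g. F (f + g) = F f + F g) \<and> (\<forall>c f. F (cst c * f) = cst c * F f)"

lemma lin_add: "lin F \<Longrightarrow> F (f + g) = F f + F g"
  and lin_cst_mult: "lin F \<Longrightarrow> F (cst c * f) = cst c * F f"
  by (simp_all add: lin_def)

lemma lin_0: "lin F \<Longrightarrow> F 0 = 0"
  using lin_cst_mult[of F 0 0] by simp

lemma lin_sum: "lin F \<Longrightarrow> F (sum h I) = (\<Sum>i\<in>I. F (h i))"
  by (induction I rule: infinite_finite_induct) (auto simp: lin_0 lin_add)

definition polyK :: "nat \<Rightarrow> (nat \<Rightarrow> nat \<Rightarrow> complex) \<Rightarrow> (ps2 \<Rightarrow> ps2) \<Rightarrow> (ps2 \<Rightarrow> ps2) \<Rightarrow> ps2 \<Rightarrow> ps2" where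
  "polyK N b L1 L2 \<psi> = (\<Sum>r\<le>N. \<Sum>s\<le>N. cst (b r s) * (L1 ^^ r) ((L2 ^^ s) \<psi>))"

lemma sol_funpow:
  assumes "\<And>\<psi>. \<psi> \<in> sol u \<Longrightarrow> L \<psi> \<in> sol u" "\<psi> \<in> sol u"
  shows "(L ^^ r) \<psi> \<in> sol u"
  by (induction r) (use assms in auto)

lemma sol_polyK:
  assumes "\<And>\<psi>. \<psi> \<in> sol u \<Longrightarrow> L1 \<psi> \<in> sol u" "\<And>\<psi>. \<psi> \<in> sol u \<Longrightarrow> L2 \<psi> \<in> sol u" "\<psi> \<in> sol u"
  shows "polyK N b L1 L2 \<psi> \<in> sol u"
  unfolding polyK_def by (intro sol_sum sol_cst_mult sol_funpow assms) auto

lemma commute_funpow: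
  assumes "\<And>\<psi>. \<psi> \<in> sol u \<Longrightarrow> F \<psi> \<in> sol u"
    and "\<And>\<psi>. \<psi> \<in> sol u \<Longrightarrow> L (F \<psi>) = F (L \<psi>)" and "\<psi> \<in> sol u"
  shows "L ((F ^^ r) \<psi>) = (F ^^ r) (L \<psi>)"
  by (induction r) (use assms sol_funpow[OF assms(1)] in auto)

lemma commute_polyK:
  assumes "lin L"
    and sol: "\<And>\<psi>. \<psi> \<in> sol u \<Longrightarrow> L \<psi> \<in> sol u" "\<And>\<psi>. \<psi> \<in> sol u \<Longrightarrow> L1 \<psi> \<in> sol u" "\<And>\<psi>. \<psi> \<in> sol u \<Longrightarrow> L2 \<psi> \<in> sol u"
    and "\<And>\<psi>. \<psi> \<in> sol u \<Longrightarrow> L (L1 \<psi>) = L1 (L \<psi>)" "\<And>\<psi>. \<psi> \<in> sol u \<Longrightarrow> L (L2 \<psi>) = L2 (L \<psi>)"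
    and "\<psi> \<in> sol u"
  shows "L (polyK N b L1 L2 \<psi>) = polyK N b L1 L2 (L \<psi>)"
  unfolding polyK_def lin_sum[OF assms(1)] lin_cst_mult[OF assms(1)]
  by (intro sum.cong refl arg_cong[of _ _ "(*) _"])
     (use assms sol_funpow[OF sol(3)] commute_funpow[of u L1 L] commute_funpow[of u L2 L] in auto)

lemma ev_span_comp:
  assumes "ev_span u lo hi \<phi>" "\<And>\<psi>. \<psi> \<in> sol u \<Longrightarrow> G \<psi> \<in> sol u"
    and "\<And>l. lo \<le> l \<Longrightarrow> l \<le> hi \<Longrightarrow> ev_span u lo' hi' (\<lambda>\<psi>. ev l (G \<psi>))"
  shows "ev_span u lo' hi' (\<lambda>\<psi>. \<phi> (G \<psi>))"
proof -
  obtain c where c: "\<forall>\<psi>\<in>sol u. \<phi> \<psi> = (\<Sum>l\<in>{lo..hi}. c l * ev l \<psi>)"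
    using assms(1) unfolding ev_span_def by blast
  have "ev_span u lo' hi' (\<lambda>\<psi>. \<Sum>l\<in>{lo..hi}. c l * ev l (G \<psi>))"
    by (intro ev_span_sum ev_span_mult assms(3)) auto
  then show ?thesis by (rule ev_span_cong) (use c assms(2) in auto)
qed

lemma ev_span_funpow:
  fixes \<nu> :: nat
  assumes sol: "\<And>\<psi>. \<psi> \<in> sol u \<Longrightarrow> L \<psi> \<in> sol u"
    and L: "\<And>l. ev_span u (- (\<bar>l\<bar> + int \<nu>)) (\<bar>l\<bar> + int \<nu>) (\<lambda>\<psi>. ev l (L \<psi>))"
    and \<phi>: "ev_span u (- int q) (int q) \<phi>"
  shows "ev_span u (- int (q + r * \<nu>)) (int (q + r * \<nu>)) (\<lambda>\<psi>. \<phi> ((L ^^ r) \<psi>))"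
proof (induction r)
  case (Suc r)
  have "ev_span u (- int (q + Suc r * \<nu>)) (int (q + Suc r * \<nu>)) (\<lambda>\<psi>. \<phi> ((L ^^ r) (L \<psi>)))"
  proof (rule ev_span_comp[OF Suc sol])
    fix l assume "- int (q + r * \<nu>) \<le> l" "l \<le> int (q + r * \<nu>)"
    then show "ev_span u (- int (q + Suc r * \<nu>)) (int (q + Suc r * \<nu>)) (\<lambda>\<psi>. ev l (L \<psi>))"
      by (intro ev_span_mono[OF L]) (auto simp: algebra_simps)
  qed
  then show ?case by (simp add: funpow_swap1)
qed (use \<phi> in simp)

lemma ev_span_ev_le: "\<bar>l\<bar> \<le> int q \<Longrightarrow> ev_span u (- int q) (int q) (ev l)"
  by (rule ev_span_ev) auto

text \<open>The functionals \<open>ev l \<circ> L1\<^sup>r L2\<^sup>s\<close> with \<open>r, s \<le> N\<close> lie in a space of dimension \<open>O(N)\<close>, while there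
  are \<open>(N + 1)\<^sup>2\<close> pairs \<open>(r, s)\<close>.\<close>

lemma polynomial_with_vanishing_ev:
  fixes \<nu> q :: nat
  assumes sol: "\<And>\<psi>. \<psi> \<in> sol u \<Longrightarrow> L1 \<psi> \<in> sol u" "\<And>\<psi>. \<psi> \<in> sol u \<Longrightarrow> L2 \<psi> \<in> sol u"
    and L: "\<And>l. ev_span u (- (\<bar>l\<bar> + int \<nu>)) (\<bar>l\<bar> + int \<nu>) (\<lambda>\<psi>. ev l (L1 \<psi>))"
           "\<And>l. ev_span u (- (\<bar>l\<bar> + int \<nu>)) (\<bar>l\<bar> + int \<nu>) (\<lambda>\<psi>. ev l (L2 \<psi>))"
  shows "\<exists>N b. (\<exists>r\<le>N. \<exists>s\<le>N. b r s \<noteq> 0) \<and>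
    (\<forall>\<psi>\<in>sol u. \<forall>l. \<bar>l\<bar> \<le> int q \<longrightarrow> ev l (polyK N b L1 L2 \<psi>) = 0)"
proof -
  \<comment> \<open>\<open>d\<close> is the number of indices \<open>l\<close> with absolute value
    at most \<open>q\<close>, and \<open>B\<close> bounds the reach after \<open>2 * N\<close>
    applications. The conditions number \<open>d * (2 * B + 1) = d * (d + 4 * N * \<nu>)\<close>, at
    most \<open>N * d * (d + 4 * \<nu>)\<close>; the value of \<open>N\<close> turns this bound into
    \<open>N * N\<close>, below the \<open>(N + 1) * (N + 1)\<close> unknowns.\<close>
  define d where "d = 2 * q + 1"
  define N where "N = d * (d + 4 * \<nu>)"
  define B where "B = q + 2 * N * \<nu>"
  have "\<exists>c. \<forall>\<psi>\<in>sol u. ev l ((L1 ^^ r) ((L2 ^^ s) \<psi>)) = (\<Sum>k\<in>{- int B..int B}. c k * ev k \<psi>)"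
    if "\<bar>l\<bar> \<le> int q" "r \<le> N" "s \<le> N" for l r s
  proof -
    have "ev_span u (- int (q + r * \<nu> + s * \<nu>)) (int (q + r * \<nu> + s * \<nu>)) (\<lambda>\<psi>. ev l ((L1 ^^ r) ((L2 ^^ s) \<psi>)))"
      by (intro ev_span_funpow[OF sol(2) L(2)] ev_span_funpow[OF sol(1) L(1)] ev_span_ev_le that)
    moreover have "q + r * \<nu> + s * \<nu> \<le> B"
      using mult_right_mono[OF that(2), of \<nu>] mult_right_mono[OF that(3), of \<nu>]
      by (simp only: B_def mult.assoc) linarith
    ultimately have "ev_span u (- int B) (int B) (\<lambda>\<psi>. ev l ((L1 ^^ r) ((L2 ^^ s) \<psi>)))"
      by (elim ev_span_mono) (simp_all only: of_nat_le_iff neg_le_iff_le)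
    then show ?thesis by (simp add: ev_span_def)
  qed
  then obtain c where c: "\<And>l r s \<psi>. \<bar>l\<bar> \<le> int q \<Longrightarrow> r \<le> N \<Longrightarrow> s \<le> N \<Longrightarrow> \<psi> \<in> sol u \<Longrightarrow>
      ev l ((L1 ^^ r) ((L2 ^^ s) \<psi>)) = (\<Sum>k\<in>{- int B..int B}. c l r s k * ev k \<psi>)"
    by metis
  \<comment> \<open>One equation for each pair \<open>(l, k)\<close>: the total coefficient of
    \<open>ev k\<close> in \<open>ev l\<close> applied to the polynomial has to vanish. The unknowns
    are indexed by the exponents in \<open>I\<close>.\<close>
  define E where "E = {- int q..int q} \<times> {- int B..int B}"
  define I where "I = {..N} \<times> {..N}"
  have "card E = d * (d + 4 * N * \<nu>)"
    by (simp add: E_def d_def B_def card_cartesian_product algebra_simps nat_add_distrib nat_mult_distrib)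
  also have "\<dots> \<le> N * N"
  proof (cases "N = 0")
    case False
    then have "d * (d + 4 * N * \<nu>) \<le> d * (N * d + 4 * N * \<nu>)" by simp
    also have "\<dots> = N * N" unfolding N_def by (simp add: algebra_simps)
    finally show ?thesis .
  qed (simp add: N_def d_def)
  also have "\<dots> < card I"
    by (simp add: I_def card_cartesian_product)
  finally have "card E < card I" .
  then obtain x where x: "\<exists>i\<in>I. x i \<noteq> 0" "\<forall>e\<in>E. (\<Sum>i\<in>I. c (fst e) (fst i) (snd i) (snd e) * x i) = 0"
    using underdetermined_system[of E I "\<lambda>e i. c (fst e) (fst i) (snd i) (snd e)"] by (auto simp: E_def I_def)
  define b where "b r s = x (r, s)" for r s
  show ?thesis
  proof (rule exI[of _ N], rule exI[of _ b], rule conjI, goal_cases)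
    case 1
    show "\<exists>r\<le>N. \<exists>s\<le>N. b r s \<noteq> 0" using x(1) by (auto simp: I_def b_def)
  next
    case 2
    have "ev l (polyK N b L1 L2 \<psi>) = 0" if \<psi>: "\<psi> \<in> sol u" and l: "\<bar>l\<bar> \<le> int q" for \<psi> l
    proof -
    have "ev l (polyK N b L1 L2 \<psi>) = (\<Sum>i\<in>I. x i * ev l ((L1 ^^ fst i) ((L2 ^^ snd i) \<psi>)))"
      by (simp add: polyK_def I_def b_def sum.cartesian_product split_def)
    also have "\<dots> = (\<Sum>i\<in>I. \<Sum>k\<in>{- int B..int B}. c l (fst i) (snd i) k * x i * ev k \<psi>)"
      by (intro sum.cong refl) (auto simp: I_def c[OF l _ _ \<psi>] sum_distrib_left algebra_simps)
    also have "\<dots> = (\<Sum>k\<in>{- int B..int B}. (\<Sum>i\<in>I. c l (fst i) (snd i) k * x i) * ev k \<psi>)"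
      by (subst sum.swap) (simp add: sum_distrib_right)
    also have "\<dots> = 0"
    proof (intro sum.neutral ballI)
      fix k assume "k \<in> {- int B..int B}"
      then have "(l, k) \<in> E" using l by (auto simp: E_def)
      then have "(\<Sum>i\<in>I. c l (fst i) (snd i) k * x i) = 0" using x(2) by force
      then show "(\<Sum>i\<in>I. c l (fst i) (snd i) k * x i) * ev k \<psi> = 0" by simp
    qed
    finally show ?thesis .
    qed
    then show ?case by blast
  qed
qed

text \<open>If \<open>L\<close> shifts the index of \<open>ev\<close> by \<open>n\<close> upwards on one axis and by \<open>m\<close> downwards on the other,
  an operator \<open>M\<close> commuting with \<open>L\<close> is determined on solutions by the functionals \<open>ev l \<circ> M\<close>
  with \<open>-m \<le> l < n\<close>.\<close>

lemma commuting_operator_vanishes: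
  assumes n: "n \<ge> 1" and m: "m \<ge> 1"
    and sol: "\<And>\<psi>. \<psi> \<in> sol u \<Longrightarrow> L \<psi> \<in> sol u" "\<And>\<psi>. \<psi> \<in> sol u \<Longrightarrow> M \<psi> \<in> sol u"
    and comm: "\<And>\<psi>. \<psi> \<in> sol u \<Longrightarrow> L (M \<psi>) = M (L \<psi>)"
    and nf: "\<And>\<psi>. \<psi> \<in> sol u \<Longrightarrow> L \<psi> = nf A n B m \<psi>"
    and lead: "cf (A n) 0 0 \<noteq> 0" "cf (B m) 0 0 \<noteq> 0"
    and init: "\<And>\<psi> l. \<psi> \<in> sol u \<Longrightarrow> - int m \<le> l \<Longrightarrow> l < int n \<Longrightarrow> ev l (M \<psi>) = 0"
    and \<psi>: "\<psi> \<in> sol u"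
  shows "M \<psi> = 0"
proof -
  \<comment> \<open>The window of vanishing indices grows by one at each end per step. Since the
    claim is made for every solution, it may be applied to \<open>L \<psi>\<close> as well as to
    \<open>\<psi>\<close>.\<close>
  have "\<forall>\<psi>\<in>sol u. \<forall>l. - int (m + k) \<le> l \<longrightarrow> l < int (n + k) \<longrightarrow> ev l (M \<psi>) = 0" for k
  proof (induction k)
    case 0
    then show ?case using init by simp
  next
    case (Suc k)
    \<comment> \<open>In the \<open>k\<close>-th x-axis coefficient of
      \<open>L (M \<psi>) = M (L \<psi>)\<close> the right side is known to vanish, and on the left
      \<open>k + n\<close> is the only index outside the window.\<close>
    have up: "cf (M \<psi>) (k + n) 0 = 0" if \<psi>: "\<psi> \<in> sol u" for \<psi>
    proof -
      have "cf (nf A n B m (M \<psi>)) k 0 = ev (int k) (M (L \<psi>))"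
        using comm[OF \<psi>] nf[OF sol(2)[OF \<psi>]] by simp
      also have "\<dots> = 0"
        using Suc sol(1)[OF \<psi>] n by (simp del: ev_of_nat)
      finally have "cf (nf A n B m (M \<psi>)) k 0 = 0" .
      moreover have "cf (nf A n B m (M \<psi>)) k 0 - cf (A n) 0 0 * fact (k + n) / fact k * cf (M \<psi>) (k + n) 0 = 0"
        by (rule ev_span_vanish[OF nf_lead_x[OF n] sol(2)[OF \<psi>]]) (use Suc \<psi> in auto)
      ultimately show ?thesis using lead by simp
    qed
    \<comment> \<open>The y-axis is tested at \<open>Suc k\<close> instead of \<open>k\<close>,
      because the initial window already contains \<open>- m\<close>: the first unknown index is
      \<open>- (Suc k + m)\<close>.\<close>
    have down: "cf (M \<psi>) 0 (Suc k + m) = 0" if \<psi>: "\<psi> \<in> sol u" for \<psi>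
    proof -
      have "cf (nf A n B m (M \<psi>)) 0 (Suc k) = ev (- int (Suc k)) (M (L \<psi>))"
        using comm[OF \<psi>] nf[OF sol(2)[OF \<psi>]] by (simp only: ev_minus_of_nat)
      also have "\<dots> = 0"
        using Suc sol(1)[OF \<psi>] m by (simp del: ev_minus_of_nat)
      finally have "cf (nf A n B m (M \<psi>)) 0 (Suc k) = 0" .
      moreover have "cf (nf A n B m (M \<psi>)) 0 (Suc k) -
          cf (B m) 0 0 * fact (Suc k + m) / fact (Suc k) * cf (M \<psi>) 0 (Suc k + m) = 0"
      proof (rule ev_span_vanish[OF nf_lead_y[OF m] sol(2)[OF \<psi>]])
        fix l assume l: "1 - int (Suc k + m) \<le> l" "l \<le> int n"
        show "ev l (M \<psi>) = 0"
        \<comment> \<open>Only for \<open>k = 0\<close> does the range of \<open>l\<close> exceed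
          the induction hypothesis, by the index \<open>n\<close>; \<open>up\<close> has just
          supplied it.\<close>
        proof (cases "l = int (n + k)")
          case True
          then show ?thesis using up[OF \<psi>] by (simp only: ev_of_nat add.commute)
        next
          case False
          then show ?thesis using Suc \<psi> l by auto
        qed
      qed
      ultimately show ?thesis using lead by (simp del: of_nat_Suc fact_Suc add_Suc)
    qed
    show ?case
    proof (intro ballI allI impI)
      fix \<psi> l assume \<psi>: "\<psi> \<in> sol u" and l: "- int (m + Suc k) \<le> l" "l < int (n + Suc k)"
      consider "l = int (k + n)" | "l = - int (Suc k + m)" | "- int (m + k) \<le> l" "l < int (n + k)"
        using l by fastforce
      then show "ev l (M \<psi>) = 0"
        using up[OF \<psi>] down[OF \<psi>] Suc \<psi> by cases (simp_all only: ev_of_nat ev_minus_of_nat)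
    qed
  qed
  note all = this
  have "ev l (M \<psi>) = 0" for l
  proof -
    have "- int (m + Suc (nat \<bar>l\<bar>)) \<le> l" "l < int (n + Suc (nat \<bar>l\<bar>))" by linarith+
    then show ?thesis using all \<psi> by blast
  qed
  then show ?thesis using sol_eq_0I sol(2) \<psi> by blast
qed

text \<open>The operator \<open>L\<close> driving the recursion is kept apart from \<open>L1\<close>
  and \<open>L2\<close>, since neither of these need involve both derivatives.\<close>

lemma generic_case:
  assumes lin: "lin L"
    and sol: "\<And>\<psi>. \<psi> \<in> sol u \<Longrightarrow> L \<psi> \<in> sol u" "\<And>\<psi>. \<psi> \<in> sol u \<Longrightarrow> L1 \<psi> \<in> sol u" "\<And>\<psi>. \<psi> \<in> sol u \<Longrightarrow> L2 \<psi> \<in> sol u"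
    and comm: "\<And>\<psi>. \<psi> \<in> sol u \<Longrightarrow> L (L1 \<psi>) = L1 (L \<psi>)" "\<And>\<psi>. \<psi> \<in> sol u \<Longrightarrow> L (L2 \<psi>) = L2 (L \<psi>)"
    and nf: "\<And>\<psi>. \<psi> \<in> sol u \<Longrightarrow> L \<psi> = nf A n B m \<psi>"
      "\<And>\<psi>. \<psi> \<in> sol u \<Longrightarrow> L1 \<psi> = nf A1 n1 B1 m1 \<psi>" "\<And>\<psi>. \<psi> \<in> sol u \<Longrightarrow> L2 \<psi> = nf A2 n2 B2 m2 \<psi>"
    and lead: "n \<ge> 1" "m \<ge> 1" "cf (A n) 0 0 \<noteq> 0" "cf (B m) 0 0 \<noteq> 0"
  shows "\<exists>N b. (\<exists>r\<le>N. \<exists>s\<le>N. b r s \<noteq> 0) \<and> (\<forall>\<psi>\<in>sol u. polyK N b L1 L2 \<psi> = 0)"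
proof -
  define \<nu> where "\<nu> = n1 + m1 + n2 + m2"
  have S1: "ev_span u (- (\<bar>l\<bar> + int \<nu>)) (\<bar>l\<bar> + int \<nu>) (\<lambda>\<psi>. ev l (L1 \<psi>))" for l
    by (rule ev_span_cong[OF ev_span_mono[OF ev_span_ev_nf]]) (auto simp: \<nu>_def nf)
  have S2: "ev_span u (- (\<bar>l\<bar> + int \<nu>)) (\<bar>l\<bar> + int \<nu>) (\<lambda>\<psi>. ev l (L2 \<psi>))" for l
    by (rule ev_span_cong[OF ev_span_mono[OF ev_span_ev_nf]]) (auto simp: \<nu>_def nf)
  obtain N b where b: "\<exists>r\<le>N. \<exists>s\<le>N. b r s \<noteq> 0"
    "\<And>\<psi> l. \<psi> \<in> sol u \<Longrightarrow> \<bar>l\<bar> \<le> int (n + m) \<Longrightarrow> ev l (polyK N b L1 L2 \<psi>) = 0"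
    using polynomial_with_vanishing_ev[OF sol(2,3) S1 S2, of "n + m"] by blast
  have "polyK N b L1 L2 \<psi> = 0" if "\<psi> \<in> sol u" for \<psi>
    by (rule commuting_operator_vanishes[OF lead(1,2) sol(1) _ _ nf(1) lead(3,4)])
       (use sol_polyK[where ?L1.0 = L1 and ?L2.0 = L2, OF sol(2,3)] commute_polyK[where L = L and ?L1.0 = L1 and ?L2.0 = L2, OF lin sol comm] b(2) that in auto)
  then show ?thesis using b(1) by blast
qed

section \<open>Operators that involve only one of the two derivatives\<close>

definition dY_form :: "ps2 \<Rightarrow> (ps2 \<Rightarrow> ps2) \<Rightarrow> bool" where
  "dY_form u F \<longleftrightarrow> (\<exists>t C. \<forall>\<psi>\<in>sol u. F \<psi> = (\<Sum>j\<le>t. C j * (Dy ^^ j) \<psi>))"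

lemma dY_form_cong: "dY_form u F \<Longrightarrow> (\<And>\<psi>. \<psi> \<in> sol u \<Longrightarrow> F \<psi> = G \<psi>) \<Longrightarrow> dY_form u G"
  unfolding dY_form_def by simp

lemma dY_form_0: "dY_form u (\<lambda>_. 0)"
  unfolding dY_form_def by (intro exI[of _ 0] exI[of _ "\<lambda>_. 0"]) simp

lemma dY_form_id: "dY_form u (\<lambda>\<psi>. \<psi>)"
  unfolding dY_form_def by (intro exI[of _ 0] exI[of _ "\<lambda>_. 1"]) simp

lemma dY_form_add:
  assumes "dY_form u F" "dY_form u G"
  shows "dY_form u (\<lambda>\<psi>. F \<psi> + G \<psi>)"
proof -
  obtain s C t D where F: "\<forall>\<psi>\<in>sol u. F \<psi> = (\<Sum>j\<le>s. C j * (Dy ^^ j) \<psi>)"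
    and G: "\<forall>\<psi>\<in>sol u. G \<psi> = (\<Sum>j\<le>t. D j * (Dy ^^ j) \<psi>)"
    using assms unfolding dY_form_def by blast
  define C' where "C' j = (if j \<le> s then C j else 0)" for j
  define D' where "D' j = (if j \<le> t then D j else 0)" for j
  have "(\<Sum>j\<le>s. C j * (Dy ^^ j) \<psi>) = (\<Sum>j\<le>s + t. C' j * (Dy ^^ j) \<psi>)" for \<psi>
    by (rule sum.mono_neutral_cong_left) (auto simp: C'_def)
  moreover have "(\<Sum>j\<le>t. D j * (Dy ^^ j) \<psi>) = (\<Sum>j\<le>s + t. D' j * (Dy ^^ j) \<psi>)" for \<psi>
    by (rule sum.mono_neutral_cong_left) (auto simp: D'_def)
  ultimately show ?thesis unfolding dY_form_def
    by (intro exI[of _ "s + t"] exI[of _ "\<lambda>j. C' j + D' j"])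
       (simp add: F G algebra_simps sum.distrib)
qed

lemma dY_form_sum: "(\<And>i. i \<in> I \<Longrightarrow> dY_form u (F i)) \<Longrightarrow> dY_form u (\<lambda>\<psi>. \<Sum>i\<in>I. F i \<psi>)"
  by (induction I rule: infinite_finite_induct) (auto intro: dY_form_add dY_form_0)

lemma dY_form_mult:
  assumes "dY_form u F"
  shows "dY_form u (\<lambda>\<psi>. f * F \<psi>)"
proof -
  obtain s C where "\<forall>\<psi>\<in>sol u. F \<psi> = (\<Sum>j\<le>s. C j * (Dy ^^ j) \<psi>)"
    using assms unfolding dY_form_def by blast
  then show ?thesis unfolding dY_form_def
    by (intro exI[of _ s] exI[of _ "\<lambda>j. f * C j"]) (simp add: sum_distrib_left mult.assoc)
qed

lemma dY_form_Dy:
  assumes "dY_form u F"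
  shows "dY_form u (\<lambda>\<psi>. Dy (F \<psi>))"
proof -
  obtain s C where F: "\<forall>\<psi>\<in>sol u. F \<psi> = (\<Sum>j\<le>s. C j * (Dy ^^ j) \<psi>)"
    using assms unfolding dY_form_def by blast
  have mon: "dY_form u (\<lambda>\<psi>. g * (Dy ^^ j) \<psi>)" for g j
    unfolding dY_form_def
    by (intro exI[of _ j] exI[of _ "\<lambda>i. if i = j then g else 0"])
       (simp add: if_distrib[of "\<lambda>x. x * _"] cong: if_cong)
  have "dY_form u (\<lambda>\<psi>. \<Sum>j\<le>s. Dy (C j) * (Dy ^^ j) \<psi> + C j * (Dy ^^ Suc j) \<psi>)"
    by (intro dY_form_sum dY_form_add mon)
  then show ?thesis by (rule dY_form_cong) (simp add: F Dy_mult)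
qed

lemma dY_form_Dy_funpow: "dY_form u F \<Longrightarrow> dY_form u (\<lambda>\<psi>. (Dy ^^ j) (F \<psi>))"
  by (induction j) (auto intro: dY_form_Dy)

text \<open>By the Leibniz rule \<open>Dy\<close> only differentiates coefficients or raises the
  order in \<open>Dy\<close>, so no mixed derivative arises. Solutions must be preserved by
  \<open>G\<close> because the form of \<open>F\<close> is known only on them.\<close>

lemma dY_form_comp:
  assumes "dY_form u F" "dY_form u G" "\<And>\<psi>. \<psi> \<in> sol u \<Longrightarrow> G \<psi> \<in> sol u"
  shows "dY_form u (\<lambda>\<psi>. F (G \<psi>))"
proof -
  obtain s C where F: "\<forall>\<psi>\<in>sol u. F \<psi> = (\<Sum>j\<le>s. C j * (Dy ^^ j) \<psi>)"
    using assms unfolding dY_form_def by blast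
  have "dY_form u (\<lambda>\<psi>. \<Sum>j\<le>s. C j * (Dy ^^ j) (G \<psi>))"
    by (intro dY_form_sum dY_form_mult dY_form_Dy_funpow assms)
  then show ?thesis by (rule dY_form_cong) (simp add: F assms)
qed

lemma dY_form_funpow:
  assumes "dY_form u F" "dY_form u G" "\<And>\<psi>. \<psi> \<in> sol u \<Longrightarrow> F \<psi> \<in> sol u" "\<And>\<psi>. \<psi> \<in> sol u \<Longrightarrow> G \<psi> \<in> sol u"
  shows "dY_form u (\<lambda>\<psi>. (F ^^ r) (G \<psi>))"
  by (induction r) (use assms sol_funpow[OF assms(3)] in \<open>auto intro: dY_form_comp\<close>)

lemma dY_form_polyK:
  assumes "dY_form u L1" "dY_form u L2" "\<And>\<psi>. \<psi> \<in> sol u \<Longrightarrow> L1 \<psi> \<in> sol u" "\<And>\<psi>. \<psi> \<in> sol u \<Longrightarrow> L2 \<psi> \<in> sol u"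
  shows "dY_form u (polyK N b L1 L2)"
proof -
  have "dY_form u (\<lambda>\<psi>. (L2 ^^ s) \<psi>)" for s
    by (rule dY_form_funpow[OF assms(2) dY_form_id]) (use assms in auto)
  then have "dY_form u (\<lambda>\<psi>. (L1 ^^ r) ((L2 ^^ s) \<psi>))" for r s
    by (intro dY_form_funpow[where G = "L2 ^^ s"] assms sol_funpow[OF assms(4)])
  then have "dY_form u (\<lambda>\<psi>. \<Sum>r\<le>N. \<Sum>s\<le>N. cst (b r s) * (L1 ^^ r) ((L2 ^^ s) \<psi>))"
    by (intro dY_form_sum dY_form_mult)
  then show ?thesis by (simp add: polyK_def[abs_def])
qed

lemma fps_deriv_funpow_nth:
  "fps_nth ((fps_deriv ^^ n) f) k = fact (k + n) / fact k * fps_nth (f :: complex fps) (k + n)"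
proof (induction n arbitrary: k)
  case (Suc n)
  show ?case by (simp add: Suc.IH fact_Suc[of k] del: of_nat_Suc)
qed simp

text \<open>Applied to the monomial of degree \<open>j\<close>, the terms above \<open>j\<close>
  vanish by differentiation and those below \<open>j\<close> by induction, which leaves
  \<open>fact j\<close> times \<open>d j\<close>.\<close>

lemma ode_coeffs_0:
  fixes d :: "nat \<Rightarrow> complex fps"
  assumes "\<And>\<phi>. (\<Sum>j\<le>t. d j * (fps_deriv ^^ j) \<phi>) = 0" "j \<le> t"
  shows "d j = 0"
  using assms(2)
proof (induction j rule: less_induct)
  case (less j)
  define \<phi> :: "complex fps" where "\<phi> = Abs_fps (\<lambda>n. if n = j then 1 else 0)"
  have "d i * (fps_deriv ^^ i) \<phi> = (if i = j then d j * fps_const (fact j) else 0)" for i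
  proof (cases i j rule: linorder_cases)
    case less
    then show ?thesis using less.IH[of i] \<open>j \<le> t\<close> less.prems by simp
  next
    case equal
    have "(fps_deriv ^^ i) \<phi> = fps_const (fact j)"
      by (rule fps_ext) (simp add: fps_deriv_funpow_nth \<phi>_def equal)
    then show ?thesis using equal by simp
  next
    case greater
    then have "(fps_deriv ^^ i) \<phi> = 0"
      by (intro fps_ext) (simp add: fps_deriv_funpow_nth \<phi>_def)
    then show ?thesis using greater by simp
  qed
  then have "(\<Sum>i\<le>t. d i * (fps_deriv ^^ i) \<phi>) = d j * fps_const (fact j)"
    using less.prems by simp
  then have "d j * fps_const (fact j) = 0" using assms(1) by simp
  then show ?case by simp
qed

text \<open>Composing \<open>fps_deriv\<close> with the operator gives coefficients
  \<open>fps_deriv (C j) + C (j - 1)\<close>; their vanishing kills \<open>C\<close> from the top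
  index downwards.\<close>

lemma ode_deriv_coeffs_0:
  fixes C :: "nat \<Rightarrow> complex fps"
  assumes "\<And>\<phi>. fps_deriv (\<Sum>j\<le>t. C j * (fps_deriv ^^ j) \<phi>) = 0" "j \<le> t"
  shows "C j = 0"
proof -
  define C' where "C' j = (if j \<le> t then C j else 0)" for j
  define d where "d j = fps_deriv (C' j) + (if j = 0 then 0 else C' (j - 1))" for j
  have "(\<Sum>j\<le>Suc t. d j * (fps_deriv ^^ j) \<phi>) = 0" for \<phi>
  proof -
    have "(\<Sum>j\<le>Suc t. d j * (fps_deriv ^^ j) \<phi>) =
        (\<Sum>j\<le>Suc t. fps_deriv (C' j) * (fps_deriv ^^ j) \<phi>) +
        (\<Sum>j\<le>Suc t. (if j = 0 then 0 else C' (j - 1)) * (fps_deriv ^^ j) \<phi>)"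
      by (simp only: d_def distrib_right sum.distrib)
    also have "(\<Sum>j\<le>Suc t. fps_deriv (C' j) * (fps_deriv ^^ j) \<phi>) =
        (\<Sum>j\<le>t. fps_deriv (C j) * (fps_deriv ^^ j) \<phi>)"
      by (simp add: C'_def)
    also have "(\<Sum>j\<le>Suc t. (if j = 0 then 0 else C' (j - 1)) * (fps_deriv ^^ j) \<phi>) =
        (\<Sum>j\<le>t. C j * (fps_deriv ^^ Suc j) \<phi>)"
      by (subst sum.atMost_Suc_shift) (simp add: C'_def)
    also have "(\<Sum>j\<le>t. fps_deriv (C j) * (fps_deriv ^^ j) \<phi>) + \<dots> = fps_deriv (\<Sum>j\<le>t. C j * (fps_deriv ^^ j) \<phi>)"
      by (simp add: fps_deriv_sum sum.distrib algebra_simps)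
    finally show ?thesis using assms(1) by simp
  qed
  then have d: "d j = 0" if "j \<le> Suc t" for j
    using ode_coeffs_0 that by blast
  have "C' (t - i) = 0" for i
  proof (induction i)
    case 0
    then show ?case using d[of "Suc t"] by (simp add: d_def C'_def)
  next
    case (Suc i)
    show ?case
    proof (cases "i < t")
      case True
      then have "d (t - i) = fps_deriv (C' (t - i)) + C' (t - Suc i)" by (simp add: d_def)
      then show ?thesis using d[of "t - i"] Suc True by simp
    next
      case False
      then show ?thesis using Suc by simp
    qed
  qed
  from this[of "t - j"] show ?thesis using assms(2) by (simp add: C'_def)
qed

text \<open>On the axis \<open>x = 0\<close> the derivatives \<open>Dy\<^sup>j \<psi>\<close> of a solution are those of an arbitrary power series.
  Expand \<open>M \<psi>\<close> in powers of \<open>x\<close>: if it vanishes to order \<open>s \<ge> 1\<close>, then the equation \<open>Dx (Dy (M \<psi>)) = u * M \<psi>\<close>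
  makes the coefficient of \<open>x\<^sup>s\<close> constant in \<open>y\<close>, for every \<open>\<psi>\<close>, and hence zero.\<close>

lemma dY_form_vanishes:
  assumes form: "dY_form u M"
    and sol: "\<And>\<psi>. \<psi> \<in> sol u \<Longrightarrow> M \<psi> \<in> sol u"
    and axis: "\<And>\<psi> k. \<psi> \<in> sol u \<Longrightarrow> cf (M \<psi>) 0 k = 0"
    and \<psi>: "\<psi> \<in> sol u"
  shows "M \<psi> = 0"
proof -
  obtain t C where M: "\<And>\<psi>. \<psi> \<in> sol u \<Longrightarrow> M \<psi> = (\<Sum>j\<le>t. C j * (Dy ^^ j) \<psi>)"
    using form unfolding dY_form_def by blast
  \<comment> \<open>\<open>Dy\<close> acts on each power of \<open>x\<close> separately, which turns
    the claim into one about ordinary differential operators in \<open>y\<close>.\<close>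
  have Dy_row: "fps_nth ((Dy ^^ j) \<psi>) i = (fps_deriv ^^ j) (fps_nth \<psi> i)" for j i \<psi>
    by (rule fps_ext) (simp add: cf_Dy_pow fps_deriv_funpow_nth)
  have "\<forall>j\<le>t. fps_nth (C j) s = 0" for s
  proof (induction s rule: less_induct)
    case (less s)
    have low: "fps_nth (M \<psi>) i = 0" if "i < s" "\<psi> \<in> sol u" for i \<psi>
      by (simp add: M that fps_sum_nth fps_mult_nth, intro sum.neutral ballI) (use that less in auto)
    have row: "fps_nth (M \<psi>) s = (\<Sum>j\<le>t. fps_nth (C j) s * (fps_deriv ^^ j) (fps_nth \<psi> 0))" if "\<psi> \<in> sol u" for \<psi>
    proof -
      have "fps_nth (C j * (Dy ^^ j) \<psi>) s = fps_nth (C j) s * (fps_deriv ^^ j) (fps_nth \<psi> 0)" if "j \<le> t" for j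
      proof -
        have "fps_nth (C j * (Dy ^^ j) \<psi>) s = (\<Sum>i=0..s. if i = s then fps_nth (C j) s * fps_nth ((Dy ^^ j) \<psi>) 0 else 0)"
          unfolding fps_mult_nth by (intro sum.cong refl) (use that less in auto)
        then show ?thesis by (simp add: Dy_row)
      qed
      then show ?thesis by (simp add: M that fps_sum_nth)
    qed
    have "fps_deriv (\<Sum>j\<le>t. fps_nth (C j) s * (fps_deriv ^^ j) \<phi>) = 0" for \<phi>
    proof -
      obtain \<psi> where \<psi>: "\<psi> \<in> sol u" "\<And>j. cf \<psi> 0 j = fps_nth \<phi> j"
        using solution_exists[of "\<lambda>_. fps_nth \<phi> 0" "fps_nth \<phi>" u] by metis
      have "fps_nth \<psi> 0 = \<phi>" by (rule fps_ext) (rule \<psi>)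
      then have r: "(\<Sum>j\<le>t. fps_nth (C j) s * (fps_deriv ^^ j) \<phi>) = fps_nth (M \<psi>) s"
        using row[OF \<psi>(1)] by simp
      show ?thesis unfolding r
      proof (rule fps_ext)
        fix k
        show "fps_nth (fps_deriv (fps_nth (M \<psi>) s)) k = fps_nth 0 k"
        proof (cases s)
          case 0
          then show ?thesis using axis[OF \<psi>(1)] by simp
        next
          case (Suc s')
          have "of_nat (Suc s') * of_nat (Suc k) * cf (M \<psi>) (Suc s') (Suc k) = 0"
            unfolding sol_coeff[OF sol[OF \<psi>(1)]] by (intro sum.neutral ballI) (simp add: low \<psi>(1) Suc)
          then show ?thesis by (simp add: Suc del: of_nat_Suc)
        qed
      qed
    qed
    then show ?case using ode_deriv_coeffs_0[where C = "\<lambda>j. fps_nth (C j) s"] by blast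
  qed
  then have "C j = 0" if "j \<le> t" for j
    by (intro fps_ext) (use that in auto)
  then show ?thesis using M[OF \<psi>] by simp
qed

lemma dY_form_nf: "dY_form u (nf A 0 B m)"
proof -
  have "nf A 0 B m \<psi> = (\<Sum>j\<le>m. (if j = 0 then A 0 else B j) * (Dy ^^ j) \<psi>)" for \<psi>
  proof -
    have "{..m} = insert 0 {1..m}" by auto
    then show ?thesis by (simp add: nf_def)
  qed
  then show ?thesis unfolding dY_form_def
    by (intro exI[of _ m] exI[of _ "\<lambda>j. if j = 0 then A 0 else B j"]) simp
qed

text \<open>With order \<open>0\<close> in \<open>X\<close> the window of \<open>nf_lead_y\<close>
  ends at \<open>0\<close>, so the recursion from \<open>L (M \<psi>) = M (L \<psi>)\<close> stays
  on the y-axis and closes up there. The step from this axis to the full series is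
  \<open>dY_form_vanishes\<close>.\<close>

lemma y_case:
  assumes lin: "lin L"
    and sol: "\<And>\<psi>. \<psi> \<in> sol u \<Longrightarrow> L \<psi> \<in> sol u" "\<And>\<psi>. \<psi> \<in> sol u \<Longrightarrow> L1 \<psi> \<in> sol u" "\<And>\<psi>. \<psi> \<in> sol u \<Longrightarrow> L2 \<psi> \<in> sol u"
    and comm: "\<And>\<psi>. \<psi> \<in> sol u \<Longrightarrow> L (L1 \<psi>) = L1 (L \<psi>)" "\<And>\<psi>. \<psi> \<in> sol u \<Longrightarrow> L (L2 \<psi>) = L2 (L \<psi>)"
    and nf: "\<And>\<psi>. \<psi> \<in> sol u \<Longrightarrow> L \<psi> = nf A 0 B m \<psi>"
      "\<And>\<psi>. \<psi> \<in> sol u \<Longrightarrow> L1 \<psi> = nf A1 0 B1 m1 \<psi>" "\<And>\<psi>. \<psi> \<in> sol u \<Longrightarrow> L2 \<psi> = nf A2 0 B2 m2 \<psi>"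
    and lead: "m \<ge> 1" "cf (B m) 0 0 \<noteq> 0"
  shows "\<exists>N b. (\<exists>r\<le>N. \<exists>s\<le>N. b r s \<noteq> 0) \<and> (\<forall>\<psi>\<in>sol u. polyK N b L1 L2 \<psi> = 0)"
proof -
  define \<nu> where "\<nu> = m1 + m2"
  have S1: "ev_span u (- (\<bar>l\<bar> + int \<nu>)) (\<bar>l\<bar> + int \<nu>) (\<lambda>\<psi>. ev l (L1 \<psi>))" for l
    by (rule ev_span_cong[OF ev_span_mono[OF ev_span_ev_nf]]) (auto simp: \<nu>_def nf)
  have S2: "ev_span u (- (\<bar>l\<bar> + int \<nu>)) (\<bar>l\<bar> + int \<nu>) (\<lambda>\<psi>. ev l (L2 \<psi>))" for l
    by (rule ev_span_cong[OF ev_span_mono[OF ev_span_ev_nf]]) (auto simp: \<nu>_def nf)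
  obtain N b where b: "\<exists>r\<le>N. \<exists>s\<le>N. b r s \<noteq> 0"
    "\<And>\<psi> l. \<psi> \<in> sol u \<Longrightarrow> \<bar>l\<bar> \<le> int m \<Longrightarrow> ev l (polyK N b L1 L2 \<psi>) = 0"
    using polynomial_with_vanishing_ev[OF sol(2,3) S1 S2, of m] by blast
  define M where "M = polyK N b L1 L2"
  have VM: "M \<psi> \<in> sol u" if "\<psi> \<in> sol u" for \<psi>
    unfolding M_def by (rule sol_polyK[where ?L1.0 = L1 and ?L2.0 = L2, OF sol(2,3) that])
  have "cf (M \<psi>) 0 k = 0" if "\<psi> \<in> sol u" for \<psi> k
    using that
  proof (induction k arbitrary: \<psi> rule: less_induct)
    case (less k)
    show ?case
    proof (cases "k < m")
      case True
      then show ?thesis using b(2)[OF less.prems, of "- int k"] by (simp add: M_def)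
    next
      case False
      define k' where "k' = k - m"
      have k: "k = k' + m" using False by (simp add: k'_def)
      have "cf (nf A 0 B m (M \<psi>)) 0 k' = cf (M (L \<psi>)) 0 k'"
        using commute_polyK[where L = L and ?L1.0 = L1 and ?L2.0 = L2, OF lin sol comm less.prems] nf(1)[OF VM[OF less.prems]] by (simp add: M_def)
      also have "\<dots> = 0"
        by (rule less.IH) (use k lead sol less.prems in auto)
      finally have "cf (nf A 0 B m (M \<psi>)) 0 k' = 0" .
      moreover have "cf (nf A 0 B m (M \<psi>)) 0 k' -
          cf (B m) 0 0 * fact (k' + m) / fact k' * cf (M \<psi>) 0 (k' + m) = 0"
      proof (rule ev_span_vanish[OF nf_lead_y[OF lead(1)] VM[OF less.prems]])
        fix l assume l: "1 - int (k' + m) \<le> l" "l \<le> int 0"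
        define i where "i = nat (- l)"
        have i: "l = - int i" "i < k" using l k by (auto simp: i_def)
        show "ev l (M \<psi>) = 0" using less.IH[OF i(2) less.prems] i(1) by simp
      qed
      ultimately show ?thesis using lead k by simp
    qed
  qed
  moreover have "dY_form u M"
    unfolding M_def
    by (intro dY_form_polyK sol; (rule dY_form_cong[OF dY_form_nf])?) (use nf in auto)
  ultimately have "M \<psi> = 0" if "\<psi> \<in> sol u" for \<psi>
    using dY_form_vanishes[of u M] VM that by blast
  then show ?thesis using b(1) unfolding M_def by blast
qed

lemma swap_funpow: "((\<lambda>\<psi>. swap (L (swap \<psi>))) ^^ r) \<psi> = swap ((L ^^ r) (swap \<psi>))"
  by (induction r) simp_all

lemma x_case:
  assumes lin: "lin L"
    and sol: "\<And>\<psi>. \<psi> \<in> sol u \<Longrightarrow> L \<psi> \<in> sol u" "\<And>\<psi>. \<psi> \<in> sol u \<Longrightarrow> L1 \<psi> \<in> sol u" "\<And>\<psi>. \<psi> \<in> sol u \<Longrightarrow> L2 \<psi> \<in> sol u"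
    and comm: "\<And>\<psi>. \<psi> \<in> sol u \<Longrightarrow> L (L1 \<psi>) = L1 (L \<psi>)" "\<And>\<psi>. \<psi> \<in> sol u \<Longrightarrow> L (L2 \<psi>) = L2 (L \<psi>)"
    and nf: "\<And>\<psi>. \<psi> \<in> sol u \<Longrightarrow> L \<psi> = nf A n B 0 \<psi>"
      "\<And>\<psi>. \<psi> \<in> sol u \<Longrightarrow> L1 \<psi> = nf A1 n1 B1 0 \<psi>" "\<And>\<psi>. \<psi> \<in> sol u \<Longrightarrow> L2 \<psi> = nf A2 n2 B2 0 \<psi>"
    and lead: "n \<ge> 1" "cf (A n) 0 0 \<noteq> 0"
  shows "\<exists>N b. (\<exists>r\<le>N. \<exists>s\<le>N. b r s \<noteq> 0) \<and> (\<forall>\<psi>\<in>sol u. polyK N b L1 L2 \<psi> = 0)"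
proof -
  \<comment> \<open>Conjugation with \<open>swap\<close> turns operators in \<open>X\<close> alone
    into operators in \<open>Y\<close> alone for the swapped equation.\<close>
  define C where "C L = (\<lambda>\<psi>. swap (L (swap \<psi>)))" for L :: "ps2 \<Rightarrow> ps2"
  have polyC: "polyK N b (C L1) (C L2) \<psi> = swap (polyK N b L1 L2 (swap \<psi>))" for N b \<psi>
    by (simp add: polyK_def C_def swap_funpow)
  have nfC: "C F \<psi> = nf (\<lambda>j. if j = 0 then swap (A 0) else swap (B j)) 0 (\<lambda>i. swap (A i)) n \<psi>"
    if "\<And>\<psi>. \<psi> \<in> sol u \<Longrightarrow> F \<psi> = nf A n B 0 \<psi>" "\<psi> \<in> sol (swap u)" for F A n B \<psi>
    using that by (simp add: C_def sol_swap swap_nf)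
  have "\<exists>N b. (\<exists>r\<le>N. \<exists>s\<le>N. b r s \<noteq> 0) \<and> (\<forall>\<psi>\<in>sol (swap u). polyK N b (C L1) (C L2) \<psi> = 0)"
  proof (rule y_case[where L = "C L"])
    show "lin (C L)" using lin by (simp add: lin_def C_def)
    show "C L \<psi> = nf (\<lambda>j. if j = 0 then swap (A 0) else swap (B j)) 0 (\<lambda>i. swap (A i)) n \<psi>"
      if "\<psi> \<in> sol (swap u)" for \<psi> using nfC[OF nf(1) that] .
    show "C L1 \<psi> = nf (\<lambda>j. if j = 0 then swap (A1 0) else swap (B1 j)) 0 (\<lambda>i. swap (A1 i)) n1 \<psi>"
      if "\<psi> \<in> sol (swap u)" for \<psi> using nfC[OF nf(2) that] .
    show "C L2 \<psi> = nf (\<lambda>j. if j = 0 then swap (A2 0) else swap (B2 j)) 0 (\<lambda>i. swap (A2 i)) n2 \<psi>"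
      if "\<psi> \<in> sol (swap u)" for \<psi> using nfC[OF nf(3) that] .
  qed (use sol comm lead in \<open>auto simp: C_def sol_swap\<close>)
  then obtain N b where b: "\<exists>r\<le>N. \<exists>s\<le>N. b r s \<noteq> 0"
    "\<And>\<psi>. \<psi> \<in> sol (swap u) \<Longrightarrow> polyK N b (C L1) (C L2) \<psi> = 0" by blast
  have "polyK N b L1 L2 \<psi> = 0" if "\<psi> \<in> sol u" for \<psi>
    using b(2)[of "swap \<psi>"] that polyC[of N b "swap \<psi>"] swap_eq_iff[of "polyK N b L1 L2 \<psi>" 0]
    by (simp add: sol_swap del: swap_eq_iff)
  then show ?thesis using b(1) by blast
qed

text \<open>An operator that acts on solutions as multiplication and preserves them multiplies by a
  constant, so a polynomial of degree one in the first variable suffices.\<close>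

lemma constant_case:
  assumes sol: "\<And>\<psi>. \<psi> \<in> sol u \<Longrightarrow> L1 \<psi> \<in> sol u"
    and nf: "\<And>\<psi>. \<psi> \<in> sol u \<Longrightarrow> L1 \<psi> = nf A 0 B 0 \<psi>"
  shows "\<exists>N b. (\<exists>r\<le>N. \<exists>s\<le>N. b r s \<noteq> 0) \<and> (\<forall>\<psi>\<in>sol u. polyK N b L1 L2 \<psi> = 0)"
proof -
  define a where "a = A 0"
  have a: "L1 \<psi> = a * \<psi>" if "\<psi> \<in> sol u" for \<psi> using nf[OF that] by (simp add: nf_def a_def)
  \<comment> \<open>This is the equation for \<open>a * \<psi>\<close> minus \<open>a\<close> times
    the equation for \<open>\<psi>\<close>, arranged as a normal form so that
    \<open>normal_form_free\<close> yields \<open>Dx a = 0\<close> and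
    \<open>Dy a = 0\<close>.\<close>
  have "(\<Sum>i\<le>1. (if i = 0 then Dx (Dy a) else Dy a) * (Dx ^^ i) \<psi>) + (\<Sum>j\<in>{1..1}. Dx a * (Dy ^^ j) \<psi>) = 0"
    if \<psi>: "\<psi> \<in> sol u" for \<psi>
  proof -
    have "Dx (Dy (a * \<psi>)) = u * (a * \<psi>)" using sol[OF \<psi>] a[OF \<psi>] by (simp add: sol_def)
    then show ?thesis using \<psi> by (simp add: sol_def Dy_mult Dx_mult algebra_simps)
  qed
  then have "(\<forall>i\<le>1::nat. (if i = 0 then Dx (Dy a) else Dy a) = 0) \<and> (\<forall>j\<in>{1..1::nat}. Dx a = 0)"
    by (intro normal_form_free[where A = "\<lambda>i. if i = 0 then Dx (Dy a) else Dy a" and B = "\<lambda>_. Dx a"])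
  then have "Dx a = 0" "Dy a = 0" by (auto dest: spec[of _ 1])
  have "cf a i j = cf (cst (cf a 0 0)) i j" for i j
  proof (cases i)
    case 0
    show ?thesis
    proof (cases j)
      case (Suc j')
      then show ?thesis using \<open>Dy a = 0\<close> cf_Dy[of a i j'] by (simp add: cf_cst del: of_nat_Suc)
    qed (simp add: cf_cst 0)
  next
    case (Suc i')
    then show ?thesis using \<open>Dx a = 0\<close> cf_Dx[of a i' j] by (simp add: cf_cst del: of_nat_Suc)
  qed
  then have c: "a = cst (cf a 0 0)" by (rule ps2_eqI)
  define b where "b r s = (if s = 0 then if r = 0 then - cf a 0 0 else 1 else 0)" for r s :: nat
  have "polyK 1 b L1 L2 \<psi> = 0" if "\<psi> \<in> sol u" for \<psi>
  proof -
    have "polyK 1 b L1 L2 \<psi> = cst (- cf a 0 0) * \<psi> + L1 \<psi>"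
      by (simp add: polyK_def b_def)
    also have "\<dots> = 0" using a[OF that] c by (metis (no_types) add.left_inverse cst_def fps_const_neg mult_minus_left)
    finally show ?thesis .
  qed
  moreover have "b 1 0 \<noteq> 0" by (simp add: b_def)
  then have "\<exists>r\<le>1. \<exists>s\<le>1. b r s \<noteq> 0" by (meson le_refl zero_le_one)
  ultimately show ?thesis by blast
qed

lemma algebraic_dependence_formal:
  assumes lin: "lin L1" "lin L2"
    and sol: "\<And>\<psi>. \<psi> \<in> sol u \<Longrightarrow> L1 \<psi> \<in> sol u" "\<And>\<psi>. \<psi> \<in> sol u \<Longrightarrow> L2 \<psi> \<in> sol u"
    and comm: "\<And>\<psi>. \<psi> \<in> sol u \<Longrightarrow> L1 (L2 \<psi>) = L2 (L1 \<psi>)"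
    and nf: "\<And>\<psi>. \<psi> \<in> sol u \<Longrightarrow> L1 \<psi> = nf A1 n1 B1 m1 \<psi>" "\<And>\<psi>. \<psi> \<in> sol u \<Longrightarrow> L2 \<psi> = nf A2 n2 B2 m2 \<psi>"
    and lead: "n1 = 0 \<or> cf (A1 n1) 0 0 \<noteq> 0" "m1 = 0 \<or> cf (B1 m1) 0 0 \<noteq> 0"
      "n2 = 0 \<or> cf (A2 n2) 0 0 \<noteq> 0" "m2 = 0 \<or> cf (B2 m2) 0 0 \<noteq> 0"
  shows "\<exists>N b. (\<exists>r\<le>N. \<exists>s\<le>N. b r s \<noteq> 0) \<and> (\<forall>\<psi>\<in>sol u. polyK N b L1 L2 \<psi> = 0)"
proof -
  define L where "L \<psi> = L1 \<psi> + L2 \<psi>" for \<psi>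
  have L: "lin L" "\<And>\<psi>. \<psi> \<in> sol u \<Longrightarrow> L \<psi> \<in> sol u"
    "\<And>\<psi>. \<psi> \<in> sol u \<Longrightarrow> L (L1 \<psi>) = L1 (L \<psi>)" "\<And>\<psi>. \<psi> \<in> sol u \<Longrightarrow> L (L2 \<psi>) = L2 (L \<psi>)"
    using lin comm by (auto simp: L_def lin_def algebra_simps sol sol_add)
  have pos: "k = 0 \<or> k \<ge> 1" for k :: nat by linarith
  \<comment> \<open>If neither operator has both orders positive, then one uses only
    \<open>X\<close> and the other only \<open>Y\<close>, or both lack the same derivative, or
    \<open>L1\<close> is a multiplication.\<close>
  consider (one) "n1 \<ge> 1" "m1 \<ge> 1" | (two) "n2 \<ge> 1" "m2 \<ge> 1"
    | (mixed12) "n1 \<ge> 1" "m1 = 0" "n2 = 0" "m2 \<ge> 1" | (mixed21) "n1 = 0" "m1 \<ge> 1" "n2 \<ge> 1" "m2 = 0"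
    | (y1) "n1 = 0" "n2 = 0" "m1 \<ge> 1" | (y2) "n1 = 0" "n2 = 0" "m2 \<ge> 1"
    | (x1) "m1 = 0" "m2 = 0" "n1 \<ge> 1" | (x2) "m1 = 0" "m2 = 0" "n2 \<ge> 1"
    | (const) "n1 = 0" "m1 = 0"
    using pos[of n1] pos[of m1] pos[of n2] pos[of m2] by blast
  then show ?thesis
  proof cases
    case one
    show ?thesis
      by (rule generic_case[OF lin(1) sol(1) sol refl comm nf(1) nf one]) (use lead one in auto)
  next
    case two
    show ?thesis
      by (rule generic_case[OF lin(2) sol(2) sol comm[symmetric] refl nf(2) nf two]) (use lead two in auto)
  next
    case mixed12
    \<comment> \<open>The order-zero term of \<open>L2\<close> moves into the first family; since
      \<open>n1 \<ge> 1\<close>, the leading coefficient at \<open>n1\<close> is unaffected.\<close>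
    have "L \<psi> = nf (\<lambda>i. A1 i + (if i = 0 then A2 0 else 0)) n1 B2 m2 \<psi>" if "\<psi> \<in> sol u" for \<psi>
    proof -
      have "{..n1} = insert 0 {1..n1}" by auto
      then show ?thesis using that mixed12 by (simp add: L_def nf nf_def algebra_simps)
    qed
    from generic_case[OF L(1,2) sol L(3,4) this nf mixed12(1,4)] show ?thesis
      using lead mixed12 by auto
  next
    case mixed21
    have "L \<psi> = nf (\<lambda>i. A2 i + (if i = 0 then A1 0 else 0)) n2 B1 m1 \<psi>" if "\<psi> \<in> sol u" for \<psi>
    proof -
      have "{..n2} = insert 0 {1..n2}" by auto
      then show ?thesis using that mixed21 by (simp add: L_def nf nf_def algebra_simps)
    qed
    from generic_case[OF L(1,2) sol L(3,4) this nf mixed21(3,2)] show ?thesis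
      using lead mixed21 by auto
  next
    case y1
    show ?thesis
      by (rule y_case[OF lin(1) sol(1) sol refl comm nf(1)[unfolded y1(1)] nf[unfolded y1(1,2)] y1(3)]) (use lead y1 in auto)
  next
    case y2
    show ?thesis
      by (rule y_case[OF lin(2) sol(2) sol comm[symmetric] refl nf(2)[unfolded y2(2)] nf[unfolded y2(1,2)] y2(3)]) (use lead y2 in auto)
  next
    case x1
    show ?thesis
      by (rule x_case[OF lin(1) sol(1) sol refl comm nf(1)[unfolded x1(1)] nf[unfolded x1(1,2)] x1(3)]) (use lead x1 in auto)
  next
    case x2
    show ?thesis
      by (rule x_case[OF lin(2) sol(2) sol comm[symmetric] refl nf(2)[unfolded x2(2)] nf[unfolded x2(1,2)] x2(3)]) (use lead x2 in auto)
  next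
    case const
    show ?thesis
      by (rule constant_case[OF sol(1) nf(1)[unfolded const]])
  qed
qed

section \<open>Convergent power series and Taylor expansion\<close>

definition ser :: "ps2 \<Rightarrow> complex \<Rightarrow> complex \<Rightarrow> complex \<Rightarrow> bool" where
  "ser F h k s \<longleftrightarrow> ((\<lambda>(i, j). cf F i j * h ^ i * k ^ j) has_sum s) UNIV"

lemma ser_unique: "ser F h k s \<Longrightarrow> ser F h k t \<Longrightarrow> s = t"
  unfolding ser_def by (rule has_sum_unique)

lemma ser_swap: "ser (swap F) k h s \<longleftrightarrow> ser F h k s"
proof -
  have "ser F h k s \<longleftrightarrow> ((\<lambda>(i, j). cf F j i * h ^ j * k ^ i) has_sum s) UNIV"
    unfolding ser_def using has_sum_swap[where f = "\<lambda>(i, j). cf F i j * h ^ i * k ^ j" and S = s and A = UNIV and B = UNIV]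
    by (simp add: case_prod_unfold)
  then show ?thesis by (simp add: ser_def mult_ac)
qed

lemma ser_0: "ser 0 h k 0"
  unfolding ser_def by (simp add: case_prod_unfold)

lemma ser_at_0: "ser F 0 0 (cf F 0 0)"
  unfolding ser_def
  by (rule has_sum_finite_neutralI[where B = "{(0, 0)}"]) (auto simp: power_0_left split: if_splits)

lemma ser_add: "ser F h k s \<Longrightarrow> ser G h k t \<Longrightarrow> ser (F + G) h k (s + t)"
  unfolding ser_def by (drule (1) has_sum_add) (simp add: case_prod_unfold algebra_simps)

text \<open>Unordered summability of complex families is absolute, and this makes the product family
  summable.\<close>

lemma has_sum_times:
  fixes f :: "'a \<Rightarrow> complex" and g :: "'b \<Rightarrow> complex"
  assumes "(f has_sum s) A" "(g has_sum t) B"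
  shows "((\<lambda>(x, y). f x * g y) has_sum (s * t)) (A \<times> B)"
proof (rule has_sum_SigmaI[where g = "\<lambda>x. f x * t"])
  show "((\<lambda>y. case (x, y) of (x, y) \<Rightarrow> f x * g y) has_sum f x * t) B" for x
    using has_sum_cmult_right[OF assms(2)] by simp
  show "((\<lambda>x. f x * t) has_sum s * t) A"
    by (rule has_sum_cmult_left[OF assms(1)])
  have f: "(\<lambda>x. norm (f x)) summable_on A" and g: "(\<lambda>x. norm (g x)) summable_on B"
    using assms by (auto simp: summable_on_iff_abs_summable_on_complex[symmetric] has_sum_imp_summable)
  have "(\<lambda>p. norm (case p of (x, y) \<Rightarrow> f x * g y)) summable_on (A \<times> B)"
    by (rule Infinite_Sum.abs_summable_on_Sigma_iff[THEN iffD2])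
       (use f g in \<open>auto simp: norm_mult abs_mult infsum_cmult_right' intro!: summable_on_cmult_right summable_on_cmult_left\<close>)
  then show "(\<lambda>(x, y). f x * g y) summable_on A \<times> B"
    by (simp add: summable_on_iff_abs_summable_on_complex)
qed

lemma ser_mult:
  assumes "ser F h k s" "ser G h k t"
  shows "ser (F * G) h k (s * t)"
proof -
  define a where "a F = (\<lambda>(i, j). cf F i j * h ^ i * k ^ j)" for F
  have "((\<lambda>(x, y). a F x * a G y) has_sum (s * t)) (UNIV \<times> UNIV)"
    using has_sum_times[OF assms[unfolded ser_def]] by (simp add: a_def)
  \<comment> \<open>Pairs of exponents are regrouped by their sum, which exhibits the Cauchy
    product.\<close>
  also have "?this \<longleftrightarrow> ((\<lambda>(x, y). a F y * a G (fst x - fst y, snd x - snd y)) has_sum (s * t))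
      (Sigma UNIV (\<lambda>x. {..fst x} \<times> {..snd x}))"
    by (rule has_sum_reindex_bij_witness[where
          i = "\<lambda>(x, y). (y, (fst x - fst y, snd x - snd y))" and
          j = "\<lambda>(x, y). ((fst x + fst y, snd x + snd y), x)"]) auto
  finally have "((\<lambda>x. \<Sum>y\<in>{..fst x} \<times> {..snd x}. a F y * a G (fst x - fst y, snd x - snd y)) has_sum (s * t)) UNIV"
    by (rule has_sum_SigmaD) (auto intro!: has_sum_finiteI)
  also have "(\<lambda>x. \<Sum>y\<in>{..fst x} \<times> {..snd x}. a F y * a G (fst x - fst y, snd x - snd y)) = a (F * G)"
  proof
    fix x :: "nat \<times> nat"
    have "(\<Sum>y\<in>{..fst x} \<times> {..snd x}. a F y * a G (fst x - fst y, snd x - snd y)) =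
        (\<Sum>y\<in>{..fst x} \<times> {..snd x}. h ^ fst x * k ^ snd x *
           (cf F (fst y) (snd y) * cf G (fst x - fst y) (snd x - snd y)))"
    proof (intro sum.cong refl)
      fix y assume "y \<in> {..fst x} \<times> {..snd x}"
      then have "h ^ fst x = h ^ fst y * h ^ (fst x - fst y)" "k ^ snd x = k ^ snd y * k ^ (snd x - snd y)"
        by (auto simp flip: power_add)
      then show "a F y * a G (fst x - fst y, snd x - snd y) = h ^ fst x * k ^ snd x *
           (cf F (fst y) (snd y) * cf G (fst x - fst y) (snd x - snd y))"
        by (simp add: a_def case_prod_unfold)
    qed
    then show "(\<Sum>y\<in>{..fst x} \<times> {..snd x}. a F y * a G (fst x - fst y, snd x - snd y)) = a (F * G) x"
      by (simp add: a_def case_prod_unfold cf_mult sum.cartesian_product flip: sum_distrib_left)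
  qed
  finally show ?thesis by (simp add: ser_def a_def)
qed

text \<open>For fixed \<open>k\<close> the double series collapses to a power series in
  \<open>h\<close>, which may be differentiated termwise. Absolute summability of the differentiated
  double series is shown separately, and summing it over \<open>j\<close> first identifies its value
  with the derivative.\<close>

lemma ser_Dx:
  assumes g: "\<And>h k. cmod h < r \<Longrightarrow> cmod k < r \<Longrightarrow> ser F h k (g h k)"
    and h: "cmod h < r" and k: "cmod k < r"
  shows "\<exists>d. ((\<lambda>h. g h k) has_field_derivative d) (at h) \<and> ser (Dx F) h k d"
proof -
  have "cmod h < r" by fact
  \<comment> \<open>The gap between \<open>cmod h\<close> and \<open>\<rho>\<close> absorbs the
    factor \<open>Suc n\<close> produced by differentiation:
    \<open>Suc n * (cmod h / \<rho>) ^ n\<close> is bounded, and its bound \<open>C\<close> drives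
    the comparison below.\<close>
  then obtain \<rho> where \<rho>: "cmod h < \<rho>" "\<rho> < r" using dense by blast
  have \<rho>0: "\<rho> > 0" using \<rho>(1) norm_ge_zero[of h] by linarith
  define R where "R i = infsum (\<lambda>j. cf F i j * k ^ j) UNIV" for i
  have R: "((\<lambda>j. cf F i j * k ^ j) has_sum R i) UNIV" for i
  proof -
    have "ser F (of_real \<rho>) k (g (of_real \<rho>) k)"
      by (rule g) (use \<rho> \<rho>0 k in auto)
    then have "(\<lambda>(i, j). cf F i j * of_real \<rho> ^ i * k ^ j) summable_on (UNIV \<times> UNIV)"
      unfolding ser_def using has_sum_imp_summable by simp
    then have "(\<lambda>j. cf F i j * of_real \<rho> ^ i * k ^ j) summable_on UNIV"
      by (rule summable_on_SigmaD1) simp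
    then have "(\<lambda>j. (1 / of_real \<rho> ^ i) * (cf F i j * of_real \<rho> ^ i * k ^ j)) summable_on UNIV"
      by (rule summable_on_cmult_right)
    then show ?thesis using \<rho>0 unfolding R_def by (simp add: summable_iff_has_sum_infsum)
  qed
  have sums: "(\<lambda>i. R i * z ^ i) sums g z k" if "cmod z < r" for z
  proof -
    have "((\<lambda>(i, j). cf F i j * z ^ i * k ^ j) has_sum g z k) (UNIV \<times> UNIV)"
      using g[OF that k] by (simp add: ser_def)
    then have "((\<lambda>i. R i * z ^ i) has_sum g z k) UNIV"
    proof (rule has_sum_SigmaD)
      show "((\<lambda>j. case (i, j) of (i, j) \<Rightarrow> cf F i j * z ^ i * k ^ j) has_sum R i * z ^ i) UNIV" for i
        using has_sum_cmult_left[OF R[of i], of "z ^ i"] by (simp add: mult_ac)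
    qed
    then show ?thesis by (rule has_sum_imp_sums)
  qed
  define d where "d = (\<Sum>n. diffs R n * h ^ n)"
  have "((\<lambda>z. \<Sum>n. R n * z ^ n) has_field_derivative d) (at h)"
    unfolding d_def by (rule termdiffs_strong'[OF _ h]) (use sums in \<open>auto simp: sums_iff\<close>)
  then have deriv: "((\<lambda>z. g z k) has_field_derivative d) (at h)"
  proof (rule has_field_derivative_transform_within_open)
    show "open (ball 0 r :: complex set)" "h \<in> ball 0 r" using h by auto
    show "(\<Sum>n. R n * z ^ n) = g z k" if "z \<in> ball 0 r" for z
      using sums[of z] that by (simp add: sums_iff)
  qed
  have "summable (\<lambda>n. diffs (\<lambda>_. 1 :: complex) n * (of_real (cmod h / \<rho>)) ^ n)"
  proof (rule termdiff_converges[where K = 1])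
    show "norm (complex_of_real (cmod h / \<rho>)) < 1" using \<rho> \<rho>0 by (simp add: norm_divide)
  qed (simp add: summable_geometric)
  then have "Bseq (\<lambda>n. diffs (\<lambda>_. 1 :: complex) n * (of_real (cmod h / \<rho>)) ^ n)"
    using summable_imp_Bseq by blast
  then obtain C where C: "\<And>n. norm (diffs (\<lambda>_. 1 :: complex) n * (of_real (cmod h / \<rho>)) ^ n) \<le> C" "C > 0"
    unfolding Bseq_def by blast
  have C': "of_nat (Suc n) * cmod h ^ n \<le> C * \<rho> ^ n" for n
  proof -
    have "of_nat (Suc n) * (cmod h / \<rho>) ^ n \<le> C"
      using C(1)[of n] \<rho>0 by (simp add: diffs_def norm_mult norm_power norm_divide del: of_nat_Suc)
    then show ?thesis using \<rho>0 by (simp add: power_divide field_simps del: of_nat_Suc)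
  qed
  have "(\<lambda>(i, j). cf F i j * of_real \<rho> ^ i * k ^ j) summable_on UNIV"
    using g[of "of_real \<rho>" k] \<rho> \<rho>0 k unfolding ser_def by (auto intro: has_sum_imp_summable)
  then have "(\<lambda>x. norm (case x of (i, j) \<Rightarrow> cf F i j * of_real \<rho> ^ i * k ^ j)) summable_on UNIV"
    by (simp add: summable_on_iff_abs_summable_on_complex)
  then have "(\<lambda>x. norm (case x of (i, j) \<Rightarrow> cf F i j * of_real \<rho> ^ i * k ^ j)) summable_on (\<lambda>(i, j). (Suc i, j)) ` UNIV"
    by (rule summable_on_subset_banach) auto
  then have "((\<lambda>x. norm (case x of (i, j) \<Rightarrow> cf F i j * of_real \<rho> ^ i * k ^ j)) \<circ> (\<lambda>(i, j). (Suc i, j))) summable_on UNIV"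
    by (subst (asm) summable_on_reindex) (auto simp: inj_on_def)
  then have "(\<lambda>x. C / \<rho> * ((\<lambda>x. norm (case x of (i, j) \<Rightarrow> cf F i j * of_real \<rho> ^ i * k ^ j)) \<circ> (\<lambda>(i, j). (Suc i, j))) x) summable_on UNIV"
    by (rule summable_on_cmult_right)
  then have "(\<lambda>x. norm (case x of (i, j) \<Rightarrow> cf (Dx F) i j * h ^ i * k ^ j)) summable_on UNIV"
  proof (rule Infinite_Sum.abs_summable_on_comparison_test')
    fix x :: "nat \<times> nat"
    obtain i j where x: "x = (i, j)" by (cases x)
    have "norm (cf (Dx F) i j * h ^ i * k ^ j) = (of_nat (Suc i) * cmod h ^ i) * (cmod (cf F (Suc i) j) * cmod k ^ j)"
      by (simp add: cf_Dx norm_mult norm_power mult_ac del: of_nat_Suc)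
    also have "\<dots> \<le> (C * \<rho> ^ i) * (cmod (cf F (Suc i) j) * cmod k ^ j)"
      by (intro mult_right_mono C') auto
    also have "\<dots> = C / \<rho> * norm (cf F (Suc i) j * of_real \<rho> ^ Suc i * k ^ j)"
      using \<rho>0 by (simp add: norm_mult norm_power)
    finally show "norm (case x of (i, j) \<Rightarrow> cf (Dx F) i j * h ^ i * k ^ j) \<le>
        C / \<rho> * ((\<lambda>x. norm (case x of (i, j) \<Rightarrow> cf F i j * of_real \<rho> ^ i * k ^ j)) \<circ> (\<lambda>(i, j). (Suc i, j))) x"
      by (simp only: x case_prod_conv o_apply)
  qed
  then obtain S where S: "ser (Dx F) h k S"
    unfolding ser_def summable_on_iff_abs_summable_on_complex[symmetric] summable_on_def by blast
  then have "((\<lambda>(i, j). cf (Dx F) i j * h ^ i * k ^ j) has_sum S) (UNIV \<times> UNIV)"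
    by (simp add: ser_def)
  then have "((\<lambda>i. diffs R i * h ^ i) has_sum S) UNIV"
  proof (rule has_sum_SigmaD)
    show "((\<lambda>j. case (i, j) of (i, j) \<Rightarrow> cf (Dx F) i j * h ^ i * k ^ j) has_sum diffs R i * h ^ i) UNIV" for i
      using has_sum_cmult_left[OF R[of "Suc i"], of "of_nat (Suc i) * h ^ i"]
      by (simp add: cf_Dx diffs_def mult_ac del: of_nat_Suc)
  qed
  then have "S = d" unfolding d_def using has_sum_imp_sums sums_unique by blast
  then show ?thesis using deriv S by blast
qed

section \<open>Local expansions and Taylor series\<close>

definition expands :: "complex \<times> complex \<Rightarrow> ps2 \<Rightarrow> (complex \<times> complex \<Rightarrow> complex) \<Rightarrow> bool" where
  "expands p F f \<longleftrightarrow> (\<exists>r>0. \<forall>h k. cmod h < r \<longrightarrow> cmod k < r \<longrightarrow> ser F h k (f (fst p + h, snd p + k)))"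

lemma expandsE2:
  assumes "expands p F f" "expands p G g"
  obtains r where "r > 0" "\<And>h k. cmod h < r \<Longrightarrow> cmod k < r \<Longrightarrow> ser F h k (f (fst p + h, snd p + k))"
    "\<And>h k. cmod h < r \<Longrightarrow> cmod k < r \<Longrightarrow> ser G h k (g (fst p + h, snd p + k))"
proof -
  obtain r s where "r > 0" "\<forall>h k. cmod h < r \<longrightarrow> cmod k < r \<longrightarrow> ser F h k (f (fst p + h, snd p + k))"
    "s > 0" "\<forall>h k. cmod h < s \<longrightarrow> cmod k < s \<longrightarrow> ser G h k (g (fst p + h, snd p + k))"
    using assms unfolding expands_def by blast
  then show ?thesis by (intro that[of "min r s"]) auto
qed

lemma expands_add:
  assumes "expands p F f" "expands p G g"
  shows "expands p (F + G) (\<lambda>q. f q + g q)"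
  using expandsE2[OF assms] unfolding expands_def by (metis ser_add)

lemma expands_mult:
  assumes "expands p F f" "expands p G g"
  shows "expands p (F * G) (\<lambda>q. f q * g q)"
  using expandsE2[OF assms] unfolding expands_def by (metis ser_mult)

lemma expands_const: "expands p (cst c) (\<lambda>_. c)"
  unfolding expands_def ser_def
  by (intro exI[of _ 1] conjI allI impI has_sum_finite_neutralI[where B = "{(0, 0)}"])
     (auto simp: cf_cst split: if_splits)

lemma expands_value: "expands p F f \<Longrightarrow> f p = cf F 0 0"
  unfolding expands_def using ser_unique[OF _ ser_at_0] by force

lemma expands_Dx:
  assumes "expands p F f"
  shows "expands p (Dx F) (dX f)"
proof -
  obtain r where r: "r > 0" "\<And>h k. cmod h < r \<Longrightarrow> cmod k < r \<Longrightarrow> ser F h k (f (fst p + h, snd p + k))"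
    using assms unfolding expands_def by blast
  have "ser (Dx F) h k (dX f (fst p + h, snd p + k))" if hk: "cmod h < r" "cmod k < r" for h k
  proof -
    obtain d where d: "((\<lambda>h. f (fst p + h, snd p + k)) has_field_derivative d) (at h)" "ser (Dx F) h k d"
      using ser_Dx[OF r(2) hk] by blast
    have "((\<lambda>t. f (t, snd p + k)) has_field_derivative d) (at (h + fst p))"
      using d(1) DERIV_shift[of "\<lambda>t. f (t, snd p + k)" d h "fst p"] by (simp add: add.commute)
    then have "dX f (fst p + h, snd p + k) = d"
      by (simp add: dX_def DERIV_imp_deriv add.commute)
    then show ?thesis using d(2) by simp
  qed
  then show ?thesis using r(1) unfolding expands_def by blast
qed

lemma expands_swap:
  assumes "expands p F f"
  shows "expands (prod.swap p) (swap F) (f \<circ> prod.swap)"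
  using assms unfolding expands_def by (force simp: ser_swap)

lemma dY_eq_dX: "dY f = dX (f \<circ> prod.swap) \<circ> prod.swap"
  by (auto simp: dX_def dY_def fun_eq_iff)

lemma expands_Dy:
  assumes "expands p F f"
  shows "expands p (Dy F) (dY f)"
  using expands_swap[OF expands_Dx[OF expands_swap[OF assms]]]
  by (simp add: dY_eq_dX)

lemma expands_dX_funpow: "expands p F f \<Longrightarrow> expands p ((Dx ^^ n) F) ((dX ^^ n) f)"
  and expands_dY_funpow: "expands p F f \<Longrightarrow> expands p ((Dy ^^ n) F) ((dY ^^ n) f)"
  by (induction n) (auto intro: expands_Dx expands_Dy)

text \<open>Defined through derivatives, so that it is total; \<open>taylor_eqI\<close> identifies
  it with any convergent expansion.\<close>

definition taylor :: "complex \<times> complex \<Rightarrow> (complex \<times> complex \<Rightarrow> complex) \<Rightarrow> ps2" where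
  "taylor p f = ps2_of (\<lambda>i j. (dX ^^ i) ((dY ^^ j) f) p / (fact i * fact j))"

lemma taylor_eqI:
  assumes "expands p F f"
  shows "taylor p f = F"
proof (rule ps2_eqI)
  fix i j
  have "(dX ^^ i) ((dY ^^ j) f) p = cf ((Dx ^^ i) ((Dy ^^ j) F)) 0 0"
    by (intro expands_value expands_dX_funpow expands_dY_funpow assms)
  then show "cf (taylor p f) i j = cf F i j"
    by (simp add: taylor_def cf_Dx_pow cf_Dy_pow)
qed

lemma taylor_value [simp]: "cf (taylor p f) 0 0 = f p"
  by (simp add: taylor_def)

lemma polydisc_in_open:
  assumes "open U" "p \<in> U"
  obtains r where "r > 0" "\<And>h k. cmod h < r \<Longrightarrow> cmod k < r \<Longrightarrow> (fst p + h, snd p + k) \<in> U"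
proof -
  obtain A B where AB: "open A" "open B" "fst p \<in> A" "snd p \<in> B" "A \<times> B \<subseteq> U"
    using open_prod_elim[OF assms] by (metis mem_Times_iff)
  obtain r s where rs: "r > 0" "ball (fst p) r \<subseteq> A" "s > 0" "ball (snd p) s \<subseteq> B"
    using AB by (meson openE)
  show thesis
  proof (rule that[of "min r s"])
    fix h k assume "cmod h < min r s" "cmod k < min r s"
    then have "fst p + h \<in> ball (fst p) r" "snd p + k \<in> ball (snd p) s" by (auto simp: dist_norm)
    then show "(fst p + h, snd p + k) \<in> U" using rs AB by blast
  qed (use rs in auto)
qed

lemma expands_cong:
  assumes "expands p F f" "open U" "p \<in> U" "\<And>q. q \<in> U \<Longrightarrow> f q = g q"
  shows "expands p F g"
proof -
  obtain r where r: "r > 0" "\<And>h k. cmod h < r \<Longrightarrow> cmod k < r \<Longrightarrow> ser F h k (f (fst p + h, snd p + k))"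
    using assms(1) unfolding expands_def by blast
  obtain s where s: "s > 0" "\<And>h k. cmod h < s \<Longrightarrow> cmod k < s \<Longrightarrow> (fst p + h, snd p + k) \<in> U"
    using polydisc_in_open[OF assms(2,3)] by blast
  have "ser F h k (g (fst p + h, snd p + k))" if hk: "cmod h < min r s" "cmod k < min r s" for h k
  proof -
    have "g (fst p + h, snd p + k) = f (fst p + h, snd p + k)"
      using assms(4)[OF s(2)] hk by simp
    then show ?thesis using r(2) hk by simp
  qed
  moreover have "min r s > 0" using r(1) s(1) by simp
  ultimately show ?thesis unfolding expands_def by blast
qed

text \<open>\<open>expands\<close> does not ask the polydisc to lie in a given domain; openness of
  \<open>U\<close> allows shrinking it into \<open>U\<close>.\<close>

lemma analytic2_iff_expands:
  assumes "open U"
  shows "analytic2 U f \<longleftrightarrow> (\<forall>p\<in>U. \<exists>F. expands p F f)"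
proof
  assume f: "analytic2 U f"
  show "\<forall>p\<in>U. \<exists>F. expands p F f"
  proof
    fix p assume "p \<in> U"
    then have "\<exists>r>0. \<exists>c. \<forall>z w. cmod (z - fst p) < r \<and> cmod (w - snd p) < r \<longrightarrow> (z, w) \<in> U \<and>
        ((\<lambda>(i, j). c i j * (z - fst p) ^ i * (w - snd p) ^ j) has_sum f (z, w)) UNIV"
      using f unfolding analytic2_def by (rule bspec[rotated])
    then obtain r c where r: "r > 0" and c: "\<forall>z w. cmod (z - fst p) < r \<and> cmod (w - snd p) < r \<longrightarrow>
        (z, w) \<in> U \<and> ((\<lambda>(i, j). c i j * (z - fst p) ^ i * (w - snd p) ^ j) has_sum f (z, w)) UNIV"
      by (elim exE conjE)
    have "ser (ps2_of c) h k (f (fst p + h, snd p + k))" if "cmod h < r" "cmod k < r" for h k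
      using c[rule_format, of "fst p + h" "snd p + k"] that by (simp add: ser_def)
    then have "expands p (ps2_of c) f" unfolding expands_def using r by blast
    then show "\<exists>F. expands p F f" by blast
  qed
next
  assume e: "\<forall>p\<in>U. \<exists>F. expands p F f"
  show "analytic2 U f" unfolding analytic2_def
  proof
    fix p assume p: "p \<in> U"
    obtain F r where r: "r > 0" "\<And>h k. cmod h < r \<Longrightarrow> cmod k < r \<Longrightarrow> ser F h k (f (fst p + h, snd p + k))"
      using e p unfolding expands_def by blast
    obtain s where s: "s > 0" "\<And>h k. cmod h < s \<Longrightarrow> cmod k < s \<Longrightarrow> (fst p + h, snd p + k) \<in> U"
      using polydisc_in_open[OF assms p] by blast
    show "\<exists>r>0. \<exists>c. \<forall>z w. cmod (z - fst p) < r \<and> cmod (w - snd p) < r \<longrightarrow> (z, w) \<in> U \<and>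
        ((\<lambda>(i, j). c i j * (z - fst p) ^ i * (w - snd p) ^ j) has_sum f (z, w)) UNIV"
    proof (intro exI[of _ "min r s"] conjI exI[of _ "cf F"] allI impI)
      fix z w assume zw: "cmod (z - fst p) < min r s \<and> cmod (w - snd p) < min r s"
      show "(z, w) \<in> U" using s(2)[of "z - fst p" "w - snd p"] zw by simp
      show "((\<lambda>(i, j). cf F i j * (z - fst p) ^ i * (w - snd p) ^ j) has_sum f (z, w)) UNIV"
        using r(2)[of "z - fst p" "w - snd p"] zw by (simp add: ser_def)
    qed (use r s in auto)
  qed
qed

lemma analytic2_expands:
  assumes "open U" "analytic2 U f" "p \<in> U"
  shows "expands p (taylor p f) f"
  using assms analytic2_iff_expands taylor_eqI by metis

lemma taylor_cong:
  assumes "open U" "analytic2 U f" "p \<in> U" "\<And>q. q \<in> U \<Longrightarrow> f q = g q"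
  shows "taylor p g = taylor p f"
  by (rule taylor_eqI, rule expands_cong[OF analytic2_expands]) (use assms in auto)

lemma analytic2_cong:
  assumes "open U" "analytic2 U f" "\<And>q. q \<in> U \<Longrightarrow> f q = g q"
  shows "analytic2 U g"
  using assms expands_cong[OF _ assms(1)] unfolding analytic2_iff_expands[OF assms(1)] by meson

lemma analytic2_const: "open U \<Longrightarrow> analytic2 U (\<lambda>_. c)"
  using expands_const by (auto simp: analytic2_iff_expands)

lemma analytic2_add: "open U \<Longrightarrow> analytic2 U f \<Longrightarrow> analytic2 U g \<Longrightarrow> analytic2 U (\<lambda>q. f q + g q)"
  and analytic2_mult: "open U \<Longrightarrow> analytic2 U f \<Longrightarrow> analytic2 U g \<Longrightarrow> analytic2 U (\<lambda>q. f q * g q)"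
  by (simp_all only: analytic2_iff_expands) (blast intro: expands_add expands_mult)+

lemma analytic2_dX: "open U \<Longrightarrow> analytic2 U f \<Longrightarrow> analytic2 U (dX f)"
  and analytic2_dY: "open U \<Longrightarrow> analytic2 U f \<Longrightarrow> analytic2 U (dY f)"
  by (simp_all only: analytic2_iff_expands) (blast intro: expands_Dx expands_Dy)+

lemma analytic2_sum:
  "open U \<Longrightarrow> (\<And>i. i \<in> I \<Longrightarrow> analytic2 U (f i)) \<Longrightarrow> analytic2 U (\<lambda>q. \<Sum>i\<in>I. f i q)"
  by (induction I rule: infinite_finite_induct) (auto intro: analytic2_add analytic2_const)

lemma analytic2_dX_funpow: "open U \<Longrightarrow> analytic2 U f \<Longrightarrow> analytic2 U ((dX ^^ n) f)"
  and analytic2_dY_funpow: "open U \<Longrightarrow> analytic2 U f \<Longrightarrow> analytic2 U ((dY ^^ n) f)"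
  by (induction n) (auto intro: analytic2_dX analytic2_dY)

lemma taylor_const: "taylor p (\<lambda>_. c) = cst c"
  by (rule taylor_eqI[OF expands_const])

context
  fixes U :: "(complex \<times> complex) set" and p
  assumes U: "open U" and p: "p \<in> U"
begin

lemma taylor_add: "analytic2 U f \<Longrightarrow> analytic2 U g \<Longrightarrow> taylor p (\<lambda>q. f q + g q) = taylor p f + taylor p g"
  and taylor_mult: "analytic2 U f \<Longrightarrow> analytic2 U g \<Longrightarrow> taylor p (\<lambda>q. f q * g q) = taylor p f * taylor p g"
  and taylor_dX: "analytic2 U f \<Longrightarrow> taylor p (dX f) = Dx (taylor p f)"
  and taylor_dY: "analytic2 U f \<Longrightarrow> taylor p (dY f) = Dy (taylor p f)"
  by (rule taylor_eqI; intro expands_add expands_mult expands_Dx expands_Dy analytic2_expands[OF U _ p]; assumption)+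

lemma taylor_dX_funpow: "analytic2 U f \<Longrightarrow> taylor p ((dX ^^ n) f) = (Dx ^^ n) (taylor p f)"
  and taylor_dY_funpow: "analytic2 U f \<Longrightarrow> taylor p ((dY ^^ n) f) = (Dy ^^ n) (taylor p f)"
  by (rule taylor_eqI; intro expands_dX_funpow expands_dY_funpow analytic2_expands[OF U _ p]; assumption)+

end

section \<open>Polynomials and the identity theorem\<close>

lemma expands_polynomial:
  "expands p (ps2_of (\<lambda>i j. if i \<le> N \<and> j \<le> N then c i j else 0))
     (\<lambda>q. \<Sum>i\<le>N. \<Sum>j\<le>N. c i j * (fst q - fst p) ^ i * (snd q - snd p) ^ j)"
  unfolding expands_def ser_def
  by (intro exI[of _ 1] conjI allI impI has_sum_finite_neutralI[where B = "{..N} \<times> {..N}"])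
     (auto simp: sum.cartesian_product intro!: sum.cong split: if_splits)

lemma analytic2_polynomial:
  assumes "open U"
  shows "analytic2 U (\<lambda>q. \<Sum>i\<le>N. \<Sum>j\<le>N. c i j * (fst q - a) ^ i * (snd q - b) ^ j)"
proof -
  have "expands p (ps2_of (\<lambda>i j. if (i, j) = (0, 0) then fst p - a else if (i, j) = (1, 0) then 1 else 0)) (\<lambda>q. fst q - a)"
    and "expands p (ps2_of (\<lambda>i j. if (i, j) = (0, 0) then snd p - b else if (i, j) = (0, 1) then 1 else 0)) (\<lambda>q. snd q - b)" for p
    unfolding expands_def ser_def
    by (intro exI[of _ 1] conjI allI impI has_sum_finite_neutralI[where B = "{(0, 0), (1, 0), (0, 1)}"]; auto split: if_splits)+
  then have "analytic2 U (\<lambda>q. fst q - a)" "analytic2 U (\<lambda>q. snd q - b)"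
    unfolding analytic2_iff_expands[OF assms] by blast+
  then have "analytic2 U (\<lambda>q. (fst q - a) ^ n)" "analytic2 U (\<lambda>q. (snd q - b) ^ n)" for n
    by (induction n) (use assms in \<open>auto intro: analytic2_const analytic2_mult\<close>)
  then show ?thesis using assms
    by (intro analytic2_sum analytic2_mult analytic2_const) auto
qed

text \<open>Uniqueness is propagated through a polydisc one variable at a time.\<close>

lemma polydisc_continuation:
  assumes hol: "\<And>k. k \<in> ball 0 r \<Longrightarrow> (\<lambda>h. g h k) holomorphic_on ball 0 r"
      "\<And>h. h \<in> ball 0 r \<Longrightarrow> (\<lambda>k. g h k) holomorphic_on ball 0 r"
    and A: "open A" "A \<subseteq> ball 0 r" "a \<in> A" and B: "open B" "B \<subseteq> ball 0 r" "b \<in> B"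
    and z: "\<And>h k. h \<in> A \<Longrightarrow> k \<in> B \<Longrightarrow> g h k = (0 :: complex)"
    and hk: "h \<in> ball 0 r" "k \<in> ball 0 r"
  shows "g h k = 0"
proof -
  have cont: "f w = 0" if "f holomorphic_on ball 0 r" "open A" "A \<subseteq> ball 0 r" "a \<in> A" "\<And>z. z \<in> A \<Longrightarrow> f z = 0"
    "w \<in> ball 0 r" for f :: "complex \<Rightarrow> complex" and A a w
    by (rule analytic_continuation_open[of A "ball 0 r" f "\<lambda>_. 0"]) (use that in auto)
  have row: "g h' k' = 0" if h': "h' \<in> ball 0 r" and k': "k' \<in> B" for h' k'
  proof (rule cont[of "\<lambda>h. g h k'" A a])
    show "(\<lambda>h. g h k') holomorphic_on ball 0 r" using hol(1) B(2) k' by blast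
  qed (use A z k' h' in auto)
  show ?thesis
  proof (rule cont[of "\<lambda>k. g h k" B b])
    show "(\<lambda>k. g h k) holomorphic_on ball 0 r" using hol(2) hk by blast
    show "g h k = 0" if "k \<in> B" for k using row hk that by blast
  qed (use B hk in auto)
qed

text \<open>Vanishing near a point spreads from any point of a polydisc of convergence to the whole
  polydisc, and connectedness carries it through \<open>U\<close>.\<close>

lemma analytic2_eq_0:
  assumes U: "open U" "connected U" and f: "analytic2 U f" and p: "p \<in> U" "taylor p f = 0" and q: "q \<in> U"
  shows "f q = 0"
proof -
  define P where "P p \<longleftrightarrow> (\<exists>A B. open A \<and> open B \<and> fst p \<in> A \<and> snd p \<in> B \<and> (\<forall>z\<in>A. \<forall>w\<in>B. f (z, w) = 0))" for p
  have "P q"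
  proof (rule connected_induction_simple[OF U(2) p(1) q, of P])
    have "expands p 0 f" using analytic2_expands[OF U(1) f p(1)] p(2) by simp
    then obtain r where r: "r > 0" "\<And>h k. cmod h < r \<Longrightarrow> cmod k < r \<Longrightarrow> ser 0 h k (f (fst p + h, snd p + k))"
      unfolding expands_def by blast
    have "f (z, w) = 0" if "z \<in> ball (fst p) r" "w \<in> ball (snd p) r" for z w
      using ser_unique[OF r(2)[of "z - fst p" "w - snd p"] ser_0] that by (simp add: dist_norm norm_minus_commute)
    then show "P p" unfolding P_def
      by (intro exI[of _ "ball (fst p) r"] exI[of _ "ball (snd p) r"]) (use r in auto)
  next
    fix a assume a: "a \<in> U"
    obtain F r0 where r0: "r0 > 0" "\<And>h k. cmod h < r0 \<Longrightarrow> cmod k < r0 \<Longrightarrow> ser F h k (f (fst a + h, snd a + k))"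
      using analytic2_expands[OF U(1) f a] unfolding expands_def by blast
    obtain s where s: "s > 0" "\<And>h k. cmod h < s \<Longrightarrow> cmod k < s \<Longrightarrow> (fst a + h, snd a + k) \<in> U"
      using polydisc_in_open[OF U(1) a] by blast
    define r where "r = min r0 s"
    define g where "g h k = f (fst a + h, snd a + k)" for h k
    have r: "r > 0" "\<And>h k. cmod h < r \<Longrightarrow> cmod k < r \<Longrightarrow> ser F h k (g h k)"
      using r0 s by (auto simp: r_def g_def)
    define T where "T = ball (fst a) r \<times> ball (snd a) r"
    have "open T" unfolding T_def by (intro open_Times) auto
    have "T \<subseteq> U"
    proof
      fix x assume "x \<in> T"
      then show "x \<in> U" using s(2)[of "fst x - fst a" "snd x - snd a"]
        by (auto simp: T_def r_def dist_norm norm_minus_commute)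
    qed
    have hol1: "(\<lambda>h. g h k) holomorphic_on ball 0 r" if "k \<in> ball 0 r" for k
      using ser_Dx[of r F g, OF r(2)] that by (subst holomorphic_on_open) fastforce+
    have r': "ser (swap F) k h (g h k)" if "cmod k < r" "cmod h < r" for h k
      using r(2) that by (simp add: ser_swap)
    have hol2: "(\<lambda>k. g h k) holomorphic_on ball 0 r" if "h \<in> ball 0 r" for h
      using ser_Dx[of r "swap F" "\<lambda>k h. g h k", OF r'] that by (subst holomorphic_on_open) fastforce+
    have "P y" if x: "x \<in> T" "P x" and y: "y \<in> T" for x y
    proof -
      obtain A B where AB: "open A" "open B" "fst x \<in> A" "snd x \<in> B" "\<And>z w. z \<in> A \<Longrightarrow> w \<in> B \<Longrightarrow> f (z, w) = 0"
        using x(2) unfolding P_def by blast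
      \<comment> \<open>Recentring at \<open>a\<close> and cutting down to the polydisc gives the
        zero box the shape required by \<open>polydisc_continuation\<close>.\<close>
      define A' where "A' = (+) (- fst a) ` (A \<inter> ball (fst a) r)"
      define B' where "B' = (+) (- snd a) ` (B \<inter> ball (snd a) r)"
      have AB': "open A'" "open B'" unfolding A'_def B'_def by (intro open_translation open_Int AB open_ball)+
      have "g h k = 0" if "h \<in> ball 0 r" "k \<in> ball 0 r" for h k
      proof (rule polydisc_continuation[OF hol1 hol2 AB'(1) _ _ AB'(2)])
        show "A' \<subseteq> ball 0 r" "B' \<subseteq> ball 0 r" by (auto simp: A'_def B'_def dist_norm norm_minus_commute)
        show "- fst a + fst x \<in> A'" "- snd a + snd x \<in> B'"
          using AB x(1) by (auto simp: A'_def B'_def T_def)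
        show "g h k = 0" if "h \<in> A'" "k \<in> B'" for h k
          using that AB(5) by (auto simp: A'_def B'_def g_def)
      qed (use that in auto)
      then have "f (z, w) = 0" if "z \<in> ball (fst a) r" "w \<in> ball (snd a) r" for z w
        using that unfolding g_def by (metis add_diff_cancel_left' diff_add_cancel add.commute dist_norm mem_ball mem_ball_0 norm_minus_commute)
      then show "P y" unfolding P_def
        by (intro exI[of _ "ball (fst a) r"] exI[of _ "ball (snd a) r"]) (use y in \<open>auto simp: T_def\<close>)
    qed
    moreover have "openin (top_of_set U) T" using \<open>open T\<close> \<open>T \<subseteq> U\<close> by (simp add: open_subset)
    moreover have "a \<in> T" using r(1) by (simp add: T_def mem_Times_iff)
    ultimately show "\<exists>T. openin (top_of_set U) T \<and> a \<in> T \<and> (\<forall>x\<in>T. \<forall>y\<in>T. P x \<longrightarrow> P y)" by blast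
  qed
  then show ?thesis unfolding P_def by (metis prod.collapse)
qed

section \<open>Differential operators and division by the second-order operator\<close>

lemma Dx_Dy_funpow: "Dx ((Dy ^^ j) f) = (Dy ^^ j) (Dx f)"
  by (induction j) (simp_all add: Dx_Dy)

lemma Dy_Dx_funpow: "Dy ((Dx ^^ j) f) = (Dx ^^ j) (Dy f)"
  by (induction j) (simp_all flip: Dx_Dy)

lemma Dx_funpow_add: "(Dx ^^ n) (f + g) = (Dx ^^ n) f + (Dx ^^ n) g"
  and Dy_funpow_add: "(Dy ^^ n) (f + g) = (Dy ^^ n) f + (Dy ^^ n) g"
  by (induction n) simp_all

text \<open>Rules for partial derivatives of analytic functions are reduced by this to identities
  already proved for formal series.\<close>

lemma analytic_eq_taylorI: "taylor p f = taylor p g \<Longrightarrow> f p = g p"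
  by (metis taylor_value)

context
  fixes U :: "(complex \<times> complex) set"
  assumes U: "open U"
begin

lemma partial_analytic: "d = dX \<or> d = dY \<Longrightarrow> analytic2 U f \<Longrightarrow> analytic2 U (d f)"
  using analytic2_dX[OF U] analytic2_dY[OF U] by blast

lemma partial_funpow_analytic: "d = dX \<or> d = dY \<Longrightarrow> analytic2 U f \<Longrightarrow> analytic2 U ((d ^^ n) f)"
  using analytic2_dX_funpow[OF U] analytic2_dY_funpow[OF U] by blast

text \<open>Functions are total and arbitrary off \<open>U\<close>; openness makes derivatives at
  points of \<open>U\<close> depend only on the values in \<open>U\<close>.\<close>

lemma partial_cong:
  assumes "d = dX \<or> d = dY" "analytic2 U f" "p \<in> U" "\<And>q. q \<in> U \<Longrightarrow> f q = g q"
  shows "d g p = d f p"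
proof -
  have "analytic2 U g" using analytic2_cong[OF U assms(2,4)] .
  then show ?thesis
    using assms taylor_cong[OF U assms(2,3,4)] taylor_dX[OF U assms(3)] taylor_dY[OF U assms(3)]
    by (metis analytic_eq_taylorI)
qed

lemma partial_mult:
  assumes "d = dX \<or> d = dY" "p \<in> U" "analytic2 U f" "analytic2 U g"
  shows "d (\<lambda>q. f q * g q) p = d f p * g p + f p * d g p"
proof -
  note an = assms(3,4) analytic2_dX[OF U assms(3)] analytic2_dX[OF U assms(4)]
    analytic2_dY[OF U assms(3)] analytic2_dY[OF U assms(4)] analytic2_mult[OF U] analytic2_add[OF U]
  note t = taylor_mult[OF U assms(2)] taylor_add[OF U assms(2)] taylor_dX[OF U assms(2)] taylor_dY[OF U assms(2)]
  have "dX (\<lambda>q. f q * g q) p = (\<lambda>p. dX f p * g p + f p * dX g p) p"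
    by (rule analytic_eq_taylorI) (simp add: an t Dx_mult)
  moreover have "dY (\<lambda>q. f q * g q) p = (\<lambda>p. dY f p * g p + f p * dY g p) p"
    by (rule analytic_eq_taylorI) (simp add: an t Dy_mult)
  ultimately show ?thesis using assms(1) by auto
qed

lemma partial_add:
  assumes "d = dX \<or> d = dY" "p \<in> U" "analytic2 U f" "analytic2 U g"
  shows "d (\<lambda>q. f q + g q) p = d f p + d g p"
proof -
  note an = assms(3,4) analytic2_dX[OF U assms(3)] analytic2_dX[OF U assms(4)]
    analytic2_dY[OF U assms(3)] analytic2_dY[OF U assms(4)] analytic2_add[OF U]
  note t = taylor_add[OF U assms(2)] taylor_dX[OF U assms(2)] taylor_dY[OF U assms(2)]
  have "dX (\<lambda>q. f q + g q) p = (\<lambda>p. dX f p + dX g p) p"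
    by (rule analytic_eq_taylorI) (simp add: an t)
  moreover have "dY (\<lambda>q. f q + g q) p = (\<lambda>p. dY f p + dY g p) p"
    by (rule analytic_eq_taylorI) (simp add: an t)
  ultimately show ?thesis using assms(1) by auto
qed

lemma partial_0: "d = dX \<or> d = dY \<Longrightarrow> d (\<lambda>_. 0) p = 0"
  by (auto simp: dX_def dY_def split: prod.splits)

lemma partial_sum:
  assumes "d = dX \<or> d = dY" "p \<in> U" "\<And>i. i \<in> I \<Longrightarrow> analytic2 U (f i)"
  shows "d (\<lambda>q. \<Sum>i\<in>I. f i q) p = (\<Sum>i\<in>I. d (f i) p)"
  using assms(3)
  by (induction I rule: infinite_finite_induct)
     (simp_all add: partial_0[OF assms(1)] partial_add[OF assms(1,2)] analytic2_sum U)

lemma partial_funpow_add: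
  assumes "d = dX \<or> d = dY" "p \<in> U" "analytic2 U f" "analytic2 U g"
  shows "(d ^^ n) (\<lambda>q. f q + g q) p = (d ^^ n) f p + (d ^^ n) g p"
proof -
  note an = assms(3,4) analytic2_dX_funpow[OF U] analytic2_dY_funpow[OF U] analytic2_add[OF U]
  note t = taylor_add[OF U assms(2)] taylor_dX_funpow[OF U assms(2)] taylor_dY_funpow[OF U assms(2)]
  have "(dX ^^ n) (\<lambda>q. f q + g q) p = (\<lambda>p. (dX ^^ n) f p + (dX ^^ n) g p) p"
    by (rule analytic_eq_taylorI) (simp add: an t Dx_funpow_add)
  moreover have "(dY ^^ n) (\<lambda>q. f q + g q) p = (\<lambda>p. (dY ^^ n) f p + (dY ^^ n) g p) p"
    by (rule analytic_eq_taylorI) (simp add: an t Dy_funpow_add)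
  ultimately show ?thesis using assms(1) by auto
qed

lemma partial_e_funpow:
  assumes "(d = dX \<and> e = dY) \<or> (d = dY \<and> e = dX)" "p \<in> U" "analytic2 U f"
  shows "d ((e ^^ n) f) p = (e ^^ n) (d f) p"
proof -
  note an = assms(3) analytic2_dX[OF U] analytic2_dY[OF U] analytic2_dX_funpow[OF U] analytic2_dY_funpow[OF U]
  note t = taylor_dX[OF U assms(2)] taylor_dY[OF U assms(2)] taylor_dX_funpow[OF U assms(2)] taylor_dY_funpow[OF U assms(2)]
  have "dX ((dY ^^ n) f) p = (dY ^^ n) (dX f) p" "dY ((dX ^^ n) f) p = (dX ^^ n) (dY f) p"
    by (rule analytic_eq_taylorI; simp add: an t Dx_Dy_funpow Dy_Dx_funpow)+
  then show ?thesis using assms(1) by auto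
qed

lemma diffop_cong:
  assumes "diffop U T" "\<And>g p. analytic2 U g \<Longrightarrow> p \<in> U \<Longrightarrow> T g p = T' g p"
  shows "diffop U T'"
proof -
  obtain a N where "\<And>i j. analytic2 U (a i j)"
    "\<And>g p. analytic2 U g \<Longrightarrow> p \<in> U \<Longrightarrow> T g p = (\<Sum>i\<le>N. \<Sum>j\<le>N. a i j p * (dX ^^ i) ((dY ^^ j) g) p)"
    using assms(1) unfolding diffop_def by blast
  then show ?thesis unfolding diffop_def
    by (intro exI[of _ a] exI[of _ N]) (simp add: assms(2)[symmetric])
qed

lemma diffop_monomial:
  assumes "analytic2 U a"
  shows "diffop U (\<lambda>g q. a q * (dX ^^ i) ((dY ^^ j) g) q)"
  unfolding diffop_def
proof (intro exI conjI allI impI ballI)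
  show "analytic2 U (if k = i \<and> l = j then a else (\<lambda>_. 0))" for k l
    using assms analytic2_const[OF U] by simp
  fix g p
  have "(\<Sum>k\<le>i + j. \<Sum>l\<le>i + j. (if k = i \<and> l = j then a else (\<lambda>_. 0)) p * (dX ^^ k) ((dY ^^ l) g) p) =
      (\<Sum>k\<le>i + j. \<Sum>l\<le>i + j. if l = j then if k = i then a p * (dX ^^ i) ((dY ^^ j) g) p else 0 else 0)"
    by (intro sum.cong refl) simp
  then show "a p * (dX ^^ i) ((dY ^^ j) g) p =
      (\<Sum>k\<le>i + j. \<Sum>l\<le>i + j. (if k = i \<and> l = j then a else (\<lambda>_. 0)) p * (dX ^^ k) ((dY ^^ l) g) p)"
    by simp
qed

text \<open>Zero padding gives two operators a common order bound, so that their coefficients can be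
  added.\<close>

lemma diffop_padded:
  assumes "diffop U T"
  obtains a N where "\<And>i j. analytic2 U (a i j)"
    "\<And>M g p. M \<ge> N \<Longrightarrow> analytic2 U g \<Longrightarrow> p \<in> U \<Longrightarrow> T g p = (\<Sum>i\<le>M. \<Sum>j\<le>M. a i j p * (dX ^^ i) ((dY ^^ j) g) p)"
proof -
  obtain a N where a: "\<And>i j. analytic2 U (a i j)"
    "\<And>g p. analytic2 U g \<Longrightarrow> p \<in> U \<Longrightarrow> T g p = (\<Sum>i\<le>N. \<Sum>j\<le>N. a i j p * (dX ^^ i) ((dY ^^ j) g) p)"
    using assms unfolding diffop_def by blast
  define b where "b i j = (if i \<le> N \<and> j \<le> N then a i j else (\<lambda>_. 0))" for i j
  show thesis
  proof
    show "analytic2 U (b i j)" for i j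
      using a(1) analytic2_const[OF U] by (simp add: b_def)
    fix M g p assume M: "M \<ge> N" and g: "analytic2 U g" "p \<in> U"
    have "T g p = (\<Sum>x\<in>{..N} \<times> {..N}. a (fst x) (snd x) p * (dX ^^ fst x) ((dY ^^ snd x) g) p)"
      using a(2)[OF g] by (simp add: sum.cartesian_product case_prod_unfold)
    also have "\<dots> = (\<Sum>x\<in>{..M} \<times> {..M}. b (fst x) (snd x) p * (dX ^^ fst x) ((dY ^^ snd x) g) p)"
      by (rule sum.mono_neutral_cong_left) (use M in \<open>auto simp: b_def\<close>)
    finally show "T g p = (\<Sum>i\<le>M. \<Sum>j\<le>M. b i j p * (dX ^^ i) ((dY ^^ j) g) p)"
      by (simp add: sum.cartesian_product case_prod_unfold)
  qed
qed

lemma diffop_add: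
  assumes "diffop U T" "diffop U T'"
  shows "diffop U (\<lambda>g q. T g q + T' g q)"
proof -
  obtain a N where a: "\<And>i j. analytic2 U (a i j)"
    "\<And>M g p. M \<ge> N \<Longrightarrow> analytic2 U g \<Longrightarrow> p \<in> U \<Longrightarrow> T g p = (\<Sum>i\<le>M. \<Sum>j\<le>M. a i j p * (dX ^^ i) ((dY ^^ j) g) p)"
    using diffop_padded[OF assms(1)] by blast
  obtain b N' where b: "\<And>i j. analytic2 U (b i j)"
    "\<And>M g p. M \<ge> N' \<Longrightarrow> analytic2 U g \<Longrightarrow> p \<in> U \<Longrightarrow> T' g p = (\<Sum>i\<le>M. \<Sum>j\<le>M. b i j p * (dX ^^ i) ((dY ^^ j) g) p)"
    using diffop_padded[OF assms(2)] by blast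
  show ?thesis unfolding diffop_def
    by (intro exI[of _ "\<lambda>i j q. a i j q + b i j q"] exI[of _ "N + N'"])
       (simp add: a(1) b(1) a(2)[of "N + N'"] b(2)[of "N + N'"] analytic2_add U distrib_right sum.distrib)
qed

lemma diffop_0: "diffop U (\<lambda>g q. 0)"
  using diffop_monomial[OF analytic2_const[OF U, of 0], of 0 0] by simp

lemma diffop_sum: "(\<And>i. i \<in> I \<Longrightarrow> diffop U (T i)) \<Longrightarrow> diffop U (\<lambda>g q. \<Sum>i\<in>I. T i g q)"
  by (induction I rule: infinite_finite_induct) (simp_all add: diffop_0 diffop_add)

lemma diffop_mult:
  assumes "analytic2 U f" "diffop U T"
  shows "diffop U (\<lambda>g q. f q * T g q)"
proof -
  obtain a N where a: "\<And>i j. analytic2 U (a i j)"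
    "\<And>g p. analytic2 U g \<Longrightarrow> p \<in> U \<Longrightarrow> T g p = (\<Sum>i\<le>N. \<Sum>j\<le>N. a i j p * (dX ^^ i) ((dY ^^ j) g) p)"
    using assms(2) unfolding diffop_def by blast
  show ?thesis unfolding diffop_def
    by (intro exI[of _ "\<lambda>i j q. f q * a i j q"] exI[of _ N])
       (simp add: a assms(1) analytic2_mult U sum_distrib_left mult.assoc)
qed

lemma diffop_analytic:
  assumes "diffop U T" "analytic2 U g"
  shows "analytic2 U (T g)"
proof -
  obtain a N where a: "\<And>i j. analytic2 U (a i j)"
    "\<And>p. p \<in> U \<Longrightarrow> T g p = (\<Sum>i\<le>N. \<Sum>j\<le>N. a i j p * (dX ^^ i) ((dY ^^ j) g) p)"
    using assms unfolding diffop_def by blast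
  have "analytic2 U (\<lambda>p. \<Sum>i\<le>N. \<Sum>j\<le>N. a i j p * (dX ^^ i) ((dY ^^ j) g) p)"
    by (intro analytic2_sum U analytic2_mult a analytic2_dX_funpow analytic2_dY_funpow assms)
  then show ?thesis by (rule analytic2_cong[OF U]) (simp add: a(2))
qed

text \<open>Leibniz rule, with \<open>dY\<close> moved past the powers of \<open>dX\<close> to keep
  monomials in the fixed order. Closure under composition rests on it.\<close>

lemma diffop_partial:
  assumes d: "d = dX \<or> d = dY" and T: "diffop U T"
  shows "diffop U (\<lambda>g. d (T g))"
proof -
  obtain a N where a: "\<And>i j. analytic2 U (a i j)"
    "\<And>g p. analytic2 U g \<Longrightarrow> p \<in> U \<Longrightarrow> T g p = (\<Sum>i\<le>N. \<Sum>j\<le>N. a i j p * (dX ^^ i) ((dY ^^ j) g) p)"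
    using T unfolding diffop_def by blast
  have mon: "diffop U (\<lambda>g q. b q * d ((dX ^^ i) ((dY ^^ j) g)) q)" if b: "analytic2 U b" for b i j
  proof (rule disjE[OF d])
    assume "d = dX"
    then show ?thesis using diffop_monomial[OF b, of "Suc i" j] by simp
  next
    assume "d = dY"
    then show ?thesis
      by (intro diffop_cong[OF diffop_monomial[OF b, of i "Suc j"]])
         (use partial_e_funpow[of dY dX] analytic2_dY_funpow[OF U] in simp)
  qed
  have "diffop U (\<lambda>g q. \<Sum>i\<le>N. \<Sum>j\<le>N. d (a i j) q * (dX ^^ i) ((dY ^^ j) g) q + a i j q * d ((dX ^^ i) ((dY ^^ j) g)) q)"
    by (intro diffop_sum diffop_add mon diffop_monomial partial_analytic[OF d] a)
  then show ?thesis
  proof (rule diffop_cong)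
    fix g p assume g: "analytic2 U g" and p: "p \<in> U"
    note an = a(1) analytic2_dX_funpow[OF U analytic2_dY_funpow[OF U g]]
    have "d (T g) p = d (\<lambda>p. \<Sum>i\<le>N. \<Sum>j\<le>N. a i j p * (dX ^^ i) ((dY ^^ j) g) p) p"
      by (rule partial_cong[OF d _ p]) (use a(2)[OF g] an U in \<open>auto intro!: analytic2_sum analytic2_mult\<close>)
    also have "\<dots> = (\<Sum>i\<le>N. \<Sum>j\<le>N. d (\<lambda>p. a i j p * (dX ^^ i) ((dY ^^ j) g) p) p)"
      by (simp add: partial_sum[OF d p] an analytic2_sum analytic2_mult U)
    finally show "(\<Sum>i\<le>N. \<Sum>j\<le>N. d (a i j) p * (dX ^^ i) ((dY ^^ j) g) p + a i j p * d ((dX ^^ i) ((dY ^^ j) g)) p) = d (T g) p"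
      by (simp add: partial_mult[OF d p] an)
  qed
qed

lemma diffop_partial_funpow: "d = dX \<or> d = dY \<Longrightarrow> diffop U T \<Longrightarrow> diffop U (\<lambda>g. (d ^^ n) (T g))"
  by (induction n) (use diffop_partial[of d] in auto)

lemma diffop_comp:
  assumes "diffop U A" "diffop U B"
  shows "diffop U (\<lambda>g. A (B g))"
proof -
  obtain a N where a: "\<And>i j. analytic2 U (a i j)"
    "\<And>g p. analytic2 U g \<Longrightarrow> p \<in> U \<Longrightarrow> A g p = (\<Sum>i\<le>N. \<Sum>j\<le>N. a i j p * (dX ^^ i) ((dY ^^ j) g) p)"
    using assms(1) unfolding diffop_def by blast
  have "diffop U (\<lambda>g q. \<Sum>i\<le>N. \<Sum>j\<le>N. a i j q * (dX ^^ i) ((dY ^^ j) (B g)) q)"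
    by (intro diffop_sum diffop_mult a diffop_partial_funpow assms) auto
  then show ?thesis by (rule diffop_cong) (simp add: a(2) diffop_analytic[OF assms(2)])
qed

lemma diffop_id: "diffop U (\<lambda>g. g)"
  using diffop_monomial[OF analytic2_const[OF U, of 1], of 0 0] by simp

lemma diffop_funpow: "diffop U A \<Longrightarrow> diffop U B \<Longrightarrow> diffop U (\<lambda>g. (A ^^ n) (B g))"
  by (induction n) (use diffop_comp in auto)

lemma diffop_polyop:
  assumes "diffop U L1" "diffop U L2"
  shows "diffop U (polyop N b L1 L2)"
proof -
  have "diffop U (\<lambda>g q. \<Sum>r\<le>N. \<Sum>s\<le>N. b r s * (L1 ^^ r) ((L2 ^^ s) g) q)"
    by (intro diffop_sum diffop_mult[OF analytic2_const[OF U]] diffop_funpow[OF assms(1)]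
          diffop_funpow[OF assms(2) diffop_id])
  then show ?thesis by (simp add: polyop_def[abs_def])
qed

lemma diffop_Hop:
  assumes "analytic2 U u"
  shows "diffop U (Hop u)"
proof -
  have "diffop U (\<lambda>g q. (-1) * (dX ^^ 1) ((dY ^^ 1) g) q + u q * (dX ^^ 0) ((dY ^^ 0) g) q)"
    by (intro diffop_add diffop_monomial analytic2_const U assms)
  then show ?thesis by (rule diffop_cong) (simp add: Hop_def)
qed

section \<open>Division by \<open>H\<close>\<close>

lemma leibniz_form:
  assumes d: "d = dX \<or> d = dY" and f: "analytic2 U f"
  shows "\<exists>C. (\<forall>l. analytic2 U (C l)) \<and>
    (\<forall>g. analytic2 U g \<longrightarrow> (\<forall>q\<in>U. (d ^^ j) (\<lambda>q. f q * g q) q = (\<Sum>l\<le>j. C l q * (d ^^ l) g q)))"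
proof (induction j)
  case 0
  then show ?case using f by (intro exI[of _ "\<lambda>_. f"]) simp
next
  case (Suc j)
  then obtain C where C: "\<And>l. analytic2 U (C l)"
    "\<And>g q. analytic2 U g \<Longrightarrow> q \<in> U \<Longrightarrow> (d ^^ j) (\<lambda>q. f q * g q) q = (\<Sum>l\<le>j. C l q * (d ^^ l) g q)" by blast
  define C1 where "C1 l = (if l \<le> j then d (C l) else (\<lambda>_. 0))" for l
  define C2 where "C2 l = (if l = 0 then (\<lambda>_. 0) else C (l - 1))" for l
  have an: "analytic2 U (C1 l)" "analytic2 U (C2 l)" for l
    using partial_analytic[OF d C(1)] C(1) analytic2_const[OF U] by (auto simp: C1_def C2_def)
  show ?case
  proof (intro exI[of _ "\<lambda>l q. C1 l q + C2 l q"] conjI allI impI ballI)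
    show "analytic2 U (\<lambda>q. C1 l q + C2 l q)" for l
      by (intro analytic2_add U an)
    fix g q assume g: "analytic2 U g" and q: "q \<in> U"
    note gan = partial_funpow_analytic[OF d g]
    have "(d ^^ Suc j) (\<lambda>q. f q * g q) q = d (\<lambda>q. \<Sum>l\<le>j. C l q * (d ^^ l) g q) q"
      unfolding funpow.simps o_apply
      by (rule partial_cong[OF d _ q]) (use C(2)[OF g] C(1) gan U in \<open>auto intro!: analytic2_sum analytic2_mult\<close>)
    also have "\<dots> = (\<Sum>l\<le>j. d (C l) q * (d ^^ l) g q + C l q * (d ^^ Suc l) g q)"
      by (simp add: partial_sum[OF d q] partial_mult[OF d q] C(1) gan analytic2_mult U)
    also have "\<dots> = (\<Sum>l\<le>j. d (C l) q * (d ^^ l) g q) + (\<Sum>l\<le>j. C l q * (d ^^ Suc l) g q)"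
      by (rule sum.distrib)
    also have "(\<Sum>l\<le>j. d (C l) q * (d ^^ l) g q) = (\<Sum>l\<le>Suc j. C1 l q * (d ^^ l) g q)"
      by (simp add: C1_def)
    also have "(\<Sum>l\<le>j. C l q * (d ^^ Suc l) g q) = (\<Sum>l\<le>Suc j. C2 l q * (d ^^ l) g q)"
      by (subst sum.atMost_Suc_shift) (simp add: C2_def)
    finally show "(d ^^ Suc j) (\<lambda>q. f q * g q) q = (\<Sum>l\<le>Suc j. (C1 l q + C2 l q) * (d ^^ l) g q)"
      by (simp only: distrib_right sum.distrib)
  qed
qed

text \<open>A loose form of the remainder: both sums start at \<open>0\<close> and share one bound,
  which makes closure properties easy. Uniqueness is restored in
  \<open>normal_form_exists\<close>.\<close>

definition nform :: "(complex \<times> complex \<Rightarrow> complex) \<Rightarrow> op2 \<Rightarrow> bool" where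
  "nform u T \<longleftrightarrow> (\<exists>S A B N. diffop U S \<and> (\<forall>i. analytic2 U (A i)) \<and> (\<forall>j. analytic2 U (B j)) \<and>
     (\<forall>g. analytic2 U g \<longrightarrow> (\<forall>q\<in>U. T g q =
        S (Hop u g) q + (\<Sum>i\<le>N. A i q * (dX ^^ i) g q) + (\<Sum>j\<le>N. B j q * (dY ^^ j) g q))))"

lemma nform_cong:
  assumes "nform u T" "\<And>g p. analytic2 U g \<Longrightarrow> p \<in> U \<Longrightarrow> T g p = T' g p"
  shows "nform u T'"
  using assms unfolding nform_def by simp

lemma padded_sum:
  fixes f :: "nat \<Rightarrow> 'a \<Rightarrow> complex"
  shows "N \<le> M \<Longrightarrow> (\<Sum>i\<le>N. f i q * h i) = (\<Sum>i\<le>M. (if i \<le> N then f i else (\<lambda>_. 0)) q * h i)"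
  by (rule sum.mono_neutral_cong_left) auto

lemma nform_add:
  assumes "nform u T" "nform u T'"
  shows "nform u (\<lambda>g q. T g q + T' g q)"
proof -
  obtain S A B N where 1: "diffop U S" "\<And>i. analytic2 U (A i)" "\<And>j. analytic2 U (B j)"
    "\<And>g q. analytic2 U g \<Longrightarrow> q \<in> U \<Longrightarrow> T g q =
        S (Hop u g) q + (\<Sum>i\<le>N. A i q * (dX ^^ i) g q) + (\<Sum>j\<le>N. B j q * (dY ^^ j) g q)"
    using assms(1) unfolding nform_def by blast
  obtain S' A' B' N' where 2: "diffop U S'" "\<And>i. analytic2 U (A' i)" "\<And>j. analytic2 U (B' j)"
    "\<And>g q. analytic2 U g \<Longrightarrow> q \<in> U \<Longrightarrow> T' g q =
        S' (Hop u g) q + (\<Sum>i\<le>N'. A' i q * (dX ^^ i) g q) + (\<Sum>j\<le>N'. B' j q * (dY ^^ j) g q)"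
    using assms(2) unfolding nform_def by blast
  define M where "M = N + N'"
  define ext where "ext N C i = (if i \<le> N then C i else (\<lambda>_. 0))" for N :: nat and C :: "nat \<Rightarrow> complex \<times> complex \<Rightarrow> complex" and i
  have an: "analytic2 U (\<lambda>q. ext N C i q + ext N' C' i q)"
    if "\<And>i. analytic2 U (C i)" "\<And>i. analytic2 U (C' i)" for C C' i
    by (intro analytic2_add U) (use that analytic2_const[OF U] in \<open>auto simp: ext_def\<close>)
  have sum: "(\<Sum>i\<le>N. C i q * h i) + (\<Sum>i\<le>N'. C' i q * h i) = (\<Sum>i\<le>M. (ext N C i q + ext N' C' i q) * h i)" for C C' q h
    unfolding padded_sum[of N M C, unfolded M_def, OF le_add1] padded_sum[of N' M C', unfolded M_def, OF le_add2]
    by (simp only: ext_def M_def distrib_right sum.distrib)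
  show ?thesis unfolding nform_def
  proof (intro exI conjI allI impI ballI)
    show "diffop U (\<lambda>g q. S g q + S' g q)" by (rule diffop_add[OF 1(1) 2(1)])
    show "analytic2 U (\<lambda>q. ext N A i q + ext N' A' i q)" for i using an[OF 1(2) 2(2)] .
    show "analytic2 U (\<lambda>q. ext N B i q + ext N' B' i q)" for i using an[OF 1(3) 2(3)] .
    fix g q assume "analytic2 U g" "q \<in> U"
    then show "T g q + T' g q = S (Hop u g) q + S' (Hop u g) q +
        (\<Sum>i\<le>M. (ext N A i q + ext N' A' i q) * (dX ^^ i) g q) + (\<Sum>j\<le>M. (ext N B j q + ext N' B' j q) * (dY ^^ j) g q)"
      unfolding sum[symmetric] by (simp add: 1 2)
  qed
qed

lemma nform_left:
  assumes "diffop U S"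
  shows "nform u (\<lambda>g. S (Hop u g))"
  unfolding nform_def
  by (intro exI[of _ S] exI[of _ "\<lambda>_ _. 0"] exI[of _ 0]) (simp add: assms analytic2_const U)

lemma nform_monomial:
  assumes "d = dX \<or> d = dY" and a: "analytic2 U a"
  shows "nform u (\<lambda>g q. a q * (d ^^ i) g q)"
proof -
  define A where "A k = (if k = i then a else (\<lambda>_. 0))" for k
  have an: "analytic2 U (A k)" for k using a analytic2_const[OF U] by (simp add: A_def)
  have s: "(\<Sum>k\<le>i. A k q * h k) = a q * h i" for q h
  proof -
    have "(\<Sum>k\<le>i. A k q * h k) = (\<Sum>k\<le>i. if k = i then a q * h k else 0)"
      by (intro sum.cong refl) (simp add: A_def)
    then show ?thesis by simp
  qed
  have "nform u (\<lambda>g q. a q * (dX ^^ i) g q)"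
    unfolding nform_def
    by (rule exI[of _ "\<lambda>_ _. 0"], rule exI[of _ A], rule exI[of _ "\<lambda>_ _. 0"], rule exI[of _ i])
       (simp add: an s diffop_0 analytic2_const U)
  moreover have "nform u (\<lambda>g q. a q * (dY ^^ i) g q)"
    unfolding nform_def
    by (rule exI[of _ "\<lambda>_ _. 0"], rule exI[of _ "\<lambda>_ _. 0"], rule exI[of _ A], rule exI[of _ i])
       (simp add: an s diffop_0 analytic2_const U)
  ultimately show ?thesis using assms(1) by auto
qed

lemma nform_0: "nform u (\<lambda>g q. 0)"
  using nform_left[OF diffop_0] by simp

lemma nform_sum: "(\<And>i. i \<in> I \<Longrightarrow> nform u (T i)) \<Longrightarrow> nform u (\<lambda>g q. \<Sum>i\<in>I. T i g q)"
  by (induction I rule: infinite_finite_induct) (simp_all add: nform_0 nform_add)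

lemma nform_mult:
  assumes f: "analytic2 U f" and "nform u T"
  shows "nform u (\<lambda>g q. f q * T g q)"
proof -
  obtain S A B N where 1: "diffop U S" "\<And>i. analytic2 U (A i)" "\<And>j. analytic2 U (B j)"
    "\<And>g q. analytic2 U g \<Longrightarrow> q \<in> U \<Longrightarrow> T g q =
        S (Hop u g) q + (\<Sum>i\<le>N. A i q * (dX ^^ i) g q) + (\<Sum>j\<le>N. B j q * (dY ^^ j) g q)"
    using assms(2) unfolding nform_def by blast
  have "nform u (\<lambda>g q. f q * S (Hop u g) q + (\<Sum>i\<le>N. (\<lambda>q. f q * A i q) q * (dX ^^ i) g q) +
      (\<Sum>j\<le>N. (\<lambda>q. f q * B j q) q * (dY ^^ j) g q))"
    by (intro nform_add nform_sum nform_monomial nform_left[OF diffop_mult[OF f 1(1)]] analytic2_mult U f 1) auto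
  then show ?thesis by (rule nform_cong) (simp add: 1(4) algebra_simps sum_distrib_left)
qed

text \<open>The division step. Since \<open>XY g = u g - H g\<close>, a mixed derivative with
  \<open>j = Suc k\<close> is the \<open>k\<close>-th \<open>e\<close>-derivative of
  \<open>u g - H g\<close>: the part with \<open>u g\<close> expands by \<open>leibniz_form\<close>
  into pure \<open>e\<close>-derivatives, the other is a left multiple of \<open>H\<close>.\<close>

lemma nform_mixed:
  assumes u: "analytic2 U u" and de: "(d = dX \<and> e = dY) \<or> (d = dY \<and> e = dX)"
  shows "nform u (\<lambda>g. d ((e ^^ j) g))"
proof (cases j)
  case 0
  have "nform u (\<lambda>g q. 1 * (d ^^ 1) g q)"
    by (rule nform_monomial) (use de analytic2_const[OF U] in auto)
  then show ?thesis using 0 by simp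
next
  case (Suc k)
  have e: "e = dX \<or> e = dY" using de by auto
  obtain C where C: "\<And>l. analytic2 U (C l)"
    "\<And>g q. analytic2 U g \<Longrightarrow> q \<in> U \<Longrightarrow> (e ^^ k) (\<lambda>q. u q * g q) q = (\<Sum>l\<le>k. C l q * (e ^^ l) g q)"
    using leibniz_form[OF e u, of k] by blast
  have S: "diffop U (\<lambda>g q. (e ^^ k) (\<lambda>q. (- 1) * g q) q)"
    by (rule diffop_partial_funpow[OF e]) (rule diffop_mult[OF analytic2_const[OF U] diffop_id])
  have "nform u (\<lambda>g q. (\<Sum>l\<le>k. C l q * (e ^^ l) g q) + (e ^^ k) (\<lambda>q. (- 1) * Hop u g q) q)"
    by (intro nform_add nform_sum nform_monomial[OF e] C nform_left[OF S])
  then show ?thesis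
  proof (rule nform_cong)
    fix g p assume g: "analytic2 U g" and p: "p \<in> U"
    have H: "analytic2 U (Hop u g)" by (rule diffop_analytic[OF diffop_Hop[OF u] g])
    have "(\<Sum>l\<le>k. C l p * (e ^^ l) g p) + (e ^^ k) (\<lambda>q. (- 1) * Hop u g q) p =
        (e ^^ k) (\<lambda>q. u q * g q + (- 1) * Hop u g q) p"
      by (subst partial_funpow_add[OF e p]) (simp_all only: C(2)[OF g p] analytic2_mult[OF U] u g H analytic2_const[OF U])
    also have "(\<lambda>q. u q * g q + (- 1) * Hop u g q) = dX (dY g)"
      by (simp add: Hop_def fun_eq_iff)
    also have "(e ^^ k) (dX (dY g)) p = d ((e ^^ Suc k) g) p"
    proof -
      have an: "analytic2 U (e g)" using partial_analytic[OF e g] .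
      have "d ((e ^^ Suc k) g) p = (e ^^ k) (d (e g)) p"
        using partial_e_funpow[OF de p an] by (simp add: funpow_swap1)
      moreover have "(e ^^ k) (dY (dX g)) p = (e ^^ k) (dX (dY g)) p"
      proof -
        have "taylor p (dY (dX g)) = taylor p (dX (dY g))"
          using g p U by (simp add: taylor_dX taylor_dY analytic2_dX analytic2_dY Dx_Dy)
        then have "taylor p ((e ^^ k) (dY (dX g))) = taylor p ((e ^^ k) (dX (dY g)))"
          using e g p U by (auto simp: taylor_dX_funpow taylor_dY_funpow analytic2_dX analytic2_dY)
        then show ?thesis by (rule analytic_eq_taylorI)
      qed
      ultimately show ?thesis using de by auto
    qed
    finally show "(\<Sum>l\<le>k. C l p * (e ^^ l) g p) + (e ^^ k) (\<lambda>q. (- 1) * Hop u g q) p = d ((e ^^ j) g) p"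
      using Suc by simp
  qed
qed

lemma nform_partial:
  assumes u: "analytic2 U u" and d: "d = dX \<or> d = dY" and T: "nform u T"
  shows "nform u (\<lambda>g. d (T g))"
proof -
  define e where "e = (if d = dX then dY else dX)"
  have e: "e = dX \<or> e = dY" by (simp add: e_def)
  have de: "(d = dX \<and> e = dY) \<or> (d = dY \<and> e = dX)" using d by (auto simp: e_def)
  obtain S A0 B0 N where 0: "diffop U S" "\<And>i. analytic2 U (A0 i)" "\<And>j. analytic2 U (B0 j)"
    "\<And>g q. analytic2 U g \<Longrightarrow> q \<in> U \<Longrightarrow> T g q =
        S (Hop u g) q + (\<Sum>i\<le>N. A0 i q * (dX ^^ i) g q) + (\<Sum>j\<le>N. B0 j q * (dY ^^ j) g q)"
    using T unfolding nform_def by blast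
  \<comment> \<open>The two sums are renamed so that the first belongs to \<open>d\<close>;
    differentiating it stays pure, and only the second produces mixed terms.\<close>
  have "\<exists>A B. (\<forall>i. analytic2 U (A i)) \<and> (\<forall>j. analytic2 U (B j)) \<and> (\<forall>g. analytic2 U g \<longrightarrow> (\<forall>q\<in>U. T g q =
        S (Hop u g) q + (\<Sum>i\<le>N. A i q * (d ^^ i) g q) + (\<Sum>j\<le>N. B j q * (e ^^ j) g q)))"
  proof (cases "d = dX")
    case True
    then show ?thesis using 0 by (intro exI[of _ A0] exI[of _ B0]) (simp add: e_def)
  next
    case False
    then show ?thesis using 0 d by (intro exI[of _ B0] exI[of _ A0]) (auto simp: e_def)
  qed
  then obtain A B where 1: "\<And>i. analytic2 U (A i)" "\<And>j. analytic2 U (B j)"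
    "\<And>g q. analytic2 U g \<Longrightarrow> q \<in> U \<Longrightarrow> T g q =
        S (Hop u g) q + (\<Sum>i\<le>N. A i q * (d ^^ i) g q) + (\<Sum>j\<le>N. B j q * (e ^^ j) g q)"
    by blast
  have "nform u (\<lambda>g q. d (S (Hop u g)) q +
      (\<Sum>i\<le>N. d (A i) q * (d ^^ i) g q + A i q * (d ^^ Suc i) g q) +
      (\<Sum>j\<le>N. d (B j) q * (e ^^ j) g q + B j q * d ((e ^^ j) g) q))"
    by (intro nform_add nform_sum nform_monomial[OF d] nform_monomial[OF e] nform_mult nform_mixed[OF u de]
          nform_left[OF diffop_partial[OF d 0(1)]] partial_analytic[OF d] 1)
  then show ?thesis
  proof (rule nform_cong)
    fix g p assume g: "analytic2 U g" and p: "p \<in> U"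
    have SH: "analytic2 U (S (Hop u g))" by (intro diffop_analytic[OF 0(1)] diffop_analytic[OF diffop_Hop[OF u] g])
    note an = 1(1,2) partial_funpow_analytic[OF d g] partial_funpow_analytic[OF e g]
    have an1: "analytic2 U (\<lambda>q. \<Sum>i\<le>N. A i q * (d ^^ i) g q)" "analytic2 U (\<lambda>q. \<Sum>j\<le>N. B j q * (e ^^ j) g q)"
      by (intro analytic2_sum analytic2_mult an U)+
    have "d (T g) p = d (\<lambda>q. S (Hop u g) q + (\<Sum>i\<le>N. A i q * (d ^^ i) g q) + (\<Sum>j\<le>N. B j q * (e ^^ j) g q)) p"
      by (rule partial_cong[OF d _ p]) (use 1(3)[OF g] in \<open>auto intro!: analytic2_add SH an1 U\<close>)
    also have "\<dots> = d (S (Hop u g)) p + d (\<lambda>q. \<Sum>i\<le>N. A i q * (d ^^ i) g q) p + d (\<lambda>q. \<Sum>j\<le>N. B j q * (e ^^ j) g q) p"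
      by (simp add: partial_add[OF d p] analytic2_add SH an1 U)
    finally show "d (S (Hop u g)) p +
      (\<Sum>i\<le>N. d (A i) p * (d ^^ i) g p + A i p * (d ^^ Suc i) g p) +
      (\<Sum>j\<le>N. d (B j) p * (e ^^ j) g p + B j p * d ((e ^^ j) g) p) = d (T g) p"
      by (simp add: partial_sum[OF d p] partial_mult[OF d p] an analytic2_mult U)
  qed
qed

lemma nform_partial_funpow:
  "analytic2 U u \<Longrightarrow> d = dX \<or> d = dY \<Longrightarrow> nform u T \<Longrightarrow> nform u (\<lambda>g. (d ^^ n) (T g))"
  by (induction n) (use nform_partial[of u d] in auto)

lemma nform_diffop:
  assumes "analytic2 U u" "diffop U T"
  shows "nform u T"
proof -
  obtain a N where a: "\<And>i j. analytic2 U (a i j)"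
    "\<And>g p. analytic2 U g \<Longrightarrow> p \<in> U \<Longrightarrow> T g p = (\<Sum>i\<le>N. \<Sum>j\<le>N. a i j p * (dX ^^ i) ((dY ^^ j) g) p)"
    using assms(2) unfolding diffop_def by blast
  have "nform u (\<lambda>g q. 1 * (dX ^^ 0) g q)"
    by (rule nform_monomial) (use analytic2_const[OF U] in auto)
  then have "nform u (\<lambda>g. g)" by simp
  then have "nform u (\<lambda>g q. \<Sum>i\<le>N. \<Sum>j\<le>N. a i j q * (dX ^^ i) ((dY ^^ j) g) q)"
    by (intro nform_sum nform_mult a nform_partial_funpow assms(1)) auto
  then show ?thesis by (rule nform_cong) (simp add: a(2))
qed

lemma trim:
  fixes C :: "nat \<Rightarrow> 'a \<Rightarrow> complex"
  shows "\<exists>n\<le>N. (n = 0 \<or> (\<exists>q\<in>U'. C n q \<noteq> 0)) \<and> (\<forall>i q. n < i \<longrightarrow> i \<le> N \<longrightarrow> q \<in> U' \<longrightarrow> C i q = 0)"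
proof (induction N)
  case (Suc N)
  show ?case
  proof (cases "\<exists>q\<in>U'. C (Suc N) q \<noteq> 0")
    case False
    then show ?thesis using Suc by (metis le_Suc_eq)
  qed auto
qed simp

lemma normal_form_exists:
  assumes "analytic2 U u" "diffop U T"
  obtains S A n B m where "diffop U S" "\<And>i. analytic2 U (A i)" "\<And>j. analytic2 U (B j)"
    "n = 0 \<or> (\<exists>q\<in>U. A n q \<noteq> 0)" "m = 0 \<or> (\<exists>q\<in>U. B m q \<noteq> 0)"
    "\<And>g q. analytic2 U g \<Longrightarrow> q \<in> U \<Longrightarrow> T g q =
        S (Hop u g) q + ((\<Sum>i\<le>n. A i q * (dX ^^ i) g q) + (\<Sum>j\<in>{1..m}. B j q * (dY ^^ j) g q))"
proof -
  obtain S A B N where 1: "diffop U S" "\<And>i. analytic2 U (A i)" "\<And>j. analytic2 U (B j)"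
    "\<And>g q. analytic2 U g \<Longrightarrow> q \<in> U \<Longrightarrow> T g q =
        S (Hop u g) q + (\<Sum>i\<le>N. A i q * (dX ^^ i) g q) + (\<Sum>j\<le>N. B j q * (dY ^^ j) g q)"
    using nform_diffop[OF assms] unfolding nform_def by blast
  \<comment> \<open>The two order-zero terms are merged, after which trimming leaves leading
    coefficients of positive order that are not identically zero.\<close>
  define A' where "A' i q = A i q + (if i = 0 then B 0 q else 0)" for i q
  have A': "analytic2 U (A' i)" for i
    unfolding A'_def using analytic2_add[OF U 1(2) 1(3)] 1(2) by (cases "i = 0") auto
  obtain n where n: "n \<le> N" "n = 0 \<or> (\<exists>q\<in>U. A' n q \<noteq> 0)" "\<And>i q. n < i \<Longrightarrow> i \<le> N \<Longrightarrow> q \<in> U \<Longrightarrow> A' i q = 0"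
    using trim[of N U A'] by blast
  obtain m where m: "m \<le> N" "m = 0 \<or> (\<exists>q\<in>U. B m q \<noteq> 0)" "\<And>i q. m < i \<Longrightarrow> i \<le> N \<Longrightarrow> q \<in> U \<Longrightarrow> B i q = 0"
    using trim[of N U B] by blast
  show thesis
  proof (rule that[where S = S and A = A' and n = n and B = B and m = m, OF 1(1) A' 1(3) n(2) m(2)])
    fix g q assume g: "analytic2 U g" and q: "q \<in> U"
    have i0: "{..N} = insert 0 {1..N}" by auto
    have "(\<Sum>i\<le>N. A i q * (dX ^^ i) g q) + (\<Sum>j\<le>N. B j q * (dY ^^ j) g q) =
        (\<Sum>i\<le>N. A' i q * (dX ^^ i) g q) + (\<Sum>j\<in>{1..N}. B j q * (dY ^^ j) g q)"
      unfolding i0 by (simp add: A'_def algebra_simps)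
    also have "(\<Sum>i\<le>N. A' i q * (dX ^^ i) g q) = (\<Sum>i\<le>n. A' i q * (dX ^^ i) g q)"
      by (rule sum.mono_neutral_right) (use n q in auto)
    also have "(\<Sum>j\<in>{1..N}. B j q * (dY ^^ j) g q) = (\<Sum>j\<in>{1..m}. B j q * (dY ^^ j) g q)"
      by (rule sum.mono_neutral_right) (use m(1) m(3)[of _ q] q in auto)
    finally show "T g q = S (Hop u g) q + ((\<Sum>i\<le>n. A' i q * (dX ^^ i) g q) + (\<Sum>j\<in>{1..m}. B j q * (dY ^^ j) g q))"
      using 1(4)[OF g q] by (simp add: add.assoc)
  qed
qed

end

section \<open>Action of differential operators on Taylor expansions\<close>

definition agree_upto :: "nat \<Rightarrow> ps2 \<Rightarrow> ps2 \<Rightarrow> bool" where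
  "agree_upto k f g \<longleftrightarrow> (\<forall>i\<le>k. \<forall>j\<le>k. cf f i j = cf g i j)"

text \<open>Continuity for coefficientwise agreement: every truncation of the output depends only on
  some truncation of the input.\<close>

definition cont :: "(ps2 \<Rightarrow> ps2) \<Rightarrow> bool" where
  "cont F \<longleftrightarrow> (\<forall>k. \<exists>l. \<forall>f g. agree_upto l f g \<longrightarrow> agree_upto k (F f) (F g))"

lemma agree_upto_mono: "agree_upto l f g \<Longrightarrow> k \<le> l \<Longrightarrow> agree_upto k f g"
  by (simp add: agree_upto_def)

lemma agree_upto_eqI: "(\<And>k. agree_upto k f g) \<Longrightarrow> f = g"
  by (rule ps2_eqI) (auto simp: agree_upto_def intro: le_add1 le_add2)

lemma cont_id: "cont (\<lambda>f. f)"
  unfolding cont_def by blast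

lemma cont_comp: "cont F \<Longrightarrow> cont G \<Longrightarrow> cont (\<lambda>f. F (G f))"
  unfolding cont_def by meson

lemma cont_mult_const: "cont (\<lambda>f. a * f)"
proof -
  have "agree_upto k (a * f) (a * g)" if "agree_upto k f g" for k f g
    using that by (auto simp: agree_upto_def cf_mult intro!: sum.cong)
  then show ?thesis unfolding cont_def by blast
qed

lemma cont_Dx: "cont Dx" and cont_Dy: "cont Dy"
proof -
  have "agree_upto k (Dx f) (Dx g)" "agree_upto k (Dy f) (Dy g)" if "agree_upto (Suc k) f g" for k f g
    using that by (auto simp: agree_upto_def cf_Dx cf_Dy)
  then show "cont Dx" "cont Dy" unfolding cont_def by blast+
qed

lemma cont_add:
  assumes "cont F" "cont G"
  shows "cont (\<lambda>f. F f + G f)"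
  unfolding cont_def
proof
  fix k
  obtain l l' where l: "\<And>f g. agree_upto l f g \<Longrightarrow> agree_upto k (F f) (F g)" "\<And>f g. agree_upto l' f g \<Longrightarrow> agree_upto k (G f) (G g)"
    using assms unfolding cont_def by blast
  have "agree_upto k (F f + G f) (F g + G g)" if "agree_upto (max l l') f g" for f g
    using l(1)[OF agree_upto_mono[OF that]] l(2)[OF agree_upto_mono[OF that]] by (simp add: agree_upto_def)
  then show "\<exists>l. \<forall>f g. agree_upto l f g \<longrightarrow> agree_upto k (F f + G f) (F g + G g)" by blast
qed

text \<open>\<open>F\<close> extends the action of \<open>T\<close> on Taylor series at
  \<open>p\<close> to all formal series, convergent or not. Continuity is included because it makes
  the extension unique.\<close>

definition formal :: "(complex \<times> complex) set \<Rightarrow> complex \<times> complex \<Rightarrow> op2 \<Rightarrow> (ps2 \<Rightarrow> ps2) \<Rightarrow> bool" where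
  "formal U p T F \<longleftrightarrow> lin F \<and> cont F \<and>
     (\<forall>g. analytic2 U g \<longrightarrow> analytic2 U (T g) \<and> taylor p (T g) = F (taylor p g))"

context
  fixes U :: "(complex \<times> complex) set" and p
  assumes U: "open U" and p: "p \<in> U"
begin

lemma formal_cong:
  assumes "formal U p T F" "\<And>g q. analytic2 U g \<Longrightarrow> q \<in> U \<Longrightarrow> T g q = T' g q"
  shows "formal U p T' F"
  unfolding formal_def
proof (intro conjI allI impI)
  fix g assume g: "analytic2 U g"
  have T: "analytic2 U (T g)" "taylor p (T g) = F (taylor p g)"
    using assms(1) g by (simp_all add: formal_def)
  show "analytic2 U (T' g)" by (rule analytic2_cong[OF U T(1) assms(2)[OF g]])
  have "taylor p (T' g) = taylor p (T g)" by (rule taylor_cong[OF U T(1) p assms(2)[OF g]])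
  then show "taylor p (T' g) = F (taylor p g)" using T(2) by simp
qed (use assms(1) in \<open>simp_all add: formal_def\<close>)

lemma formal_id: "formal U p (\<lambda>g. g) (\<lambda>f. f)"
  unfolding formal_def by (simp add: lin_def cont_id)

lemma formal_add: "formal U p T F \<Longrightarrow> formal U p T' F' \<Longrightarrow> formal U p (\<lambda>g q. T g q + T' g q) (\<lambda>f. F f + F' f)"
  unfolding formal_def lin_def by (simp add: cont_add analytic2_add taylor_add[OF U p] U algebra_simps)

lemma formal_mult: "analytic2 U a \<Longrightarrow> formal U p T F \<Longrightarrow> formal U p (\<lambda>g q. a q * T g q) (\<lambda>f. taylor p a * F f)"
  unfolding formal_def lin_def
  by (simp add: cont_comp[OF cont_mult_const] analytic2_mult taylor_mult[OF U p] U distrib_left mult.left_commute)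

lemma formal_0: "formal U p (\<lambda>g q. 0) (\<lambda>f. 0)"
  using formal_mult[OF analytic2_const[OF U, of 0] formal_id] by (simp add: taylor_const)

lemma formal_sum:
  "(\<And>i. i \<in> I \<Longrightarrow> formal U p (T i) (F i)) \<Longrightarrow> formal U p (\<lambda>g q. \<Sum>i\<in>I. T i g q) (\<lambda>f. \<Sum>i\<in>I. F i f)"
  by (induction I rule: infinite_finite_induct) (simp_all add: formal_0 formal_add)

lemma formal_comp: "formal U p T F \<Longrightarrow> formal U p T' F' \<Longrightarrow> formal U p (\<lambda>g. T (T' g)) (\<lambda>f. F (F' f))"
  unfolding formal_def lin_def by (simp add: cont_comp)

lemma formal_dX: "formal U p dX Dx" and formal_dY: "formal U p dY Dy"
  unfolding formal_def lin_def
  by (simp_all add: cont_Dx cont_Dy analytic2_dX analytic2_dY taylor_dX[OF U p] taylor_dY[OF U p] U)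

lemma formal_funpow: "formal U p T F \<Longrightarrow> formal U p T' F' \<Longrightarrow> formal U p (\<lambda>g. (T ^^ n) (T' g)) (\<lambda>f. (F ^^ n) (F' f))"
  by (induction n) (auto intro: formal_comp)

lemma formal_diffop:
  assumes "diffop U T"
  shows "\<exists>F. formal U p T F"
proof -
  obtain a N where a: "\<And>i j. analytic2 U (a i j)"
    "\<And>g q. analytic2 U g \<Longrightarrow> q \<in> U \<Longrightarrow> T g q = (\<Sum>i\<le>N. \<Sum>j\<le>N. a i j q * (dX ^^ i) ((dY ^^ j) g) q)"
    using assms unfolding diffop_def by blast
  have "formal U p (\<lambda>g q. \<Sum>i\<le>N. \<Sum>j\<le>N. a i j q * (dX ^^ i) ((dY ^^ j) g) q)
      (\<lambda>f. \<Sum>i\<le>N. \<Sum>j\<le>N. taylor p (a i j) * (Dx ^^ i) ((Dy ^^ j) f))"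
    by (intro formal_sum formal_mult a formal_funpow[OF formal_dX] formal_funpow[OF formal_dY formal_id])
  then show ?thesis by (intro exI, rule formal_cong) (simp add: a(2))
qed

lemma formal_Hop:
  assumes "analytic2 U u"
  shows "formal U p (Hop u) (\<lambda>f. taylor p u * f - Dx (Dy f))"
proof -
  have "formal U p (\<lambda>g q. (-1) * dX (dY g) q + u q * g q) (\<lambda>f. taylor p (\<lambda>_. -1) * Dx (Dy f) + taylor p u * f)"
    by (intro formal_add formal_mult analytic2_const U assms formal_id formal_comp[OF formal_dX formal_dY])
  moreover have "taylor p (\<lambda>_. -1) = - 1"
    by (simp add: taylor_const cst_def flip: fps_const_neg)
  ultimately show ?thesis by (simp add: Hop_def[abs_def] algebra_simps)
qed

lemma formal_nf:
  assumes "\<And>i. analytic2 U (A i)" "\<And>j. analytic2 U (B j)"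
  shows "formal U p (\<lambda>g q. (\<Sum>i\<le>n. A i q * (dX ^^ i) g q) + (\<Sum>j\<in>{1..m}. B j q * (dY ^^ j) g q))
     (nf (\<lambda>i. taylor p (A i)) n (\<lambda>j. taylor p (B j)) m)"
  unfolding nf_def[abs_def]
  by (intro formal_add formal_sum formal_mult assms formal_funpow[OF formal_dX formal_id] formal_funpow[OF formal_dY formal_id])

lemma formal_polyop:
  assumes "formal U p L1 F1" "formal U p L2 F2"
  shows "formal U p (polyop N b L1 L2) (polyK N b F1 F2)"
proof -
  have "formal U p (\<lambda>g q. \<Sum>r\<le>N. \<Sum>s\<le>N. b r s * (L1 ^^ r) ((L2 ^^ s) g) q)
     (\<lambda>f. \<Sum>r\<le>N. \<Sum>s\<le>N. taylor p (\<lambda>_. b r s) * (F1 ^^ r) ((F2 ^^ s) f))"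
    by (intro formal_sum formal_mult analytic2_const U formal_funpow[OF assms(1)] formal_funpow[OF assms(2) formal_id])
  then show ?thesis by (simp add: polyop_def[abs_def] polyK_def[abs_def] taylor_const)
qed

text \<open>Taylor expansions of polynomials are dense.\<close>

lemma formal_unique:
  assumes F: "formal U p T F" and F': "formal U p T' F'"
    and eq: "\<And>g q. analytic2 U g \<Longrightarrow> q \<in> U \<Longrightarrow> T g q = T' g q"
  shows "F f = F' f"
proof (rule agree_upto_eqI)
  fix k
  obtain l l' where l: "\<And>f g. agree_upto l f g \<Longrightarrow> agree_upto k (F f) (F g)" "\<And>f g. agree_upto l' f g \<Longrightarrow> agree_upto k (F' f) (F' g)"
    using F F' unfolding formal_def cont_def by meson
  define N where "N = l + l'"
  \<comment> \<open>The truncation of \<open>f\<close> as a polynomial function; \<open>N\<close>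
    exceeds both truncation orders \<open>l\<close> and \<open>l'\<close>, so neither
    \<open>F\<close> nor \<open>F'\<close> distinguishes it from \<open>f\<close> up to
    \<open>k\<close>.\<close>
  define g where "g q = (\<Sum>i\<le>N. \<Sum>j\<le>N. cf f i j * (fst q - fst p) ^ i * (snd q - snd p) ^ j)" for q
  have g: "analytic2 U g" unfolding g_def by (rule analytic2_polynomial[OF U])
  have "expands p (ps2_of (\<lambda>i j. if i \<le> N \<and> j \<le> N then cf f i j else 0)) g"
    unfolding g_def by (rule expands_polynomial)
  then have "agree_upto N (taylor p g) f" by (simp add: taylor_eqI agree_upto_def)
  then have "agree_upto l (taylor p g) f" "agree_upto l' (taylor p g) f" by (auto simp: N_def intro: agree_upto_mono)
  then have "agree_upto k (F (taylor p g)) (F f)" "agree_upto k (F' (taylor p g)) (F' f)" using l by blast+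
  moreover have "F (taylor p g) = F' (taylor p g)"
  proof -
    have "taylor p (T' g) = taylor p (T g)"
      by (rule taylor_cong[OF U _ p]) (use F g eq in \<open>auto simp: formal_def\<close>)
    then show ?thesis using F F' g by (simp add: formal_def)
  qed
  ultimately show "agree_upto k (F f) (F' f)" by (simp add: agree_upto_def)
qed

lemma formal_commutator:
  assumes F: "formal U p A F" "formal U p B G" "formal U p P R" "formal U p H K"
    and eq: "opeq U (comm A B) (P \<circ> H)"
  shows "F (G f) - G (F f) = R (K f)"
proof -
  have "F (G f) = R (K f) + G (F f)"
  proof (rule formal_unique[OF formal_comp[OF F(1,2)] formal_add[OF formal_comp[OF F(3,4)] formal_comp[OF F(2,1)]]])
    fix g q assume "analytic2 U g" "q \<in> U"
    then show "A (B g) q = P (H g) q + B (A g) q"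
      using eq unfolding opeq_def comm_def by (simp add: algebra_simps)
  qed
  then show ?thesis by simp
qed

end

text \<open>Formal power series form an integral domain, so one factor has zero Taylor series at a
  point and vanishes on \<open>U\<close> by the identity theorem.\<close>

lemma analytic2_mult_nonzero:
  assumes U: "open U" "connected U" and "analytic2 U f" "analytic2 U g"
    and "\<exists>q\<in>U. f q \<noteq> 0" "\<exists>q\<in>U. g q \<noteq> 0"
  shows "\<exists>q\<in>U. f q * g q \<noteq> 0"
proof (rule ccontr)
  assume z: "\<not> ?thesis"
  obtain q where q: "q \<in> U" using assms(5) by blast
  have "taylor q f * taylor q g = taylor q (\<lambda>_. 0)"
    unfolding taylor_mult[OF U(1) q assms(3,4), symmetric]
    by (rule taylor_cong[OF U(1) analytic2_const[OF U(1)] q]) (use z in auto)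
  then have "taylor q f = 0 \<or> taylor q g = 0" by (simp add: taylor_const)
  then show False using analytic2_eq_0[OF U _ q] assms by blast
qed

section \<open>From formal solutions back to differential operators\<close>

lemma formal_sol_invariant:
  assumes U: "open U" and p: "p \<in> U" and u: "analytic2 U u"
    and F: "formal U p L F" "formal U p P R" and eq: "opeq U (comm L (Hop u)) (P \<circ> Hop u)"
    and \<psi>: "\<psi> \<in> sol (taylor p u)"
  shows "F \<psi> \<in> sol (taylor p u)"
proof -
  have "F 0 = 0" "R 0 = 0" using F lin_0 by (auto simp: formal_def)
  moreover have "taylor p u * \<psi> - Dx (Dy \<psi>) = 0" using \<psi> by (simp add: sol_def)
  ultimately show ?thesis
    using formal_commutator[OF U p F(1) formal_Hop[OF U p u] F(2) formal_Hop[OF U p u] eq, of \<psi>]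
    by (simp add: sol_def)
qed

text \<open>The multiple \<open>S H\<close> annihilates solutions, so only the remainder of the
  division acts on them.\<close>

lemma formal_nf_on_sol:
  assumes U: "open U" and p: "p \<in> U" and u: "analytic2 U u"
    and F: "formal U p T F" and S: "diffop U S" and an: "\<And>i. analytic2 U (A i)" "\<And>j. analytic2 U (B j)"
    and eq: "\<And>g q. analytic2 U g \<Longrightarrow> q \<in> U \<Longrightarrow> T g q =
        S (Hop u g) q + ((\<Sum>i\<le>n. A i q * (dX ^^ i) g q) + (\<Sum>j\<in>{1..m}. B j q * (dY ^^ j) g q))"
    and \<psi>: "\<psi> \<in> sol (taylor p u)"
  shows "F \<psi> = nf (\<lambda>i. taylor p (A i)) n (\<lambda>j. taylor p (B j)) m \<psi>"
proof -
  obtain R where R: "formal U p S R" using formal_diffop[OF U p S] by blast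
  have "F \<psi> = R (taylor p u * \<psi> - Dx (Dy \<psi>)) + nf (\<lambda>i. taylor p (A i)) n (\<lambda>j. taylor p (B j)) m \<psi>"
    by (rule formal_unique[OF U p F formal_add[OF U p formal_comp[OF U p R formal_Hop[OF U p u]] formal_nf[OF U p an]]])
       (rule eq)
  moreover have "taylor p u * \<psi> - Dx (Dy \<psi>) = 0" using \<psi> by (simp add: sol_def)
  moreover have "R 0 = 0" using R lin_0 by (auto simp: formal_def)
  ultimately show ?thesis by simp
qed

theorem theorem7:
  fixes U :: "(complex \<times> complex) set"
    and u :: "complex \<times> complex \<Rightarrow> complex"
    and L1 L2 P0 P1 P2 :: op2
  assumes "open U" and "connected U" and "U \<noteq> {}"
    and "analytic2 U u"
    and "diffop U L1" and "diffop U L2"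
    and "diffop U P0" and "diffop U P1" and "diffop U P2"
    and "opeq U (comm L1 L2) (P0 \<circ> Hop u)"
    and "opeq U (comm L1 (Hop u)) (P1 \<circ> Hop u)"
    and "opeq U (comm L2 (Hop u)) (P2 \<circ> Hop u)"
  shows "\<exists>(N :: nat) (b :: nat \<Rightarrow> nat \<Rightarrow> complex) (S :: op2).
           (\<exists>r\<le>N. \<exists>s\<le>N. b r s \<noteq> 0) \<and> diffop U S \<and>
           opeq U (polyop N b L1 L2) (S \<circ> Hop u)"
proof -
  note U = assms(1,2) and u = assms(4)
  obtain S1 A1 n1 B1 m1 where N1: "diffop U S1" "\<And>i. analytic2 U (A1 i)" "\<And>j. analytic2 U (B1 j)"
    "n1 = 0 \<or> (\<exists>q\<in>U. A1 n1 q \<noteq> 0)" "m1 = 0 \<or> (\<exists>q\<in>U. B1 m1 q \<noteq> 0)"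
    "\<And>g q. analytic2 U g \<Longrightarrow> q \<in> U \<Longrightarrow> L1 g q =
        S1 (Hop u g) q + ((\<Sum>i\<le>n1. A1 i q * (dX ^^ i) g q) + (\<Sum>j\<in>{1..m1}. B1 j q * (dY ^^ j) g q))"
    by (rule normal_form_exists[OF U(1) u assms(5)], rule that)
  obtain S2 A2 n2 B2 m2 where N2: "diffop U S2" "\<And>i. analytic2 U (A2 i)" "\<And>j. analytic2 U (B2 j)"
    "n2 = 0 \<or> (\<exists>q\<in>U. A2 n2 q \<noteq> 0)" "m2 = 0 \<or> (\<exists>q\<in>U. B2 m2 q \<noteq> 0)"
    "\<And>g q. analytic2 U g \<Longrightarrow> q \<in> U \<Longrightarrow> L2 g q =
        S2 (Hop u g) q + ((\<Sum>i\<le>n2. A2 i q * (dX ^^ i) g q) + (\<Sum>j\<in>{1..m2}. B2 j q * (dY ^^ j) g q))"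
    by (rule normal_form_exists[OF U(1) u assms(6)], rule that)
  \<comment> \<open>In order zero the constant \<open>1\<close> replaces the leading coefficient,
    which may vanish identically then; a single product thus handles all cases.\<close>
  define lead where "lead C n = (if n = 0 then (\<lambda>_. 1) else C n)"
    for C :: "nat \<Rightarrow> complex \<times> complex \<Rightarrow> complex" and n :: nat
  have lead: "analytic2 U (lead C n)" "\<exists>q\<in>U. lead C n q \<noteq> 0"
    if "\<And>i. analytic2 U (C i)" "n = 0 \<or> (\<exists>q\<in>U. C n q \<noteq> 0)" for C n
    using that analytic2_const[OF U(1)] assms(3) by (auto simp: lead_def)
  note l = lead[of A1 n1, OF N1(2,4)] lead[of B1 m1, OF N1(3,5)] lead[of A2 n2, OF N2(2,4)] lead[of B2 m2, OF N2(3,5)]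
  obtain p where p: "p \<in> U" "lead A1 n1 p * lead B1 m1 p * (lead A2 n2 p * lead B2 m2 p) \<noteq> 0"
    using analytic2_mult_nonzero[OF U analytic2_mult[OF U(1) l(1,3)] analytic2_mult[OF U(1) l(5,7)]
        analytic2_mult_nonzero[OF U l(1,3,2,4)] analytic2_mult_nonzero[OF U l(5,7,6,8)]] by blast
  have nz: "n1 = 0 \<or> A1 n1 p \<noteq> 0" "m1 = 0 \<or> B1 m1 p \<noteq> 0" "n2 = 0 \<or> A2 n2 p \<noteq> 0" "m2 = 0 \<or> B2 m2 p \<noteq> 0"
    using p(2) by (auto simp: lead_def)
  obtain F1 F2 R0 R1 R2 where F: "formal U p L1 F1" "formal U p L2 F2" "formal U p P0 R0" "formal U p P1 R1" "formal U p P2 R2"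
    using formal_diffop[OF U(1) p(1)] assms(5-9) by metis
  define v where "v = taylor p u"
  have sol: "F1 \<psi> \<in> sol v" "F2 \<psi> \<in> sol v" if "\<psi> \<in> sol v" for \<psi>
    using that unfolding v_def
    by (rule formal_sol_invariant[OF U(1) p(1) u F(1,4) assms(11)], rule formal_sol_invariant[OF U(1) p(1) u F(2,5) assms(12)])
  have comm: "F1 (F2 \<psi>) = F2 (F1 \<psi>)" if "\<psi> \<in> sol v" for \<psi>
  proof -
    have "v * \<psi> - Dx (Dy \<psi>) = 0" using that by (simp add: sol_def)
    moreover have "R0 0 = 0" using F(3) lin_0 by (auto simp: formal_def)
    ultimately show ?thesis
      using formal_commutator[OF U(1) p(1) F(1,2,3) formal_Hop[OF U(1) p(1) u] assms(10), of \<psi>] by (simp add: v_def)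
  qed
  have "lin F1" "lin F2" using F by (auto simp: formal_def)
  then have "\<exists>N b. (\<exists>r\<le>N. \<exists>s\<le>N. b r s \<noteq> 0) \<and> (\<forall>\<psi>\<in>sol v. polyK N b F1 F2 \<psi> = 0)"
    by (rule algebraic_dependence_formal[OF _ _ sol comm
          formal_nf_on_sol[where A = A1 and n = n1 and B = B1 and m = m1, OF U(1) p(1) u F(1) N1(1,2,3,6), folded v_def]
          formal_nf_on_sol[where A = A2 and n = n2 and B = B2 and m = m2, OF U(1) p(1) u F(2) N2(1,2,3,6), folded v_def]])
       (use nz in auto)
  then obtain N b where b: "\<exists>r\<le>N. \<exists>s\<le>N. b r s \<noteq> 0" "\<And>\<psi>. \<psi> \<in> sol v \<Longrightarrow> polyK N b F1 F2 \<psi> = 0" by blast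
  \<comment> \<open>Division of the polynomial in \<open>L1\<close> and \<open>L2\<close> by
    \<open>H\<close>. Its remainder kills all formal solutions at \<open>p\<close>, so its
    coefficients have zero Taylor series there and vanish on \<open>U\<close>; the quotient
    \<open>S\<close> is the desired factor.\<close>
  obtain S A n B m where N: "diffop U S" "\<And>i. analytic2 U (A i)" "\<And>j. analytic2 U (B j)"
    "\<And>g q. analytic2 U g \<Longrightarrow> q \<in> U \<Longrightarrow> polyop N b L1 L2 g q =
        S (Hop u g) q + ((\<Sum>i\<le>n. A i q * (dX ^^ i) g q) + (\<Sum>j\<in>{1..m}. B j q * (dY ^^ j) g q))"
    by (rule normal_form_exists[OF U(1) u diffop_polyop[OF U(1) assms(5,6)]], rule that)
  have "nf (\<lambda>i. taylor p (A i)) n (\<lambda>j. taylor p (B j)) m \<psi> = 0" if "\<psi> \<in> sol v" for \<psi>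
    using formal_nf_on_sol[where A = A and n = n and B = B and m = m, OF U(1) p(1) u formal_polyop[OF U(1) p(1) F(1,2)] N, of \<psi>] b(2)[OF that] that
    by (simp add: v_def)
  then have "(\<forall>i\<le>n. taylor p (A i) = 0) \<and> (\<forall>j\<in>{1..m}. taylor p (B j) = 0)"
    unfolding nf_def by (rule normal_form_free)
  then have "\<And>i q. i \<le> n \<Longrightarrow> q \<in> U \<Longrightarrow> A i q = 0" "\<And>j q. j \<in> {1..m} \<Longrightarrow> q \<in> U \<Longrightarrow> B j q = 0"
    using analytic2_eq_0[OF U N(2) p(1)] analytic2_eq_0[OF U N(3) p(1)] by blast+
  then have "opeq U (polyop N b L1 L2) (S \<circ> Hop u)"
    unfolding opeq_def by (auto simp: N(4) intro!: sum.neutral)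
  then show ?thesis using b(1) N(1) by blast
qed

end
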